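(* Let $H(K)$ be a separable reproducing kernel Hilbert space of complex-valued functions on a subset $D\subset\mathbb{R}^d$ such that the positive semidefinite kernel $K:D\times D\to\mathbb{C}$ satisfies $\sup_{\mathbf{x}\in D}K(\mathbf{x},\mathbf{x})<\infty$. Let $\varrho_D$ be a probability measure on $D$. For $n\in\mathbb{N}$ and $\delta\in(0,1/3)$ let $m\in\mathbb{N}$ be such that $$N(m):=\sup_{\mathbf{x}\in D}\sum_{k=1}^{m-1}\sigma_k^{-2}|e_k(\mathbf{x})|^2\le\frac{n}{48(\sqrt{2}\log(2n)-\log\delta)}.$$ Then the least squares reconstruction operator $S^m_{\mathbf{X}}$, which uses samples at $n$ nodes $\mathbf{X}=(\mathbf{x}^1,\dots,\mathbf{x}^n)$ drawn i.i.d. according to $\varrho_D$, satisfies $$\mathbb{P}\left(\sup_{\|f\|_{H(K)}\le1}\|f-S^m_{\mathbf{X}}f\|^2_{L_2(D,\varrho_D)}\le\frac{29}{\delta}\max\Big\{\sigma_m^2,\frac{\log(8n)}{n}T(m)\Big\}\right)\ge1-3\delta,$$ where $T(m):=\sup_{\mathbf{x}\in D}\sum_{k=m}^{\infty}|e_k(\mathbf{x})|^2$.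
   Context: $\log$ is the natural logarithm. $H(K)$ is the Hilbert space with $f(\mathbf{x})=\langle f,K(\cdot,\mathbf{x})\rangle_{H(K)}$; its elements are assumed measurable so that the embedding $\mathrm{Id}:H(K)\to L_2(D,\varrho_D)$ is defined (it is compact under the assumptions). Standing assumption: $H(K)$ is infinite dimensional. $\lambda_1\ge\lambda_2\ge\dots>0$ denote the positive eigenvalues of $\mathrm{Id}^*\circ\mathrm{Id}:H(K)\to H(K)$ (an infinite sequence, as in the paper's notation), $(e_k)_{k\in\mathbb{N}}$ the corresponding eigenfunctions, orthonormal in $H(K)$, and $\sigma_k:=\sqrt{\lambda_k}$ the singular numbers of $\mathrm{Id}$. Put $\eta_k:=\lambda_k^{-1/2}e_k$; $(\eta_k)_k$ is orthonormal in $L_2(D,\varrho_D)$. Least squares operator: for nodes $\mathbf{X}=(\mathbf{x}^1,\dots,\mathbf{x}^n)$ let $\mathbf{L}_m:=(\eta_k(\mathbf{x}^j))_{j=1,\dots,n;\,k=1,\dots,m-1}\in\mathbb{C}^{n\times(m-1)}$. If $\mathbf{L}_m$ has full column rank, set $(c_1,\dots,c_{m-1})^\top:=(\mathbf{L}_m^*\mathbf{L}_m)^{-1}\mathbf{L}_m^*(f(\mathbf{x}^1),\dots,f(\mathbf{x}^n))^\top$ and $S^m_{\mathbf{X}}f:=\sum_{k=1}^{m-1}c_k\eta_k$. The event in the probability is understood to include that $\mathbf{L}_m$ has full column rank. *)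

theory Defs
  imports
    "HOL-Probability.Probability"
    "HOL-Library.Function_Algebras"
    "Jordan_Normal_Form.DL_Rank"
    "Jordan_Normal_Form.Schur_Decomposition"
    "Jordan_Normal_Form.Gauss_Jordan_Elimination"
begin

text \<open>
  Complex-valued functions on a subset \<open>D\<close> of a type are represented by their extension by zero to
  the whole type.  Sequences \<open>\<lambda>\<^sub>k\<close>, \<open>e\<^sub>k\<close>, \<open>\<eta>\<^sub>k\<close> and node families are indexed from 1; the value at
  index 0 is never used.
\<close>

abbreviation fun_scale :: "complex \<Rightarrow> ('a \<Rightarrow> complex) \<Rightarrow> 'a \<Rightarrow> complex" where
  "fun_scale c f \<equiv> (\<lambda>x. c * f x)"

abbreviation fun_span :: "('a \<Rightarrow> complex) set \<Rightarrow> ('a \<Rightarrow> complex) set" where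
  "fun_span \<equiv> Modules.module.span fun_scale"

abbreviation fun_subspace :: "('a \<Rightarrow> complex) set \<Rightarrow> bool" where
  "fun_subspace \<equiv> Modules.module.subspace fun_scale"

subsection \<open>Hilbert spaces of functions\<close>

definition ip_norm :: "(('a \<Rightarrow> complex) \<Rightarrow> ('a \<Rightarrow> complex) \<Rightarrow> complex) \<Rightarrow> ('a \<Rightarrow> complex) \<Rightarrow> real" where
  "ip_norm ip f = sqrt (Re (ip f f))"

text \<open>
  The locale \<open>Metric_space\<close> requires nonnegativity and symmetry also outside its carrier, where
  nothing is known about \<open>ip\<close>; hence the case distinction.
\<close>

definition ip_dist ::
  "('a \<Rightarrow> complex) set \<Rightarrow> (('a \<Rightarrow> complex) \<Rightarrow> ('a \<Rightarrow> complex) \<Rightarrow> complex) \<Rightarrow>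
   ('a \<Rightarrow> complex) \<Rightarrow> ('a \<Rightarrow> complex) \<Rightarrow> real" where
  "ip_dist H ip f g = (if f \<in> H \<and> g \<in> H then ip_norm ip (f - g) else 0)"

locale function_hilbert_space =
  fixes H :: "('a \<Rightarrow> complex) set"
    and ip :: "('a \<Rightarrow> complex) \<Rightarrow> ('a \<Rightarrow> complex) \<Rightarrow> complex"
  assumes subspace: "fun_subspace H"
    and ip_add: "\<lbrakk>f \<in> H; g \<in> H; h \<in> H\<rbrakk> \<Longrightarrow> ip (f + g) h = ip f h + ip g h"
    and ip_scale: "\<lbrakk>f \<in> H; h \<in> H\<rbrakk> \<Longrightarrow> ip (fun_scale c f) h = c * ip f h"
    and ip_commute: "\<lbrakk>f \<in> H; g \<in> H\<rbrakk> \<Longrightarrow> ip g f = cnj (ip f g)"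
    and ip_nonneg: "f \<in> H \<Longrightarrow> 0 \<le> Re (ip f f)"
    and ip_definite: "\<lbrakk>f \<in> H; ip f f = 0\<rbrakk> \<Longrightarrow> f = 0"
    and complete: "Metric_space.mcomplete H (ip_dist H ip)"

definition separable_ip ::
  "('a \<Rightarrow> complex) set \<Rightarrow> (('a \<Rightarrow> complex) \<Rightarrow> ('a \<Rightarrow> complex) \<Rightarrow> complex) \<Rightarrow> bool" where
  "separable_ip H ip \<longleftrightarrow> separable_space (Metric_space.mtopology H (ip_dist H ip))"

definition infinite_dimensional :: "('a \<Rightarrow> complex) set \<Rightarrow> bool" where
  "infinite_dimensional H \<longleftrightarrow> \<not> (\<exists>B. finite B \<and> H \<subseteq> fun_span B)"

subsection \<open>Reproducing kernels\<close>

definition psd_kernel :: "'a set \<Rightarrow> ('a \<Rightarrow> 'a \<Rightarrow> complex) \<Rightarrow> bool" where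
  "psd_kernel D K \<longleftrightarrow>
     (\<forall>S c. finite S \<and> S \<subseteq> D \<longrightarrow> (\<Sum>x\<in>S. \<Sum>y\<in>S. cnj (c x) * c y * K x y) \<in> \<real>\<^sub>\<ge>\<^sub>0)"

definition kernel_section :: "'a set \<Rightarrow> ('a \<Rightarrow> 'a \<Rightarrow> complex) \<Rightarrow> 'a \<Rightarrow> 'a \<Rightarrow> complex" where
  "kernel_section D K x = (\<lambda>y. if y \<in> D then K y x else 0)"

text \<open>
  By the Moore--Aronszajn theorem the pair \<open>(H, ip)\<close> is determined (on \<open>H\<close>) by \<open>D\<close> and \<open>K\<close>.
\<close>

locale rkhs = function_hilbert_space H ip
  for D :: "'a set" and K :: "'a \<Rightarrow> 'a \<Rightarrow> complex"
    and H :: "('a \<Rightarrow> complex) set"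
    and ip :: "('a \<Rightarrow> complex) \<Rightarrow> ('a \<Rightarrow> complex) \<Rightarrow> complex" +
  assumes vanish_outside: "\<lbrakk>f \<in> H; x \<notin> D\<rbrakk> \<Longrightarrow> f x = 0"
    and kernel_section_in: "x \<in> D \<Longrightarrow> kernel_section D K x \<in> H"
    and reproducing: "\<lbrakk>f \<in> H; x \<in> D\<rbrakk> \<Longrightarrow> f x = ip f (kernel_section D K x)"

subsection \<open>The embedding into \<open>L\<^sub>2\<close> and its singular system\<close>

definition L2_ip :: "'a measure \<Rightarrow> ('a \<Rightarrow> complex) \<Rightarrow> ('a \<Rightarrow> complex) \<Rightarrow> complex" where
  "L2_ip \<rho> f g = (LINT x|\<rho>. f x * cnj (g x))"

text \<open>
  The Hilbert space adjoint of the embedding of \<open>H\<close> into \<open>L\<^sub>2(\<rho>)\<close>.  Elements of \<open>L\<^sub>2(\<rho>)\<close> are given by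
  representatives, and the embedding itself sends \<open>f\<close> to \<open>f\<close>.
\<close>

definition embedding_adjoint ::
  "('a \<Rightarrow> complex) set \<Rightarrow> (('a \<Rightarrow> complex) \<Rightarrow> ('a \<Rightarrow> complex) \<Rightarrow> complex) \<Rightarrow> 'a measure \<Rightarrow>
   ('a \<Rightarrow> complex) \<Rightarrow> ('a \<Rightarrow> complex)" where
  "embedding_adjoint H ip \<rho> u = (THE h. h \<in> H \<and> (\<forall>f\<in>H. ip f h = L2_ip \<rho> f u))"

definition embedding :: "('a \<Rightarrow> complex) \<Rightarrow> ('a \<Rightarrow> complex)" where
  "embedding f = f"

definition embedding_gram ::
  "('a \<Rightarrow> complex) set \<Rightarrow> (('a \<Rightarrow> complex) \<Rightarrow> ('a \<Rightarrow> complex) \<Rightarrow> complex) \<Rightarrow> 'a measure \<Rightarrow>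
   ('a \<Rightarrow> complex) \<Rightarrow> ('a \<Rightarrow> complex)" where
  "embedding_gram H ip \<rho> = embedding_adjoint H ip \<rho> \<circ> embedding"

text \<open>
  The last clause says that the sequence lists all positive eigenvalues, each repeated according to
  its multiplicity.  Eigenspaces for positive eigenvalues are finite-dimensional because the embedding
  is compact for bounded kernels, so the algebraic span is the right one.
\<close>

definition embedding_eigensystem ::
  "('a \<Rightarrow> complex) set \<Rightarrow> (('a \<Rightarrow> complex) \<Rightarrow> ('a \<Rightarrow> complex) \<Rightarrow> complex) \<Rightarrow> 'a measure \<Rightarrow>
   (nat \<Rightarrow> real) \<Rightarrow> (nat \<Rightarrow> 'a \<Rightarrow> complex) \<Rightarrow> bool" where
  "embedding_eigensystem H ip \<rho> lam e \<longleftrightarrow>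
     (\<forall>k\<ge>1. 0 < lam k \<and> lam (Suc k) \<le> lam k) \<and>
     (\<forall>k\<ge>1. e k \<in> H) \<and>
     (\<forall>j\<ge>1. \<forall>k\<ge>1. ip (e j) (e k) = (if j = k then 1 else 0)) \<and>
     (\<forall>k\<ge>1. embedding_gram H ip \<rho> (e k) = fun_scale (complex_of_real (lam k)) (e k)) \<and>
     (\<forall>\<mu>>0. {g \<in> H. embedding_gram H ip \<rho> g = fun_scale (complex_of_real \<mu>) g}
              = fun_span {e k |k. 1 \<le> k \<and> lam k = \<mu>})"

definition singular_number :: "(nat \<Rightarrow> real) \<Rightarrow> nat \<Rightarrow> real" where
  "singular_number lam k = sqrt (lam k)"

definition L2_normalized :: "(nat \<Rightarrow> real) \<Rightarrow> (nat \<Rightarrow> 'a \<Rightarrow> complex) \<Rightarrow> nat \<Rightarrow> 'a \<Rightarrow> complex" where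
  "L2_normalized lam e k = fun_scale (complex_of_real (lam k powr (-1/2))) (e k)"

text \<open>
  For a bounded kernel, both suprema below are over sets bounded by multiples of \<open>sup\<^sub>x K(x,x)\<close>, and
  the series converges, both by Bessel's inequality applied to \<open>K(\<cdot>,x)\<close>.
\<close>

definition spectral_N :: "'a set \<Rightarrow> (nat \<Rightarrow> real) \<Rightarrow> (nat \<Rightarrow> 'a \<Rightarrow> complex) \<Rightarrow> nat \<Rightarrow> real" where
  "spectral_N D lam e m =
     (SUP x\<in>D. \<Sum>k=1..m-1. (cmod (e k x))\<^sup>2 / (singular_number lam k)\<^sup>2)"

definition spectral_T :: "'a set \<Rightarrow> (nat \<Rightarrow> 'a \<Rightarrow> complex) \<Rightarrow> nat \<Rightarrow> real" where
  "spectral_T D e m = (SUP x\<in>D. \<Sum>k. (cmod (e (m + k) x))\<^sup>2)"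

subsection \<open>Least squares reconstruction\<close>

text \<open>Matrix and vector indices start at 0, nodes and basis functions at 1.\<close>

definition lsq_matrix :: "(nat \<Rightarrow> 'a \<Rightarrow> complex) \<Rightarrow> nat \<Rightarrow> nat \<Rightarrow> (nat \<Rightarrow> 'a) \<Rightarrow> complex Matrix.mat" where
  "lsq_matrix \<eta> m n X = Matrix.mat n (m - 1) (\<lambda>(j, k). \<eta> (Suc k) (X (Suc j)))"

definition full_column_rank :: "complex Matrix.mat \<Rightarrow> bool" where
  "full_column_rank A \<longleftrightarrow> vec_space.rank (dim_row A) A = dim_col A"

definition lsq_coeffs ::
  "(nat \<Rightarrow> 'a \<Rightarrow> complex) \<Rightarrow> nat \<Rightarrow> nat \<Rightarrow> (nat \<Rightarrow> 'a) \<Rightarrow> ('a \<Rightarrow> complex) \<Rightarrow> complex Matrix.vec" where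
  "lsq_coeffs \<eta> m n X f =
     (let L = lsq_matrix \<eta> m n X in
      (the (mat_inverse (mat_adjoint L * L)) * mat_adjoint L) *\<^sub>v Matrix.vec n (\<lambda>j. f (X (Suc j))))"

definition lsq_operator ::
  "(nat \<Rightarrow> 'a \<Rightarrow> complex) \<Rightarrow> nat \<Rightarrow> nat \<Rightarrow> (nat \<Rightarrow> 'a) \<Rightarrow> ('a \<Rightarrow> complex) \<Rightarrow> 'a \<Rightarrow> complex" where
  "lsq_operator \<eta> m n X f =
     (\<lambda>x. \<Sum>k=1..m-1. vec_index (lsq_coeffs \<eta> m n X f) (k - 1) * \<eta> k x)"

text \<open>The squared \<open>L\<^sub>2\<close> norm is taken in \<open>[0,\<infinity>]\<close>, so that its supremum is the true one without any
  boundedness condition.\<close>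

definition L2_norm_sq :: "'a measure \<Rightarrow> ('a \<Rightarrow> complex) \<Rightarrow> ennreal" where
  "L2_norm_sq \<rho> g = (\<integral>\<^sup>+x. ennreal ((cmod (g x))\<^sup>2) \<partial>\<rho>)"

definition lsq_worst_error_sq ::
  "('a \<Rightarrow> complex) set \<Rightarrow> (('a \<Rightarrow> complex) \<Rightarrow> ('a \<Rightarrow> complex) \<Rightarrow> complex) \<Rightarrow> 'a measure \<Rightarrow>
   (nat \<Rightarrow> 'a \<Rightarrow> complex) \<Rightarrow> nat \<Rightarrow> nat \<Rightarrow> (nat \<Rightarrow> 'a) \<Rightarrow> ennreal" where
  "lsq_worst_error_sq H ip \<rho> \<eta> m n X =
     (SUP f\<in>{f \<in> H. ip_norm ip f \<le> 1}. L2_norm_sq \<rho> (f - lsq_operator \<eta> m n X f))"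

end

theory Submission
  imports Defs
begin

text \<open>
  Let \<open>\<parallel>f\<parallel> \<le> 1\<close> and \<open>g = f - P f\<close>, where \<open>P\<close> is the orthogonal projection of \<open>H\<close> onto the span of
  \<open>e\<^sub>1, \<dots>, e\<^bsub>m-1\<^esub>\<close>.  Least squares reproduces this span, so \<open>f - S f = g - S g\<close>; and \<open>g\<close> is also
  orthogonal to it in \<open>L\<^sub>2\<close>, so the squared error is \<open>\<parallel>g\<parallel>\<^sup>2 + \<parallel>S g\<parallel>\<^sup>2\<close>.  The first term is at most
  \<open>\<lambda>\<^sub>m\<close> by the variational characterisation of the eigenvalues (\<open>L2_norm_le_on_orth\<close>).  If the smallest
  eigenvalue of \<open>L\<^sup>* L\<close> is at least \<open>n/2\<close>, then the normal equations bound the second term by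
  \<open>2/n\<close> times the sum of the \<open>|g(x\<^sub>j)|\<^sup>2\<close> (\<open>lsq_stability\<close>), and that sum is at most \<open>s\<close> if the sampled
  tail matrix \<open>\<Sum>\<^sub>j y\<^sub>j y\<^sub>j\<^sup>*\<close>, \<open>y\<^sub>j = (e\<^sub>k(x\<^sub>j))\<close> with \<open>k \<ge> m\<close>, has norm at most \<open>s\<close>.  With \<open>M\<close> the
  maximum in the theorem, \<open>s = 14 n M / \<delta>\<close> gives the total \<open>\<lambda>\<^sub>m + 28 M / \<delta> \<le> 29 M / \<delta>\<close>.

  What remains are a lower tail and an upper tail estimate for the extreme eigenvalues of a sum of
  independent random rank-one matrices (\<open>lower_tail\<close>, \<open>upper_tail\<close>); each of the two events fails
  with probability at most \<open>\<delta>\<close>.  As in the Laplace transform method one controls the expectation of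
  a trace that is large when an eigenvalue is extreme, but instead of the exponential of
  \<open>\<plusminus> \<tau> \<Sum>\<^sub>j y\<^sub>j y\<^sub>j\<^sup>*\<close> the high power \<open>B\<^sup>p\<close> of \<open>B = 1 \<plusminus> \<theta> \<Sum>\<^sub>j y\<^sub>j y\<^sub>j\<^sup>*\<close> with \<open>p \<theta> = \<tau>\<close> is used.
  The gain is that the effect of one new sample can be estimated by elementary means.  For a positive
  operator \<open>A\<close> the moments \<open>a\<^sub>k = \<langle>A\<^sup>k y, y\<rangle>\<close> are logarithmically convex, hence \<open>a\<^sub>i a\<^sub>j \<le> a\<^sub>0 a\<^bsub>i+j\<^esub>\<close>
  (\<open>mom_supermult\<close>), and this yields
  \<open>\<langle>(A + \<theta> y y\<^sup>*)\<^sup>q y, y\<rangle> \<le> (1 + \<theta> T / c)\<^sup>q \<langle>A\<^sup>q y, y\<rangle>\<close> whenever \<open>A \<ge> c\<close> and \<open>\<parallel>y\<parallel>\<^sup>2 \<le> T\<close> (\<open>mom_B_le\<close>).  This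
  inequality does the work of the Golden--Thompson inequality.  Averaging over the new sample replaces
  \<open>y y\<^sup>*\<close> by its diagonal expectation, and the expected trace obeys a one-step recursion
  (\<open>upper_step\<close>, \<open>lower_step\<close>).  In the upper estimate it is \<open>tr B\<^sup>p - tr 1\<close> that is
  followed, and the trace of \<open>\<Sum>\<^sub>j y\<^sub>j y\<^sub>j\<^sup>*\<close> is at most \<open>n T\<close>; so the bound is free of the dimension,
  only \<open>log n\<close> enters, and finite truncations of the tail can be exhausted.

  The functional analysis is needed for three purposes: to turn the eigenvalue equation into
  \<open>\<langle>f, e\<^sub>k\<rangle>\<^bsub>L2\<^esub> = \<lambda>\<^sub>k \<langle>f, e\<^sub>k\<rangle>\<^bsub>H\<^esub>\<close>, which requires the adjoint to exist (\<open>riesz\<close>); to show that the listed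
  eigenvalues exhaust the embedding, by maximising the \<open>L\<^sub>2\<close> norm on orthogonal complements (\<open>maximizer\<close>);
  and to show that for almost every \<open>x\<close> all \<open>f\<close> in \<open>H\<close> simultaneously satisfy
  \<open>f(x) = \<Sum>\<^sub>k \<langle>f, e\<^sub>k\<rangle> e\<^sub>k(x)\<close>, so that the kernel of the embedding is invisible at the nodes
  (\<open>AE_expansion\<close>).  The last step and the measurability of the event both rest on separability.
\<close>

section \<open>Moments of positive operators\<close>

lemma Re_mult_cnj: "Re (z * cnj z) = (cmod z)\<^sup>2"
  by (simp add: complex_norm_square[symmetric] del: of_real_power)

text \<open>
  The Cauchy--Schwarz inequality as a statement about the coefficients of a nonnegative quadratic
  polynomial in a complex parameter.  It is applied to several positive semidefinite forms.  With
  \<open>\<alpha> = 0\<close> it says that a minimiser of such a form annihilates the linear term.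
\<close>

lemma quadratic_form_CS:
  fixes \<alpha> \<gamma> :: real and \<beta> :: complex
  assumes "0 \<le> \<alpha>" "0 \<le> \<gamma>" and pos: "\<And>t. 0 \<le> \<alpha> + 2 * Re (t * \<beta>) + (cmod t)\<^sup>2 * \<gamma>"
  shows "(cmod \<beta>)\<^sup>2 \<le> \<alpha> * \<gamma>"
proof -
  have *: "0 \<le> \<alpha> - 2 * s * (cmod \<beta>)\<^sup>2 + s\<^sup>2 * (cmod \<beta>)\<^sup>2 * \<gamma>" for s :: real
  proof -
    have 1: "Re (complex_of_real (- s) * cnj \<beta> * \<beta>) = - s * (cmod \<beta>)\<^sup>2"
      using Re_mult_cnj[of \<beta>] by (simp only: mult.assoc mult.commute[of "cnj \<beta>"]) simp
    have 2: "(cmod (complex_of_real (- s) * cnj \<beta>))\<^sup>2 = s\<^sup>2 * (cmod \<beta>)\<^sup>2"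
      by (simp add: norm_mult power_mult_distrib)
    show ?thesis using pos[of "complex_of_real (- s) * cnj \<beta>"] unfolding 1 2 by simp
  qed
  show ?thesis
  proof (cases "\<gamma> = 0")
    case True
    have "(cmod \<beta>)\<^sup>2 = 0"
    proof (rule ccontr)
      assume "(cmod \<beta>)\<^sup>2 \<noteq> 0"
      then have "0 < (cmod \<beta>)\<^sup>2" by simp
      with *[of "(\<alpha> + 1) / (2 * (cmod \<beta>)\<^sup>2)"] True assms(1) show False
        by (simp add: field_simps)
    qed
    with True show ?thesis by simp
  next
    case False
    with assms(2) have g: "0 < \<gamma>" by simp
    have "0 \<le> \<alpha> - (cmod \<beta>)\<^sup>2 / \<gamma>"
      using *[of "1 / \<gamma>"] g by (simp add: field_simps power2_eq_square)
    with g show ?thesis by (simp add: field_simps)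
  qed
qed

text \<open>
  The ratios of consecutive terms increase, so passing from \<open>a 0\<close> to \<open>a i\<close> multiplies by at most as much as
  passing from \<open>a j\<close> to \<open>a (i + j)\<close>.  If a term vanishes, then so do all terms except possibly \<open>a 0\<close>.
\<close>

lemma log_convex_supermult:
  fixes a :: "nat \<Rightarrow> real"
  assumes nonneg: "\<And>k. 0 \<le> a k" and lc: "\<And>k. (a (Suc k))\<^sup>2 \<le> a k * a (Suc (Suc k))"
  shows "a i * a j \<le> a 0 * a (i + j)"
proof (cases "\<exists>k. a k = 0")
  case True
  then obtain k0 where k0: "a k0 = 0" ..
  have up: "a (k + n) = 0" if "a k = 0" for k n
  proof (induction n)
    case (Suc n)
    with lc[of "k + n"] show ?case by simp
  qed (use that in simp)
  have "a 1 = 0"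
  proof -
    have "a (Suc k) = 0 \<Longrightarrow> a 1 = 0" for k
    proof (induction k)
      case (Suc k)
      with lc[of k] show ?case by simp
    qed simp
    with up[OF k0, of 1] show ?thesis by simp
  qed
  then have z: "a k = 0" if "k > 0" for k using up[of 1 "k - 1"] that by simp
  show ?thesis using z[of i] z[of j] nonneg by (cases "i = 0"; cases "j = 0") auto
next
  case False
  with nonneg have pos: "0 < a k" for k by (metis order_le_less)
  have ratio: "a (Suc k) / a k \<le> a (Suc (k + n)) / a (k + n)" for k n
  proof (induction n)
    case (Suc n)
    have "a (Suc (k + n)) / a (k + n) \<le> a (Suc (k + Suc n)) / a (k + Suc n)"
      using lc[of "k + n"] pos[of "k + n"] pos[of "Suc (k + n)"]
      by (simp add: divide_simps power2_eq_square mult.commute)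
    with Suc show ?case by linarith
  qed simp
  show ?thesis
  proof (induction i)
    case (Suc i)
    have "a (Suc i) * a j = a (Suc i) / a i * (a i * a j)" using pos[of i] by simp
    also have "\<dots> \<le> a (Suc (i + j)) / a (i + j) * (a 0 * a (i + j))"
      by (intro mult_mono ratio Suc.IH) (simp_all add: less_imp_le[OF pos])
    also have "\<dots> = a 0 * a (Suc i + j)" using pos[of "i + j"] by simp
    finally show ?case .
  qed simp
qed

text \<open>
  Vectors of length \<open>d\<close> are functions on the natural numbers of which only the first \<open>d\<close> values count;
  this lets \<open>d\<close> vary inside proofs.  Operators are arbitrary functions on such vectors: being Hermitian
  for \<open>dot d\<close> makes them linear as far as \<open>dot d\<close> can see.
\<close>

definition dot :: "nat \<Rightarrow> (nat \<Rightarrow> complex) \<Rightarrow> (nat \<Rightarrow> complex) \<Rightarrow> complex" where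
  "dot d u v = (\<Sum>i<d. u i * cnj (v i))"

lemma dot_add_left: "dot d (\<lambda>i. u i + v i) w = dot d u w + dot d v w"
  by (simp add: dot_def algebra_simps sum.distrib)

lemma dot_scale_left: "dot d (\<lambda>i. c * u i) w = c * dot d u w"
  by (simp add: dot_def algebra_simps sum_distrib_left)

lemma dot_commute: "dot d v u = cnj (dot d u v)"
  by (simp add: dot_def algebra_simps)

lemma dot_add_right: "dot d w (\<lambda>i. u i + v i) = dot d w u + dot d w v"
  by (simp add: dot_def algebra_simps sum.distrib)

lemma dot_scale_right: "dot d w (\<lambda>i. c * u i) = cnj c * dot d w u"
  by (simp add: dot_def algebra_simps sum_distrib_left)

lemma dot_sum_left: "dot d (\<lambda>i. \<Sum>j\<in>J. f j i) w = (\<Sum>j\<in>J. dot d (f j) w)"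
  by (induction J rule: infinite_finite_induct) (simp_all add: dot_add_left, simp_all add: dot_def)

lemma dot_self: "dot d u u = complex_of_real (\<Sum>i<d. (cmod (u i))\<^sup>2)"
  unfolding dot_def of_real_sum complex_norm_square ..

lemma Re_dot_self_nonneg: "0 \<le> Re (dot d u u)"
  by (simp add: dot_self sum_nonneg)

abbreviation basis_vec :: "nat \<Rightarrow> nat \<Rightarrow> complex" where
  "basis_vec i \<equiv> (\<lambda>j. if j = i then 1 else 0)"

lemma dot_basis_right: "i < d \<Longrightarrow> dot d u (basis_vec i) = u i"
  by (simp add: dot_def if_distrib cong: if_cong)

lemma dot_basis_left: "i < d \<Longrightarrow> dot d (basis_vec i) u = cnj (u i)"
  by (simp add: dot_def if_distrib[of "\<lambda>x. x * _"] cong: if_cong)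

locale psd_op =
  fixes d :: nat and A :: "(nat \<Rightarrow> complex) \<Rightarrow> nat \<Rightarrow> complex"
  assumes herm: "dot d (A u) v = dot d u (A v)"
    and pos: "0 \<le> Re (dot d (A u) u)"
begin

lemma herm_pow: "dot d ((A ^^ k) u) v = dot d u ((A ^^ k) v)"
proof (induction k arbitrary: u v)
  case (Suc k)
  have "dot d ((A ^^ Suc k) u) v = dot d ((A ^^ k) u) (A v)" by (simp add: herm)
  also have "\<dots> = dot d u ((A ^^ k) (A v))" by (rule Suc)
  also have "(A ^^ k) (A v) = (A ^^ Suc k) v" by (simp add: funpow_swap1)
  finally show ?case .
qed simp

lemma CS: "(cmod (dot d (A u) v))\<^sup>2 \<le> Re (dot d (A u) u) * Re (dot d (A v) v)"
proof (rule quadratic_form_CS[OF pos pos])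
  fix t
  let ?w = "\<lambda>i. u i + cnj t * v i"
  have "dot d (A ?w) ?w = dot d (A ?w) u + t * dot d (A ?w) v"
    unfolding dot_add_right dot_scale_right by simp
  also have "dot d (A ?w) u = dot d (A u) u + cnj t * dot d (A v) u"
    unfolding herm dot_add_left dot_scale_left ..
  also have "dot d (A ?w) v = dot d (A u) v + cnj t * dot d (A v) v"
    unfolding herm dot_add_left dot_scale_left ..
  finally have e: "dot d (A ?w) ?w = dot d (A u) u + cnj t * dot d (A v) u
      + t * dot d (A u) v + t * cnj t * dot d (A v) v" by (simp add: algebra_simps)
  have 1: "dot d (A v) u = cnj (dot d (A u) v)" by (metis herm dot_commute)
  have 2: "Re (cnj t * dot d (A v) u) = Re (t * dot d (A u) v)" unfolding 1 by simp
  have 3: "Re (t * cnj t * dot d (A v) v) = (cmod t)\<^sup>2 * Re (dot d (A v) v)"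
    by (simp add: complex_norm_square[symmetric] del: of_real_power)
  show "0 \<le> Re (dot d (A u) u) + 2 * Re (t * dot d (A u) v) + (cmod t)\<^sup>2 * Re (dot d (A v) v)"
    using pos[of ?w] unfolding e by (simp only: plus_complex.simps 2 3)
qed

end

lemma psd_op_id: "psd_op d (\<lambda>u. u)"
  by unfold_locales (simp_all add: Re_dot_self_nonneg)

lemma dot_CS: "(cmod (dot d u v))\<^sup>2 \<le> Re (dot d u u) * Re (dot d v v)"
  by (rule psd_op.CS[OF psd_op_id])

context psd_op
begin

lemma real_pow: "Im (dot d ((A ^^ k) y) y) = 0"
proof -
  have "dot d ((A ^^ k) y) y = cnj (dot d ((A ^^ k) y) y)"
    using herm_pow[of k y y] dot_commute by metis
  then show ?thesis by (simp add: complex_eq_iff)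
qed

text \<open>
  The moments of the spectral measure of \<open>y\<close> with respect to \<open>A\<close>.
\<close>

definition mom :: "(nat \<Rightarrow> complex) \<Rightarrow> nat \<Rightarrow> real" where
  "mom y k = Re (dot d ((A ^^ k) y) y)"

lemma dot_pow: "dot d ((A ^^ k) y) y = complex_of_real (mom y k)"
  unfolding mom_def using real_pow[of k y] by (simp add: complex_eq_iff)

lemma dot_pow_split: "dot d ((A ^^ i) y) ((A ^^ j) y) = complex_of_real (mom y (i + j))"
proof -
  have "dot d ((A ^^ i) y) ((A ^^ j) y) = dot d ((A ^^ j) ((A ^^ i) y)) y"
    by (simp add: herm_pow)
  also have "(A ^^ j) ((A ^^ i) y) = (A ^^ (j + i)) y" by (simp add: funpow_add)
  finally show ?thesis by (simp add: dot_pow add.commute)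
qed

lemma mom_even: "mom y (j + j) = Re (dot d ((A ^^ j) y) ((A ^^ j) y))"
  by (simp add: dot_pow_split)

lemma mom_odd: "mom y (Suc (j + j)) = Re (dot d (A ((A ^^ j) y)) ((A ^^ j) y))"
  using dot_pow_split[of "Suc j" y j] by simp

text \<open>
  Even moments are squared norms of \<open>A\<^sup>j y\<close>, odd ones are values of the form of \<open>A\<close> at \<open>A\<^sup>j y\<close>.
\<close>

lemma mom_nonneg: "0 \<le> mom y k"
proof (cases "even k")
  case True
  then obtain j where "k = j + j" by (metis dvd_def mult_2)
  then show ?thesis by (simp only: mom_even Re_dot_self_nonneg)
next
  case False
  then obtain j where "k = Suc (j + j)" by (metis oddE mult_2 Suc_eq_plus1)
  then show ?thesis by (simp only: mom_odd pos)
qed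

text \<open>
  Cauchy--Schwarz for \<open>A\<^sup>j y\<close> and \<open>A\<^bsup>j+1\<^esup> y\<close>, in the standard form or in the form of \<open>A\<close> according to parity.
\<close>

lemma mom_log_convex: "(mom y (Suc k))\<^sup>2 \<le> mom y k * mom y (Suc (Suc k))"
proof (cases "even k")
  case True
  then obtain j where k: "k = j + j" by (metis dvd_def mult_2)
  let ?w = "(A ^^ j) y"
  have "(cmod (dot d ?w (A ?w)))\<^sup>2 \<le> Re (dot d ?w ?w) * Re (dot d (A ?w) (A ?w))"
    using dot_CS .
  moreover have "dot d ?w (A ?w) = complex_of_real (mom y (Suc k))"
    using dot_pow_split[of j y "Suc j"] by (simp add: k)
  moreover have "dot d (A ?w) (A ?w) = complex_of_real (mom y (Suc (Suc k)))"
    using dot_pow_split[of "Suc j" y "Suc j"] by (simp add: k)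
  moreover have "dot d ?w ?w = complex_of_real (mom y k)"
    using dot_pow_split[of j y j] by (simp add: k)
  ultimately show ?thesis by simp
next
  case False
  then obtain j where k: "k = Suc (j + j)" by (metis oddE mult_2 Suc_eq_plus1)
  let ?w = "(A ^^ j) y"
  have "(cmod (dot d (A ?w) (A ?w)))\<^sup>2 \<le> Re (dot d (A ?w) ?w) * Re (dot d (A (A ?w)) (A ?w))"
    by (rule CS)
  moreover have "dot d (A ?w) (A ?w) = complex_of_real (mom y (Suc k))"
    using dot_pow_split[of "Suc j" y "Suc j"] by (simp add: k)
  moreover have "dot d (A (A ?w)) (A ?w) = complex_of_real (mom y (Suc (Suc k)))"
    using dot_pow_split[of "Suc (Suc j)" y "Suc j"] by (simp add: k)
  moreover have "dot d (A ?w) ?w = complex_of_real (mom y k)"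
    using dot_pow_split[of "Suc j" y j] by (simp add: k)
  ultimately show ?thesis by simp
qed

lemma mom_supermult: "mom y i * mom y j \<le> mom y 0 * mom y (i + j)"
  by (rule log_convex_supermult) (rule mom_nonneg, rule mom_log_convex)

lemma mom_zero: assumes "mom y 0 = 0" shows "mom y k = 0"
proof (induction k)
  case (Suc k)
  then show ?case using mom_log_convex[of y k] by simp
qed (use assms in simp)

text \<open>
  \<open>c a\<^sub>0 \<le> a\<^sub>1\<close> propagates to all orders because the ratios of consecutive moments increase.
\<close>

lemma mom_Suc_ge:
  assumes "\<And>u. c * Re (dot d u u) \<le> Re (dot d (A u) u)"
  shows "c * mom y k \<le> mom y (Suc k)"
proof (cases "mom y 0 = 0")
  case True
  then show ?thesis by (simp add: mom_zero)
next
  case False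
  then have p: "0 < mom y 0" using mom_nonneg[of y 0] by simp
  have "c * mom y 0 \<le> mom y 1" using assms[of y] by (simp add: mom_def)
  have "mom y 0 * (c * mom y k) \<le> mom y 1 * mom y k"
    using mult_right_mono[OF \<open>c * mom y 0 \<le> mom y 1\<close> mom_nonneg[of y k]] by (simp add: mult_ac)
  also have "\<dots> \<le> mom y 0 * mom y (Suc k)" using mom_supermult[of y 1 k] by simp
  finally show ?thesis using p by simp
qed

lemma mom_Suc_le:
  assumes "\<And>u. Re (dot d (A u) u) \<le> Re (dot d u u)"
  shows "mom y (Suc k) \<le> mom y k"
proof -
  have e: "mom y (Suc (j + j)) \<le> mom y (j + j)" for j
    unfolding mom_odd mom_even by (rule assms)
  show ?thesis
  proof (cases "even k")
    case True
    then obtain j where k: "k = j + j" by (metis dvd_def mult_2)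
    then show ?thesis using e by simp
  next
    case False
    then obtain j where k: "k = Suc (j + j)" by (metis oddE mult_2 Suc_eq_plus1)
    have "(mom y (Suc k))\<^sup>2 \<le> mom y k * mom y (Suc (Suc k))" by (rule mom_log_convex)
    also have "\<dots> \<le> mom y k * mom y (Suc k)"
      using e[of "Suc j"] by (intro mult_left_mono mom_nonneg) (simp add: k)
    finally show ?thesis
      using mom_nonneg[of y "Suc k"] mom_nonneg[of y k]
      by (cases "mom y (Suc k) = 0") (auto simp: power2_eq_square)
  qed
qed

text \<open>
  Jensen's inequality for the spectral measure of \<open>y\<close>, up to normalisation.
\<close>

lemma mom_power: "mom y 1 ^ p * mom y 0 \<le> mom y 0 ^ p * mom y p"
proof (induction p)
  case (Suc p)
  have "mom y 1 ^ Suc p * mom y 0 = mom y 1 * (mom y 1 ^ p * mom y 0)" by simp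
  also have "\<dots> \<le> mom y 1 * (mom y 0 ^ p * mom y p)"
    by (rule mult_left_mono[OF Suc mom_nonneg])
  also have "\<dots> = mom y 0 ^ p * (mom y 1 * mom y p)" by simp
  also have "\<dots> \<le> mom y 0 ^ p * (mom y 0 * mom y (1 + p))"
    by (intro mult_left_mono mom_supermult zero_le_power mom_nonneg)
  finally show ?case by (simp add: mult_ac)
qed simp

lemma psd_pow: "psd_op d (A ^^ k)"
proof
  show "dot d ((A ^^ k) u) v = dot d u ((A ^^ k) v)" for u v by (rule herm_pow)
  show "0 \<le> Re (dot d ((A ^^ k) u) u)" for u unfolding dot_pow by (simp add: mom_nonneg)
qed

end

definition trc :: "nat \<Rightarrow> ((nat \<Rightarrow> complex) \<Rightarrow> nat \<Rightarrow> complex) \<Rightarrow> real" where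
  "trc d A = (\<Sum>i<d. Re (A (basis_vec i) i))"

lemma (in psd_op) diag_pow: "i < d \<Longrightarrow> Re ((A ^^ k) (basis_vec i) i) = mom (basis_vec i) k"
  by (simp add: mom_def dot_basis_right)

text \<open>
  The largest eigenvalue of a positive operator is at most its trace.  Instead of an eigenbasis, the
  proof expands \<open>u\<close> in the standard basis and uses the seminorm given by the form of \<open>A\<close>.
\<close>

lemma (in psd_op) form_le_trc: "Re (dot d (A u) u) \<le> trc d A * Re (dot d u u)"
proof -
  let ?q = "\<lambda>i. Re (A (basis_vec i) i)"
  have q: "?q i = Re (dot d (A (basis_vec i)) (basis_vec i))" if "i < d" for i
    using that by (simp add: dot_basis_right)
  have q0: "0 \<le> ?q i" if "i < d" for i unfolding q[OF that] by (rule pos)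
  have exp: "dot d (A u) u = (\<Sum>i<d. u i * dot d (A (basis_vec i)) u)"
  proof -
    have "dot d (A u) u = (\<Sum>i<d. u i * cnj (A u i))" unfolding herm unfolding dot_def ..
    also have "\<dots> = (\<Sum>i<d. u i * dot d (A (basis_vec i)) u)"
      by (intro sum.cong refl) (simp add: herm dot_basis_left)
    finally show ?thesis .
  qed
  let ?s = "sqrt (Re (dot d (A u) u))"
  have "(\<Sum>i<d. Re (u i * dot d (A (basis_vec i)) u)) \<le> (\<Sum>i<d. cmod (u i) * (sqrt (?q i) * ?s))"
  proof (intro sum_mono)
    fix i assume "i \<in> {..<d}" then have i: "i < d" by simp
    have "(cmod (dot d (A (basis_vec i)) u))\<^sup>2 \<le> ?q i * Re (dot d (A u) u)"
      unfolding q[OF i] by (rule CS)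
    then have "cmod (dot d (A (basis_vec i)) u) \<le> sqrt (?q i * Re (dot d (A u) u))"
      by (rule real_le_rsqrt)
    then have c: "cmod (dot d (A (basis_vec i)) u) \<le> sqrt (?q i) * ?s"
      by (simp add: real_sqrt_mult)
    have "Re (u i * dot d (A (basis_vec i)) u) \<le> cmod (u i * dot d (A (basis_vec i)) u)"
      by (rule complex_Re_le_cmod)
    also have "\<dots> \<le> cmod (u i) * (sqrt (?q i) * ?s)"
      unfolding norm_mult by (intro mult_left_mono c) simp
    finally show "Re (u i * dot d (A (basis_vec i)) u) \<le> cmod (u i) * (sqrt (?q i) * ?s)" .
  qed
  then have 1: "Re (dot d (A u) u) \<le> ?s * (\<Sum>i<d. cmod (u i) * sqrt (?q i))"
    unfolding exp[THEN arg_cong, of Re, unfolded Re_sum, symmetric] sum_distrib_left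
    by (simp only: mult_ac)
  have "?s * ?s = Re (dot d (A u) u)" using pos[of u] by simp
  with 1 have le: "?s * ?s \<le> ?s * (\<Sum>i<d. cmod (u i) * sqrt (?q i))" by simp
  have t0: "0 \<le> (\<Sum>i<d. cmod (u i) * sqrt (?q i))"
    by (intro sum_nonneg mult_nonneg_nonneg real_sqrt_ge_zero q0) simp_all
  have 2: "?s \<le> (\<Sum>i<d. cmod (u i) * sqrt (?q i))"
  proof (cases "?s = 0")
    case False
    then have "0 < ?s" using pos[of u] by simp
    with le show ?thesis by (simp only: mult_le_cancel_left_pos)
  qed (use t0 in simp)
  have "Re (dot d (A u) u) = ?s\<^sup>2" using pos[of u] by simp
  also have "\<dots> \<le> (\<Sum>i<d. cmod (u i) * sqrt (?q i))\<^sup>2" using 2 pos[of u] by (intro power_mono) auto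
  also have "\<dots> \<le> (\<Sum>i<d. (cmod (u i))\<^sup>2) * (\<Sum>i<d. (sqrt (?q i))\<^sup>2)"
    by (rule Cauchy_Schwarz_ineq_sum)
  also have "(\<Sum>i<d. (sqrt (?q i))\<^sup>2) = trc d A" unfolding trc_def
    by (intro sum.cong refl real_sqrt_pow2 q0) simp
  also have "(\<Sum>i<d. (cmod (u i))\<^sup>2) = Re (dot d u u)" by (simp add: dot_self)
  finally show ?thesis by (simp add: mult.commute)
qed

definition rank_one_update ::
  "nat \<Rightarrow> real \<Rightarrow> (nat \<Rightarrow> complex) \<Rightarrow> ((nat \<Rightarrow> complex) \<Rightarrow> nat \<Rightarrow> complex) \<Rightarrow> (nat \<Rightarrow> complex) \<Rightarrow> nat \<Rightarrow> complex"
  where "rank_one_update d \<theta> y A = (\<lambda>u i. A u i + complex_of_real \<theta> * dot d u y * y i)"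

locale psd_update = psd_op +
  fixes \<theta> :: real and y :: "nat \<Rightarrow> complex"
  assumes theta: "0 \<le> \<theta>"
begin

abbreviation "B \<equiv> rank_one_update d \<theta> y A"

lemma dot_update: "dot d (B u) v = dot d (A u) v + complex_of_real \<theta> * dot d u y * dot d y v"
  unfolding rank_one_update_def dot_add_left dot_scale_left ..

lemma psd_B: "psd_op d B"
proof
  show "dot d (B u) v = dot d u (B v)" for u v
  proof -
    have "dot d u (B v) = cnj (dot d (B v) u)" by (rule dot_commute)
    also have "\<dots> = dot d (B u) v"
      using dot_commute[of d y v] dot_commute[of d u y] dot_commute[of d u "A v"]
      unfolding dot_update by (simp add: herm)
    finally show ?thesis ..
  qed
  fix u
  have "Re (complex_of_real \<theta> * dot d u y * dot d y u) = \<theta> * (cmod (dot d u y))\<^sup>2"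
    unfolding dot_commute[of d y u] mult.assoc using Re_mult_cnj[of "dot d u y"] by simp
  then show "0 \<le> Re (dot d (B u) u)" unfolding dot_update using pos[of u] theta by simp
qed

sublocale B: psd_op d B by (rule psd_B)

text \<open>
  The mixed moments \<open>\<langle>B\<^sup>q y, A\<^sup>k y\<rangle>\<close> interpolate between the moments of \<open>A\<close> and those of \<open>B = A + \<theta> y y\<^sup>*\<close>,
  and they are exactly what a change of \<open>A\<close> to \<open>B\<close> contributes to the trace of a power.
\<close>

definition cross :: "nat \<Rightarrow> nat \<Rightarrow> complex" where
  "cross q k = dot d ((B ^^ q) y) ((A ^^ k) y)"

text \<open>
  Replacing one factor \<open>B\<close> by \<open>A + \<theta> y y\<^sup>*\<close>: the rank-one term splits the product into two moments.
  All following estimates come from this recursion.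
\<close>

lemma cross_Suc: "cross (Suc q) k = cross q (Suc k) + complex_of_real (\<theta> * mom y k) * cross q 0"
proof -
  have "cross (Suc q) k = dot d (A ((B ^^ q) y)) ((A ^^ k) y)
      + complex_of_real \<theta> * dot d ((B ^^ q) y) y * dot d y ((A ^^ k) y)"
    unfolding cross_def by (simp add: dot_update)
  also have "dot d y ((A ^^ k) y) = complex_of_real (mom y k)"
    using dot_pow_split[of 0 y k] by simp
  finally show ?thesis by (simp add: cross_def herm mult_ac)
qed

lemma cross_0_left: "cross 0 k = complex_of_real (mom y k)"
  unfolding cross_def using dot_pow_split[of 0 y k] by simp

lemma cross_0_right: "cross q 0 = complex_of_real (B.mom y q)"
  unfolding cross_def by (simp add: B.dot_pow)

lemma cross_ge: "mom y (q + k) \<le> Re (cross q k)"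
proof (induction q arbitrary: k)
  case (Suc q)
  have "Re (cross (Suc q) k) = Re (cross q (Suc k)) + \<theta> * mom y k * B.mom y q"
    unfolding cross_Suc cross_0_right by simp
  moreover have "0 \<le> \<theta> * mom y k * B.mom y q" by (simp add: theta mom_nonneg B.mom_nonneg)
  ultimately show ?case using Suc[of "Suc k"] by simp
qed (simp add: cross_0_left)

lemma cross_le_mom_B: "Re (cross q k) \<le> B.mom y (q + k)"
proof (induction k arbitrary: q)
  case (Suc k)
  have "Re (cross (Suc q) k) = Re (cross q (Suc k)) + \<theta> * mom y k * B.mom y q"
    unfolding cross_Suc cross_0_right by simp
  moreover have "0 \<le> \<theta> * mom y k * B.mom y q" by (simp add: theta mom_nonneg B.mom_nonneg)
  ultimately show ?case using Suc[of "Suc q"] by simp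
qed (simp add: cross_0_right)

text \<open>
  By the recursion, turning a factor \<open>B\<close> into \<open>A\<close> costs \<open>\<theta> a\<^sub>k a\<^sub>q\<close>, which is at most
  \<open>\<theta> a\<^sub>0 a\<^bsub>q+k\<^esub> \<le> \<theta> T a\<^bsub>q+k+1\<^esub> / c\<close>; so each factor costs at most \<open>1 + \<theta> T / c\<close>.
\<close>

lemma mom_B_le:
  assumes lower: "\<And>u. c * Re (dot d u u) \<le> Re (dot d (A u) u)" and c: "0 < c"
    and y: "Re (dot d y y) \<le> T" and T: "0 \<le> T"
  shows "B.mom y q \<le> (1 + \<theta> * T / c) ^ q * mom y q"
proof -
  have "Re (cross q k) \<le> (1 + \<theta> * T / c) ^ q * mom y (q + k)" for k
  proof (induction q arbitrary: k)
    case (Suc q)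
    let ?r = "1 + \<theta> * T / c"
    have r: "0 \<le> ?r" using theta c T by simp
    have m0: "mom y 0 \<le> T" using y by (simp add: mom_def)
    have "Re (cross (Suc q) k) = Re (cross q (Suc k)) + \<theta> * mom y k * Re (cross q 0)"
      unfolding cross_Suc by (simp add: cross_0_right)
    also have "\<dots> \<le> ?r ^ q * mom y (q + Suc k) + \<theta> * mom y k * (?r ^ q * mom y (q + 0))"
      by (intro add_mono Suc mult_left_mono) (simp add: theta mom_nonneg)
    also have "\<dots> = ?r ^ q * (mom y (q + Suc k) + \<theta> * (mom y q * mom y k))"
      by (simp add: algebra_simps)
    also have "\<dots> \<le> ?r ^ q * (mom y (q + Suc k) + \<theta> * (T * (mom y (Suc (q + k)) / c)))"
    proof (intro mult_left_mono add_left_mono)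
      have "mom y q * mom y k \<le> mom y 0 * mom y (q + k)" by (rule mom_supermult)
      also have "\<dots> \<le> T * mom y (q + k)" by (intro mult_right_mono m0 mom_nonneg)
      also have "\<dots> \<le> T * (mom y (Suc (q + k)) / c)"
        using mom_Suc_ge[OF lower, of y "q + k"] c T by (intro mult_left_mono) (simp_all add: field_simps)
      finally show "mom y q * mom y k \<le> T * (mom y (Suc (q + k)) / c)" .
    qed (use theta r in simp_all)
    also have "\<dots> = ?r ^ Suc q * mom y (Suc q + k)" by (simp add: algebra_simps)
    finally show ?case .
  qed (simp add: cross_0_left)
  from this[of 0] show ?thesis by (simp add: cross_0_right)
qed

text \<open>
  Telescoping \<open>tr (B\<^sup>j A\<^bsup>p-j\<^esup>)\<close> over \<open>j\<close>: consecutive terms differ by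
  \<open>tr (B\<^sup>j (B - A) A\<^bsup>p-1-j\<^esup>)\<close>, and \<open>B - A\<close> has rank one.
\<close>

lemma trc_update: "trc d (B ^^ p) - trc d (A ^^ p) = \<theta> * (\<Sum>j<p. Re (cross j (p - 1 - j)))"
proof -
  define D where "D j = (\<Sum>i<d. Re (dot d ((B ^^ j) ((A ^^ (p - j)) (basis_vec i))) (basis_vec i)))" for j
  have step: "D (Suc j) - D j = \<theta> * Re (cross j (p - 1 - j))" if "j < p" for j
  proof -
    have "dot d ((B ^^ Suc j) ((A ^^ (p - Suc j)) (basis_vec i))) (basis_vec i)
        - dot d ((B ^^ j) ((A ^^ (p - j)) (basis_vec i))) (basis_vec i)
        = complex_of_real \<theta> * ((B ^^ j) y i * cnj ((A ^^ (p - 1 - j)) y i))" if i: "i < d" for i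
    proof -
      let ?e = "basis_vec i" and ?v = "(A ^^ (p - Suc j)) (basis_vec i)"
      have "dot d ((B ^^ Suc j) ?v) ?e = dot d (B ?v) ((B ^^ j) ?e)"
        unfolding funpow_Suc_right o_def by (simp add: B.herm_pow)
      also have "\<dots> = dot d (A ?v) ((B ^^ j) ?e) + complex_of_real \<theta> * dot d ?v y * dot d y ((B ^^ j) ?e)"
        by (rule dot_update)
      also have "A ?v = (A ^^ (p - j)) ?e" using \<open>j < p\<close>
        by (metis Suc_diff_Suc comp_apply funpow.simps(2))
      also have "dot d ((A ^^ (p - j)) ?e) ((B ^^ j) ?e) = dot d ((B ^^ j) ((A ^^ (p - j)) ?e)) ?e"
        by (simp add: B.herm_pow)
      also have "dot d y ((B ^^ j) ?e) = (B ^^ j) y i"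
        using B.herm_pow[of j y ?e] i by (simp add: dot_basis_right)
      also have "dot d ?v y = cnj ((A ^^ (p - 1 - j)) y i)"
        using i by (simp add: herm_pow dot_basis_left)
      finally show ?thesis by simp
    qed
    then have "D (Suc j) - D j = (\<Sum>i<d. Re (complex_of_real \<theta> * ((B ^^ j) y i * cnj ((A ^^ (p - 1 - j)) y i))))"
      unfolding D_def sum_subtractf[symmetric] minus_complex.simps(1)[symmetric]
      by (intro sum.cong refl) simp
    also have "\<dots> = \<theta> * Re (cross j (p - 1 - j))"
      unfolding cross_def dot_def Re_sum[symmetric] sum_distrib_left[symmetric] by simp
    finally show ?thesis .
  qed
  have "(\<Sum>j<p. D (Suc j) - D j) = D p - D 0" by (rule sum_lessThan_telescope)
  moreover have "D p = trc d (B ^^ p)" "D 0 = trc d (A ^^ p)"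
    unfolding D_def trc_def by (auto intro!: sum.cong simp: dot_basis_right)
  moreover have "(\<Sum>j<p. D (Suc j) - D j) = \<theta> * (\<Sum>j<p. Re (cross j (p - 1 - j)))"
    by (simp add: step sum_distrib_left)
  ultimately show ?thesis by simp
qed

lemma trc_update_ge: "trc d (A ^^ p) + real p * \<theta> * mom y (p - 1) \<le> trc d (B ^^ p)"
proof -
  have "(\<Sum>j<p. mom y (p - 1)) \<le> (\<Sum>j<p. Re (cross j (p - 1 - j)))"
  proof (intro sum_mono)
    fix j assume "j \<in> {..<p}"
    then have "j + (p - 1 - j) = p - 1" by auto
    then show "mom y (p - 1) \<le> Re (cross j (p - 1 - j))" using cross_ge[of j "p - 1 - j"] by simp
  qed
  from mult_left_mono[OF this theta] show ?thesis
    using trc_update[of p] by (simp add: mult_ac)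
qed

lemma trc_update_le: "trc d (B ^^ p) \<le> trc d (A ^^ p) + real p * \<theta> * B.mom y (p - 1)"
proof -
  have "(\<Sum>j<p. Re (cross j (p - 1 - j))) \<le> (\<Sum>j<p. B.mom y (p - 1))"
  proof (intro sum_mono)
    fix j assume "j \<in> {..<p}"
    then have "j + (p - 1 - j) = p - 1" by auto
    then show "Re (cross j (p - 1 - j)) \<le> B.mom y (p - 1)" using cross_le_mom_B[of j "p - 1 - j"] by simp
  qed
  from mult_left_mono[OF this theta] show ?thesis
    using trc_update[of p] by (simp add: mult_ac)
qed

end

context psd_op
begin

lemma power_le_mom:
  assumes c: "0 \<le> c" "c * Re (dot d u u) \<le> Re (dot d (A u) u)"
  shows "c ^ p * mom u 0 \<le> mom u p"
proof (cases "mom u 0 = 0")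
  case True
  then show ?thesis by (simp add: mom_zero)
next
  case False
  then have p: "0 < mom u 0 ^ p" using mom_nonneg[of u 0] by simp
  have m: "mom u 0 = Re (dot d u u)" "mom u 1 = Re (dot d (A u) u)" by (simp_all add: mom_def)
  have "mom u 0 ^ p * (c ^ p * mom u 0) = (c * mom u 0) ^ p * mom u 0"
    by (simp add: power_mult_distrib mult_ac)
  also have "\<dots> \<le> mom u 1 ^ p * mom u 0"
    unfolding m using c by (intro mult_right_mono power_mono) (simp_all add: Re_dot_self_nonneg)
  also have "\<dots> \<le> mom u 0 ^ p * mom u p" by (rule mom_power)
  finally show ?thesis using p by simp
qed

lemma power_le_trc_pow:
  assumes u: "0 < Re (dot d u u)" and c: "0 \<le> c" "c * Re (dot d u u) \<le> Re (dot d (A u) u)"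
  shows "c ^ p \<le> trc d (A ^^ p)"
proof -
  interpret P: psd_op d "A ^^ p" by (rule psd_pow)
  have "c ^ p * Re (dot d u u) \<le> trc d (A ^^ p) * Re (dot d u u)"
    using power_le_mom[OF c, of p] P.form_le_trc[of u] by (simp add: mom_def)
  then show ?thesis using u by simp
qed

text \<open>
  For \<open>A \<ge> 1\<close> the operator \<open>A\<^sup>p - 1\<close> is positive, so its trace dominates \<open>c\<^sup>p - 1\<close>.  Subtracting the
  identity is what removes the dimension from the upper tail estimate.
\<close>

lemma power_minus_one_le_trc_pow:
  assumes u: "0 < Re (dot d u u)" and c: "0 \<le> c" "c * Re (dot d u u) \<le> Re (dot d (A u) u)"
    and ge1: "\<And>u. Re (dot d u u) \<le> Re (dot d (A u) u)"
  shows "c ^ p - 1 \<le> trc d (A ^^ p) - real d"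
proof -
  let ?Q = "\<lambda>u i. (A ^^ p) u i + (- 1) * u i"
  have Q: "dot d (?Q u) v = dot d ((A ^^ p) u) v + (- 1) * dot d u v" for u v
    unfolding dot_add_left dot_scale_left ..
  have ge: "mom v 0 \<le> mom v p" for v
    using power_le_mom[of 1 v p] ge1[of v] by simp
  interpret Q: psd_op d ?Q
  proof
    show "dot d (?Q u) v = dot d u (?Q v)" for u v
      unfolding Q dot_add_right dot_scale_right by (simp add: herm_pow)
    show "0 \<le> Re (dot d (?Q u) u)" for u
      unfolding Q dot_pow using ge[of u] by (simp add: mom_def)
  qed
  have tr: "trc d ?Q = trc d (A ^^ p) - real d" by (simp add: trc_def sum.distrib sum_subtractf)
  have "(c ^ p - 1) * Re (dot d u u) \<le> (trc d (A ^^ p) - real d) * Re (dot d u u)"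
    using power_le_mom[OF c, of p] Q.form_le_trc[of u] unfolding Q tr by (simp add: mom_def algebra_simps)
  then show ?thesis using u by simp
qed

end

section \<open>Expected traces of powers for sums of random rank-one operators\<close>

lemma borel_measurable_cnj [measurable (raw)]:
  assumes "f \<in> borel_measurable M"
  shows "(\<lambda>x. cnj (f x)) \<in> borel_measurable M"
  by (rule measurable_compose[OF assms borel_measurable_continuous_onI]) (intro continuous_intros)

lemma ennreal_add_le: "0 \<le> b \<Longrightarrow> ennreal (a + b) \<le> ennreal a + ennreal b"
  by (cases "0 \<le> a") (simp_all add: ennreal_neg ennreal_leI)

text \<open>
  Feature vectors \<open>(y\<^sub>0(x), \<dots>, y\<^bsub>d-1\<^esub>(x))\<close> of squared norm at most \<open>T\<close> whose second moment matrix is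
  diagonal with entries \<open>lam i\<close>.
\<close>

locale sampled_frame = prob_space \<rho> for \<rho> :: "'a measure" +
  fixes y :: "nat \<Rightarrow> 'a \<Rightarrow> complex" and d :: nat and T :: real and lam :: "nat \<Rightarrow> real"
  assumes meas_y [measurable]: "\<And>i. y i \<in> borel_measurable \<rho>"
    and bound_y: "\<And>x. x \<in> space \<rho> \<Longrightarrow> (\<Sum>i<d. (cmod (y i x))\<^sup>2) \<le> T"
    and T0: "0 \<le> T"
    and orth_y: "\<And>i j. i < d \<Longrightarrow> j < d \<Longrightarrow>
      (LINT x|\<rho>. y i x * cnj (y j x)) = (if i = j then complex_of_real (lam i) else 0)"
begin

abbreviation yvec :: "'a \<Rightarrow> nat \<Rightarrow> complex" where "yvec x \<equiv> (\<lambda>i. y i x)"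

lemma yvec_bound: "x \<in> space \<rho> \<Longrightarrow> Re (dot d (yvec x) (yvec x)) \<le> T"
  by (simp add: dot_self bound_y)

lemma integrable_prod: assumes "i < d" "j < d" shows "integrable \<rho> (\<lambda>x. y i x * cnj (y j x))"
proof (rule integrable_const_bound[where B=T])
  have "cmod (y i x) * cmod (y j x) \<le> T" if "x \<in> space \<rho>" for x
  proof -
    have "cmod (y k x) \<le> sqrt T" if "k < d" for k
    proof -
      have "(cmod (y k x))\<^sup>2 \<le> (\<Sum>i<d. (cmod (y i x))\<^sup>2)"
        using that by (intro member_le_sum) auto
      also have "\<dots> \<le> T" by (rule bound_y) fact
      finally show ?thesis by (rule real_le_rsqrt)
    qed
    with assms have "cmod (y i x) * cmod (y j x) \<le> sqrt T * sqrt T"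
      by (intro mult_mono) (auto simp: T0)
    with T0 show ?thesis by simp
  qed
  then show "AE x in \<rho>. norm (y i x * cnj (y j x)) \<le> T"
    by (intro AE_I2) (simp add: norm_mult)
qed measurable

text \<open>
  The expectation of \<open>\<langle>Q y, y\<rangle>\<close> is the trace of \<open>Q\<close> times the second moment matrix.
\<close>

lemma quadratic_form_integral:
  assumes "psd_op d Q"
  shows "integrable \<rho> (\<lambda>x. Re (dot d (Q (yvec x)) (yvec x)))" (is ?I)
    and "(LINT x|\<rho>. Re (dot d (Q (yvec x)) (yvec x))) = (\<Sum>i<d. lam i * Re (Q (basis_vec i) i))" (is ?E)
proof -
  interpret psd_op d Q by fact
  have e: "dot d (Q (yvec x)) (yvec x) =
    (\<Sum>i<d. \<Sum>l<d. cnj (Q (basis_vec i) l) * (y l x * cnj (y i x)))" for x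
  proof -
    have "Q (yvec x) i = (\<Sum>l<d. y l x * cnj (Q (basis_vec i) l))" if "i < d" for i
      using herm[of "yvec x" "basis_vec i"] that by (simp add: dot_basis_right) (simp add: dot_def)
    then have "dot d (Q (yvec x)) (yvec x) = (\<Sum>i<d. (\<Sum>l<d. y l x * cnj (Q (basis_vec i) l)) * cnj (y i x))"
      by (simp add: dot_def)
    then show ?thesis by (simp add: sum_distrib_left mult_ac)
  qed
  have i: "integrable \<rho> (\<lambda>x. dot d (Q (yvec x)) (yvec x))"
    unfolding e by (intro Bochner_Integration.integrable_sum integrable_mult_right integrable_prod) auto
  then show ?I by simp
  have "(LINT x|\<rho>. dot d (Q (yvec x)) (yvec x)) =
      (\<Sum>i<d. \<Sum>l<d. cnj (Q (basis_vec i) l) * (LINT x|\<rho>. y l x * cnj (y i x)))"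
  proof -
    have "(LINT x|\<rho>. dot d (Q (yvec x)) (yvec x)) =
        (\<Sum>i<d. (LINT x|\<rho>. (\<Sum>l<d. cnj (Q (basis_vec i) l) * (y l x * cnj (y i x)))))"
      unfolding e
      by (intro Bochner_Integration.integral_sum Bochner_Integration.integrable_sum
          integrable_mult_right integrable_prod) auto
    also have "\<dots> = (\<Sum>i<d. \<Sum>l<d. (LINT x|\<rho>. cnj (Q (basis_vec i) l) * (y l x * cnj (y i x))))"
      by (intro sum.cong refl Bochner_Integration.integral_sum integrable_mult_right integrable_prod) auto
    finally show ?thesis by simp
  qed
  also have "\<dots> = (\<Sum>i<d. \<Sum>l<d. if l = i then cnj (Q (basis_vec i) l) * complex_of_real (lam i) else 0)"
    by (intro sum.cong refl) (auto simp: orth_y)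
  also have "\<dots> = (\<Sum>i<d. cnj (Q (basis_vec i) i) * complex_of_real (lam i))" by simp
  finally show ?E using i by (simp add: mult.commute)
qed

lemma sum_lam_le: "(\<Sum>i<d. lam i) \<le> T"
proof -
  have "(\<Sum>i<d. lam i) = (LINT x|\<rho>. Re (dot d (yvec x) (yvec x)))"
    by (simp add: quadratic_form_integral(2)[OF psd_op_id])
  also have "\<dots> \<le> (LINT x|\<rho>. T)"
    by (intro integral_mono quadratic_form_integral(1)[OF psd_op_id]) (simp_all add: yvec_bound)
  finally show ?thesis by (simp add: prob_space)
qed

lemma lam_nonneg: assumes "i < d" shows "0 \<le> lam i"
proof -
  have "complex_of_real (lam i) = (LINT x|\<rho>. complex_of_real ((cmod (y i x))\<^sup>2))"
    using orth_y[OF assms assms] unfolding complex_norm_square by simp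
  then have "lam i = (LINT x|\<rho>. (cmod (y i x))\<^sup>2)"
    by (simp only: integral_complex_of_real of_real_eq_iff)
  then show ?thesis by simp
qed

definition gram :: "('i \<Rightarrow> 'a) \<Rightarrow> 'i set \<Rightarrow> (nat \<Rightarrow> complex) \<Rightarrow> real" where
  "gram X J u = (\<Sum>j\<in>J. (cmod (dot d u (yvec (X j))))\<^sup>2)"

definition sample_op :: "real \<Rightarrow> ('i \<Rightarrow> 'a) \<Rightarrow> 'i set \<Rightarrow> (nat \<Rightarrow> complex) \<Rightarrow> nat \<Rightarrow> complex" where
  "sample_op \<theta> X J u = (\<lambda>i. u i + complex_of_real \<theta> * (\<Sum>j\<in>J. dot d u (yvec (X j)) * y i (X j)))"

lemma dot_sample_op:
  "dot d (sample_op \<theta> X J u) v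
    = dot d u v + complex_of_real \<theta> * (\<Sum>j\<in>J. dot d u (yvec (X j)) * dot d (yvec (X j)) v)"
  unfolding sample_op_def dot_add_left dot_scale_left dot_sum_left ..

lemma sample_op_form: "Re (dot d (sample_op \<theta> X J u) u) = Re (dot d u u) + \<theta> * gram X J u"
proof -
  have "dot d u v * dot d v u = complex_of_real ((cmod (dot d u v))\<^sup>2)" for v
    unfolding complex_norm_square dot_commute[of d v u] by simp
  then have "(\<Sum>j\<in>J. dot d u (yvec (X j)) * dot d (yvec (X j)) u) = complex_of_real (gram X J u)"
    unfolding gram_def by simp
  then show ?thesis unfolding dot_sample_op by simp
qed

lemma sample_op_herm: "dot d (sample_op \<theta> X J u) v = dot d u (sample_op \<theta> X J v)"
proof -
  have "dot d u (sample_op \<theta> X J v) = cnj (dot d (sample_op \<theta> X J v) u)" by (rule dot_commute)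
  also have "\<dots> = dot d u v + complex_of_real \<theta> * (\<Sum>j\<in>J. cnj (dot d v (yvec (X j)) * dot d (yvec (X j)) u))"
    unfolding dot_sample_op using dot_commute[of d u v] by simp
  also have "\<dots> = dot d (sample_op \<theta> X J u) v"
    unfolding dot_sample_op complex_cnj_mult dot_commute[symmetric]
    by (simp add: mult.commute)
  finally show ?thesis ..
qed

lemma gram_nonneg: "0 \<le> gram X J u"
  by (simp add: gram_def sum_nonneg)

lemma gram_le:
  assumes "\<And>j. j \<in> J \<Longrightarrow> X j \<in> space \<rho>"
  shows "gram X J u \<le> real (card J) * T * Re (dot d u u)"
proof -
  have "gram X J u \<le> (\<Sum>j\<in>J. T * Re (dot d u u))"
    unfolding gram_def
  proof (rule sum_mono)
    fix j assume "j \<in> J"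
    have "(cmod (dot d u (yvec (X j))))\<^sup>2 \<le> Re (dot d u u) * Re (dot d (yvec (X j)) (yvec (X j)))"
      using dot_CS .
    also have "\<dots> \<le> Re (dot d u u) * T"
      by (intro mult_left_mono yvec_bound assms Re_dot_self_nonneg) fact
    finally show "(cmod (dot d u (yvec (X j))))\<^sup>2 \<le> T * Re (dot d u u)" by (simp add: mult.commute)
  qed
  then show ?thesis by simp
qed

lemma sample_op_psd: assumes "0 \<le> \<theta>" shows "psd_op d (sample_op \<theta> X J)"
proof
  show "0 \<le> Re (dot d (sample_op \<theta> X J u) u)" for u
    unfolding sample_op_form using assms by (simp add: Re_dot_self_nonneg gram_nonneg)
qed (rule sample_op_herm)

lemma sample_op_neg_ge:
  assumes "0 \<le> \<theta>" "\<And>j. j \<in> J \<Longrightarrow> X j \<in> space \<rho>" "\<theta> * (real (card J) * T) \<le> \<tau>"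
  shows "(1 - \<tau>) * Re (dot d u u) \<le> Re (dot d (sample_op (- \<theta>) X J u) u)"
proof -
  have "\<theta> * gram X J u \<le> \<theta> * (real (card J) * T * Re (dot d u u))"
    by (intro mult_left_mono gram_le assms)
  also have "\<dots> \<le> \<tau> * Re (dot d u u)"
    using mult_right_mono[OF assms(3) Re_dot_self_nonneg[of d u]] by (simp add: mult_ac)
  finally show ?thesis unfolding sample_op_form by (simp add: algebra_simps)
qed

lemma sample_op_neg_psd:
  assumes "0 \<le> \<theta>" "\<And>j. j \<in> J \<Longrightarrow> X j \<in> space \<rho>" "\<theta> * (real (card J) * T) \<le> 1"
  shows "psd_op d (sample_op (- \<theta>) X J)"
proof
  show "0 \<le> Re (dot d (sample_op (- \<theta>) X J u) u)" for u
    using sample_op_neg_ge[OF assms, where u=u] by simp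
qed (rule sample_op_herm)

lemma sample_op_insert:
  assumes "finite J" "j \<notin> J"
  shows "sample_op \<theta> (X(j := z)) (insert j J) = rank_one_update d \<theta> (yvec z) (sample_op \<theta> X J)"
proof (intro ext)
  fix u i
  have "(\<Sum>k\<in>J. dot d u (yvec ((X(j := z)) k)) * y i ((X(j := z)) k)) = (\<Sum>k\<in>J. dot d u (yvec (X k)) * y i (X k))"
    using assms by (intro sum.cong) auto
  then show "sample_op \<theta> (X(j := z)) (insert j J) u i = rank_one_update d \<theta> (yvec z) (sample_op \<theta> X J) u i"
    using assms unfolding sample_op_def rank_one_update_def by (simp add: algebra_simps)
qed

text \<open>
  With a negative sign, a new sample decreases the operator.  The old operator is then the rank-one update of
  the new one, so the results on \<open>psd_update\<close> apply with the roles of old and new interchanged.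
\<close>

lemma sample_op_remove:
  assumes "finite J" "j \<notin> J"
  shows "sample_op (- \<theta>) X J = rank_one_update d \<theta> (yvec z) (sample_op (- \<theta>) (X(j := z)) (insert j J))"
  unfolding sample_op_insert[OF assms] by (simp add: rank_one_update_def fun_eq_iff)

lemma measurable_sample_op_pow:
  assumes "finite J"
  shows "(\<lambda>X. (sample_op \<theta> X J ^^ k) u i) \<in> borel_measurable (PiM J (\<lambda>_. \<rho>))"
proof (induction k arbitrary: i)
  case (Suc k)
  have c: "(\<lambda>X. y i (X j)) \<in> borel_measurable (PiM J (\<lambda>_. \<rho>))" if "j \<in> J" for i j
    using measurable_compose[OF measurable_component_singleton[OF that] meas_y] .
  note [measurable] = c Suc
  show ?case unfolding funpow.simps o_def sample_op_def[of _ _ _ "(_ ^^ k) _"] dot_def by measurable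
qed simp

lemma measurable_trc [measurable]:
  assumes "finite J"
  shows "(\<lambda>X. trc d (sample_op \<theta> X J ^^ k)) \<in> borel_measurable (PiM J (\<lambda>_. \<rho>))"
  unfolding trc_def
  by (intro borel_measurable_sum) (rule measurable_compose[OF measurable_sample_op_pow[OF assms] borel_measurable_Re])

lemma product_sigma_finite: "product_sigma_finite (\<lambda>_. \<rho>)"
  by (rule product_sigma_finite.intro) (rule prob_space_imp_sigma_finite[OF prob_space_axioms])

lemma trc_pow_mom: "psd_op d A \<Longrightarrow> trc d (A ^^ k) = (\<Sum>i<d. psd_op.mom d A (basis_vec i) k)"
  unfolding trc_def by (intro sum.cong refl psd_op.diag_pow) auto

text \<open>
  The trace grows by at most \<open>p \<theta> \<kappa> \<langle>B\<^bsup>p-1\<^esup> y, y\<rangle>\<close>, whose mean is the sum over \<open>i\<close> of \<open>lam i\<close> times the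
  \<open>i\<close>th diagonal entry \<open>b\<^sub>i\<close> of \<open>B\<^bsup>p-1\<^esup>\<close>.  Writing \<open>b\<^sub>i = (b\<^sub>i - 1) + 1\<close>, the parts \<open>b\<^sub>i - 1\<close> contribute at most
  \<open>\<Lambda>\<close> times \<open>tr B\<^sup>p - d\<close>, and the ones contribute \<open>\<Sum> lam i \<le> T\<close> in place of a multiple of \<open>d\<close>.
\<close>

lemma upper_step:
  assumes X: "finite J" "j \<notin> J" and \<theta>: "0 \<le> \<theta>" and \<Lambda>: "\<And>i. i < d \<Longrightarrow> lam i \<le> \<Lambda>" and \<Lambda>0: "0 \<le> \<Lambda>"
    and p: "0 < p" and \<kappa>: "(1 + \<theta> * T) ^ (p - 1) \<le> \<kappa>"
  shows "(\<integral>\<^sup>+z. ennreal (trc d (sample_op \<theta> (X(j := z)) (insert j J) ^^ p) - real d) \<partial>\<rho>)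
    \<le> ennreal ((1 + real p * \<theta> * \<kappa> * \<Lambda>) * (trc d (sample_op \<theta> X J ^^ p) - real d) + real p * \<theta> * \<kappa> * T)"
proof -
  let ?B = "sample_op \<theta> X J"
  interpret B: psd_op d ?B by (rule sample_op_psd) fact
  have ge1: "1 * Re (dot d u u) \<le> Re (dot d (?B u) u)" for u
    unfolding sample_op_form using \<theta> by (simp add: gram_nonneg)
  have \<kappa>0: "0 \<le> \<kappa>" using \<kappa> \<theta> T0 by (meson add_nonneg_nonneg mult_nonneg_nonneg order_trans zero_le_one zero_le_power)
  let ?q = "p - 1"
  have pw: "psd_op d (?B ^^ ?q)" by (rule B.psd_pow)
  let ?F = "\<lambda>z. trc d (?B ^^ p) - real d + real p * \<theta> * \<kappa> * Re (dot d ((?B ^^ ?q) (yvec z)) (yvec z))"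
  have le: "trc d (sample_op \<theta> (X(j := z)) (insert j J) ^^ p) - real d \<le> ?F z" if z: "z \<in> space \<rho>" for z
  proof -
    interpret U: psd_update d ?B \<theta> "yvec z" by unfold_locales (rule \<theta>)
    have "U.B.mom (yvec z) ?q \<le> (1 + \<theta> * T / 1) ^ ?q * B.mom (yvec z) ?q"
      by (rule U.mom_B_le[OF ge1]) (simp_all add: yvec_bound[OF z] T0)
    also have "\<dots> \<le> \<kappa> * B.mom (yvec z) ?q" using \<kappa> by (intro mult_right_mono B.mom_nonneg) simp
    finally have "trc d (U.B ^^ p) \<le> trc d (?B ^^ p) + real p * \<theta> * (\<kappa> * B.mom (yvec z) ?q)"
      using \<theta> by (intro order_trans[OF U.trc_update_le] add_left_mono mult_left_mono) simp_all
    then show ?thesis unfolding sample_op_insert[OF X] by (simp add: B.mom_def mult.assoc)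
  qed
  have mom_ge: "1 \<le> B.mom (basis_vec i) k" if "i < d" for i k
  proof (induction k)
    case 0 show ?case using that by (simp add: B.mom_def dot_basis_right)
  next
    case (Suc k) then show ?case using B.mom_Suc_ge[OF ge1, of "basis_vec i" k] by simp
  qed
  have tr0: "trc d (?B ^^ k) - real d = (\<Sum>i<d. B.mom (basis_vec i) k - 1)" for k
    unfolding trc_pow_mom[OF B.psd_op_axioms] by (simp add: sum_subtractf)
  have tr_nn: "0 \<le> trc d (?B ^^ p) - real d"
    unfolding tr0 by (intro sum_nonneg) (use mom_ge in auto)
  have iF: "integrable \<rho> ?F" using quadratic_form_integral(1)[OF pw] by simp
  have F0: "0 \<le> ?F z" for z
    using tr_nn \<theta> \<kappa>0 B.mom_nonneg[of "yvec z" ?q] unfolding B.mom_def by (intro add_nonneg_nonneg mult_nonneg_nonneg) auto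
  have "(\<integral>\<^sup>+z. ennreal (trc d (sample_op \<theta> (X(j := z)) (insert j J) ^^ p) - real d) \<partial>\<rho>)
      \<le> (\<integral>\<^sup>+z. ennreal (?F z) \<partial>\<rho>)"
    by (intro nn_integral_mono ennreal_leI le)
  also have "\<dots> = ennreal (LINT z|\<rho>. ?F z)"
    by (rule nn_integral_eq_integral[OF iF]) (intro AE_I2 F0)
  also have "(LINT z|\<rho>. ?F z) = trc d (?B ^^ p) - real d
      + real p * \<theta> * \<kappa> * (\<Sum>i<d. lam i * Re ((?B ^^ ?q) (basis_vec i) i))"
    using quadratic_form_integral[OF pw] by (simp add: prob_space)
  finally have int: "(\<integral>\<^sup>+z. ennreal (trc d (sample_op \<theta> (X(j := z)) (insert j J) ^^ p) - real d) \<partial>\<rho>)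
      \<le> ennreal (trc d (?B ^^ p) - real d
          + real p * \<theta> * \<kappa> * (\<Sum>i<d. lam i * Re ((?B ^^ ?q) (basis_vec i) i)))" .
  have "(\<Sum>i<d. lam i * Re ((?B ^^ ?q) (basis_vec i) i))
      \<le> (\<Sum>i<d. \<Lambda> * (B.mom (basis_vec i) p - 1) + lam i)"
  proof (intro sum_mono)
    fix i assume "i \<in> {..<d}" then have i: "i < d" by simp
    have "B.mom (basis_vec i) ?q \<le> B.mom (basis_vec i) p"
      using B.mom_Suc_ge[OF ge1, of "basis_vec i" ?q] p by simp
    then have "lam i * (B.mom (basis_vec i) ?q - 1) \<le> lam i * (B.mom (basis_vec i) p - 1)"
      by (intro mult_left_mono lam_nonneg i) simp
    also have "\<dots> \<le> \<Lambda> * (B.mom (basis_vec i) p - 1)"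
      using mom_ge[OF i, of p] by (intro mult_right_mono \<Lambda> i) simp
    finally show "lam i * Re ((?B ^^ ?q) (basis_vec i) i) \<le> \<Lambda> * (B.mom (basis_vec i) p - 1) + lam i"
      unfolding B.diag_pow[OF i] by (simp add: algebra_simps)
  qed
  also have "\<dots> \<le> \<Lambda> * (trc d (?B ^^ p) - real d) + T"
    unfolding tr0 sum.distrib sum_distrib_left using sum_lam_le by simp
  finally have "real p * \<theta> * \<kappa> * (\<Sum>i<d. lam i * Re ((?B ^^ ?q) (basis_vec i) i))
      \<le> real p * \<theta> * \<kappa> * (\<Lambda> * (trc d (?B ^^ p) - real d) + T)"
    using \<theta> \<kappa>0 by (intro mult_left_mono) simp_all
  then have "trc d (?B ^^ p) - real d + real p * \<theta> * \<kappa> * (\<Sum>i<d. lam i * Re ((?B ^^ ?q) (basis_vec i) i))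
      \<le> (1 + real p * \<theta> * \<kappa> * \<Lambda>) * (trc d (?B ^^ p) - real d) + real p * \<theta> * \<kappa> * T"
    unfolding distrib_left distrib_right mult_1 by (simp only: mult.assoc)
  then show ?thesis by (rule order_trans[OF int ennreal_leI])
qed

lemma upper_expectation:
  assumes "finite J" and \<theta>: "0 \<le> \<theta>" and \<Lambda>: "\<And>i. i < d \<Longrightarrow> lam i \<le> \<Lambda>" and \<Lambda>0: "0 \<le> \<Lambda>"
    and p: "0 < p" and \<kappa>: "(1 + \<theta> * T) ^ (p - 1) \<le> \<kappa>"
    and a: "a = real p * \<theta> * \<kappa>"
  shows "(\<integral>\<^sup>+X. ennreal (trc d (sample_op \<theta> X J ^^ p) - real d) \<partial>PiM J (\<lambda>_. \<rho>))
    \<le> ennreal (real (card J) * (a * T) * (1 + a * \<Lambda>) ^ card J)"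
  using assms(1)
proof (induction J)
  case empty
  have "trc d (sample_op \<theta> X {} ^^ p) = real d" for X :: "'b \<Rightarrow> 'a"
  proof -
    have "(sample_op \<theta> X {} ^^ p) = id" by (induction p) (simp_all add: sample_op_def fun_eq_iff)
    then show ?thesis by (simp add: trc_def)
  qed
  then show ?case by simp
next
  case (insert j J)
  interpret PS: product_sigma_finite "\<lambda>_::'b. \<rho>" by (rule product_sigma_finite)
  interpret PJ: prob_space "PiM J (\<lambda>_::'b. \<rho>)" by (rule prob_space_PiM) (rule prob_space_axioms)
  have \<kappa>0: "0 \<le> \<kappa>" using \<kappa> \<theta> T0 by (meson add_nonneg_nonneg mult_nonneg_nonneg order_trans zero_le_one zero_le_power)
  have a0: "0 \<le> a" unfolding a using \<theta> \<kappa>0 by simp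
  note [measurable] = measurable_trc[OF insert(1)] measurable_trc[of "insert j J"]
  let ?t = "real (card J)" and ?e = "1 + a * \<Lambda>"
  have e1: "1 \<le> ?e" using a0 \<Lambda>0 by simp
  have "(\<integral>\<^sup>+X. ennreal (trc d (sample_op \<theta> X (insert j J) ^^ p) - real d) \<partial>PiM (insert j J) (\<lambda>_. \<rho>))
     = (\<integral>\<^sup>+X. (\<integral>\<^sup>+z. ennreal (trc d (sample_op \<theta> (X(j := z)) (insert j J) ^^ p) - real d) \<partial>\<rho>) \<partial>PiM J (\<lambda>_. \<rho>))"
    using insert(1,2) by (intro PS.product_nn_integral_insert) measurable
  also have "\<dots> \<le> (\<integral>\<^sup>+X. ennreal (?e * (trc d (sample_op \<theta> X J ^^ p) - real d) + a * T) \<partial>PiM J (\<lambda>_. \<rho>))"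
    unfolding a by (intro nn_integral_mono upper_step insert \<theta> \<Lambda> \<Lambda>0 p \<kappa>)
  also have "\<dots> \<le> (\<integral>\<^sup>+X. ennreal ?e * ennreal (trc d (sample_op \<theta> X J ^^ p) - real d) + ennreal (a * T) \<partial>PiM J (\<lambda>_. \<rho>))"
    using e1 a0 T0
    by (intro nn_integral_mono order_trans[OF ennreal_add_le]) (simp_all add: ennreal_mult')
  also have "\<dots> = ennreal ?e * (\<integral>\<^sup>+X. ennreal (trc d (sample_op \<theta> X J ^^ p) - real d) \<partial>PiM J (\<lambda>_. \<rho>)) + ennreal (a * T)"
    by (subst nn_integral_add) (simp_all add: nn_integral_cmult PJ.emeasure_space_1)
  also have "\<dots> \<le> ennreal ?e * ennreal (?t * (a * T) * ?e ^ card J) + ennreal (a * T)"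
    by (intro add_right_mono mult_left_mono insert.IH) simp
  also have "\<dots> = ennreal (?t * (a * T) * ?e ^ Suc (card J) + a * T)"
    using e1 a0 T0 by (simp add: ennreal_mult'[symmetric] ennreal_plus[symmetric] mult_ac del: ennreal_plus)
  also have "\<dots> \<le> ennreal (?t * (a * T) * ?e ^ Suc (card J) + a * T * ?e ^ Suc (card J))"
    using one_le_power[OF e1, of "Suc (card J)"] a0 T0 mult_left_mono[of 1 "?e ^ Suc (card J)" "a * T"]
    by (intro ennreal_leI add_left_mono) simp
  also have "\<dots> = ennreal (real (card (insert j J)) * (a * T) * ?e ^ card (insert j J))"
    using insert(1,2) by (simp add: algebra_simps)
  finally show ?case .
qed

text \<open>
  Here the trace drops by at least \<open>p \<theta> \<kappa> \<langle>B\<^bsup>p-1\<^esup> y, y\<rangle>\<close>, where \<open>\<kappa>\<close> pays for passing from the new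
  operator to the old one in \<open>mom_B_le\<close>.  The mean of this drop is \<open>p \<theta> \<kappa> tr B\<^bsup>p-1\<^esup> \<ge> p \<theta> \<kappa> tr B\<^sup>p\<close>, as \<open>B \<le> 1\<close>.
\<close>

lemma lower_step:
  assumes X: "finite J" "j \<notin> J" "\<And>i. i \<in> J \<Longrightarrow> X i \<in> space \<rho>" and \<theta>: "0 \<le> \<theta>" and lam1: "\<And>i. i < d \<Longrightarrow> lam i = 1"
    and p: "0 < p" and \<tau>: "\<theta> * (real (card (insert j J)) * T) \<le> \<tau>" "\<tau> < 1"
    and \<kappa>: "0 \<le> \<kappa>" "\<kappa> * (1 + \<theta> * T / (1 - \<tau>)) ^ (p - 1) \<le> 1"
  shows "(\<integral>\<^sup>+z. ennreal (trc d (sample_op (- \<theta>) (X(j := z)) (insert j J) ^^ p)) \<partial>\<rho>)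
    \<le> ennreal ((1 - real p * \<theta> * \<kappa>) * trc d (sample_op (- \<theta>) X J ^^ p))"
proof -
  let ?B = "sample_op (- \<theta>) X J" and ?q = "p - 1" and ?C = "\<lambda>z. sample_op (- \<theta>) (X(j := z)) (insert j J)"
  have cJ: "\<theta> * (real (card J) * T) \<le> \<theta> * (real (card (insert j J)) * T)"
    using \<theta> T0 X(1,2) by (intro mult_left_mono mult_right_mono) auto
  interpret B: psd_op d ?B
    by (rule sample_op_neg_psd[OF \<theta> X(3)]) (use cJ \<tau> in simp_all)
  have le1: "Re (dot d (?B u) u) \<le> Re (dot d u u)" for u
    unfolding sample_op_form using mult_nonneg_nonneg[OF \<theta> gram_nonneg[of X J u]] by simp
  have pw: "psd_op d (?B ^^ ?q)" by (rule B.psd_pow)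
  let ?F = "\<lambda>z. trc d (?B ^^ p) - real p * \<theta> * \<kappa> * Re (dot d ((?B ^^ ?q) (yvec z)) (yvec z))"
  have key: "0 \<le> trc d (?C z ^^ p)" "trc d (?C z ^^ p) \<le> ?F z" if z: "z \<in> space \<rho>" for z
  proof -
    have sp: "(X(j := z)) i \<in> space \<rho>" if "i \<in> insert j J" for i using that X z by auto
    have C1: "\<theta> * (real (card (insert j J)) * T) \<le> 1" using \<tau> by simp
    interpret U: psd_update d "?C z" \<theta> "yvec z"
      by (intro psd_update.intro psd_update_axioms.intro sample_op_neg_psd[OF \<theta> sp C1] \<theta>)
    have BC: "U.B = ?B" by (rule sample_op_remove[OF X(1,2), symmetric])
    show "0 \<le> trc d (?C z ^^ p)"
      unfolding trc_pow_mom[OF U.psd_op_axioms] by (intro sum_nonneg U.mom_nonneg)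
    have "U.B.mom (yvec z) ?q \<le> (1 + \<theta> * T / (1 - \<tau>)) ^ ?q * U.mom (yvec z) ?q"
      by (rule U.mom_B_le[OF sample_op_neg_ge[OF \<theta> sp \<tau>(1)]]) (use \<tau>(2) in \<open>simp_all add: yvec_bound[OF z] T0\<close>)
    then have "\<kappa> * B.mom (yvec z) ?q \<le> (\<kappa> * (1 + \<theta> * T / (1 - \<tau>)) ^ ?q) * U.mom (yvec z) ?q"
      unfolding BC using mult_left_mono[OF _ \<kappa>(1)] by (simp add: mult.assoc)
    also have "\<dots> \<le> 1 * U.mom (yvec z) ?q" by (intro mult_right_mono \<kappa> U.mom_nonneg)
    finally have "real p * \<theta> * (\<kappa> * B.mom (yvec z) ?q) \<le> real p * \<theta> * U.mom (yvec z) ?q"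
      using \<theta> by (intro mult_left_mono) simp_all
    with U.trc_update_ge[of p] show "trc d (?C z ^^ p) \<le> ?F z"
      unfolding BC by (simp add: B.mom_def mult.assoc)
  qed
  have iF: "integrable \<rho> ?F" using quadratic_form_integral(1)[OF pw] by simp
  have "(\<integral>\<^sup>+z. ennreal (trc d (?C z ^^ p)) \<partial>\<rho>) \<le> (\<integral>\<^sup>+z. ennreal (?F z) \<partial>\<rho>)"
    by (intro nn_integral_mono ennreal_leI key)
  also have "\<dots> = ennreal (LINT z|\<rho>. ?F z)"
    by (rule nn_integral_eq_integral[OF iF]) (intro AE_I2, use key order_trans in blast)
  also have "(LINT z|\<rho>. ?F z) = trc d (?B ^^ p) - real p * \<theta> * \<kappa> * (\<Sum>i<d. lam i * Re ((?B ^^ ?q) (basis_vec i) i))"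
    using quadratic_form_integral[OF pw] by (simp add: prob_space)
  also have "(\<Sum>i<d. lam i * Re ((?B ^^ ?q) (basis_vec i) i)) = trc d (?B ^^ ?q)"
    unfolding trc_def by (simp add: lam1)
  also have "ennreal (trc d (?B ^^ p) - real p * \<theta> * \<kappa> * trc d (?B ^^ ?q))
      \<le> ennreal ((1 - real p * \<theta> * \<kappa>) * trc d (?B ^^ p))"
  proof (rule ennreal_leI)
    have "trc d (?B ^^ p) \<le> trc d (?B ^^ ?q)"
      unfolding trc_pow_mom[OF B.psd_op_axioms]
      using B.mom_Suc_le[OF le1, of _ ?q] p by (intro sum_mono) simp
    then have "real p * \<theta> * \<kappa> * trc d (?B ^^ p) \<le> real p * \<theta> * \<kappa> * trc d (?B ^^ ?q)"
      using \<theta> \<kappa> by (intro mult_left_mono) simp_all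
    then show "trc d (?B ^^ p) - real p * \<theta> * \<kappa> * trc d (?B ^^ ?q) \<le> (1 - real p * \<theta> * \<kappa>) * trc d (?B ^^ p)"
      by (simp add: algebra_simps)
  qed
  finally show ?thesis .
qed

lemma lower_expectation:
  assumes "finite J" and \<theta>: "0 \<le> \<theta>" and lam1: "\<And>i. i < d \<Longrightarrow> lam i = 1"
    and p: "0 < p" and \<tau>: "\<theta> * (real (card J) * T) \<le> \<tau>" "\<tau> < 1"
    and \<kappa>: "0 \<le> \<kappa>" "\<kappa> * (1 + \<theta> * T / (1 - \<tau>)) ^ (p - 1) \<le> 1" "real p * \<theta> * \<kappa> \<le> 1"
  shows "(\<integral>\<^sup>+X. ennreal (trc d (sample_op (- \<theta>) X J ^^ p)) \<partial>PiM J (\<lambda>_. \<rho>))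
    \<le> ennreal (real d * (1 - real p * \<theta> * \<kappa>) ^ card J)"
  using assms(1) \<tau>(1)
proof (induction J)
  case empty
  interpret P0: prob_space "PiM {} (\<lambda>_::'b. \<rho>)" by (rule prob_space_PiM) (rule prob_space_axioms)
  have "trc d (sample_op (- \<theta>) X {} ^^ p) = real d" for X :: "'b \<Rightarrow> 'a"
  proof -
    have "(sample_op (- \<theta>) X {} ^^ p) = id" by (induction p) (simp_all add: sample_op_def fun_eq_iff)
    then show ?thesis by (simp add: trc_def)
  qed
  then show ?case by (simp add: P0.emeasure_space_1)
next
  case (insert j J)
  interpret PS: product_sigma_finite "\<lambda>_::'b. \<rho>" by (rule product_sigma_finite)
  note [measurable] = measurable_trc[OF insert(1)] measurable_trc[of "insert j J"]
  have cJ: "\<theta> * (real (card J) * T) \<le> \<theta> * (real (card (insert j J)) * T)"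
    using \<theta> T0 insert(1,2) by (intro mult_left_mono mult_right_mono) auto
  let ?e = "1 - real p * \<theta> * \<kappa>"
  have "(\<integral>\<^sup>+X. ennreal (trc d (sample_op (- \<theta>) X (insert j J) ^^ p)) \<partial>PiM (insert j J) (\<lambda>_. \<rho>))
     = (\<integral>\<^sup>+X. (\<integral>\<^sup>+z. ennreal (trc d (sample_op (- \<theta>) (X(j := z)) (insert j J) ^^ p)) \<partial>\<rho>) \<partial>PiM J (\<lambda>_. \<rho>))"
    using insert(1,2) by (intro PS.product_nn_integral_insert) measurable
  also have "\<dots> \<le> (\<integral>\<^sup>+X. ennreal ?e * ennreal (trc d (sample_op (- \<theta>) X J ^^ p)) \<partial>PiM J (\<lambda>_. \<rho>))"
  proof (intro nn_integral_mono)
    fix X assume "X \<in> space (PiM J (\<lambda>_::'b. \<rho>))"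
    then have "\<And>i. i \<in> J \<Longrightarrow> X i \<in> space \<rho>" by (auto simp: space_PiM)
    from lower_step[OF insert(1,2) this \<theta> lam1 p insert(4) \<tau>(2) \<kappa>(1,2)]
    show "(\<integral>\<^sup>+z. ennreal (trc d (sample_op (- \<theta>) (X(j := z)) (insert j J) ^^ p)) \<partial>\<rho>)
       \<le> ennreal ?e * ennreal (trc d (sample_op (- \<theta>) X J ^^ p))"
      using \<kappa>(3) by (simp add: ennreal_mult')
  qed
  also have "\<dots> = ennreal ?e * (\<integral>\<^sup>+X. ennreal (trc d (sample_op (- \<theta>) X J ^^ p)) \<partial>PiM J (\<lambda>_. \<rho>))"
    by (rule nn_integral_cmult) measurable
  also have "\<dots> \<le> ennreal ?e * ennreal (real d * ?e ^ card J)"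
    using cJ insert.prems by (intro mult_left_mono insert.IH) simp_all
  also have "\<dots> = ennreal (real d * ?e ^ card (insert j J))"
    using insert(1,2) \<kappa>(3) by (simp add: ennreal_mult'[symmetric] mult_ac)
  finally show ?case .
qed

lemma gram_upper:
  assumes \<theta>: "0 < \<theta>" and s: "0 \<le> s"
    and tr: "trc d (sample_op \<theta> X J ^^ p) - real d < (1 + \<theta> * s) ^ p - 1"
  shows "gram X J u \<le> s * Re (dot d u u)"
proof (rule ccontr)
  assume "\<not> ?thesis"
  then have less: "s * Re (dot d u u) < gram X J u" by simp
  interpret psd_op d "sample_op \<theta> X J" by (rule sample_op_psd) (use \<theta> in simp)
  have "Re (dot d u u) \<noteq> 0"
  proof
    assume z: "Re (dot d u u) = 0"
    have "gram X J u = 0"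
      unfolding gram_def using dot_CS[of d u] z by (intro sum.neutral) (simp add: z)
    with less z show False by simp
  qed
  then have "0 < Re (dot d u u)" using Re_dot_self_nonneg[of d u] by simp
  then have "(1 + \<theta> * s) ^ p - 1 \<le> trc d (sample_op \<theta> X J ^^ p) - real d"
  proof (rule power_minus_one_le_trc_pow)
    have "\<theta> * (s * Re (dot d u u)) \<le> \<theta> * gram X J u" using less \<theta> by (intro mult_left_mono) simp_all
    then show "(1 + \<theta> * s) * Re (dot d u u) \<le> Re (dot d (sample_op \<theta> X J u) u)"
      unfolding sample_op_form by (simp add: algebra_simps)
    show "Re (dot d u u) \<le> Re (dot d (sample_op \<theta> X J u) u)" for u
      unfolding sample_op_form using \<theta> by (simp add: gram_nonneg)
  qed (use \<theta> s in simp)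
  with tr show False by simp
qed

lemma gram_lower:
  assumes \<theta>: "0 < \<theta>" and s: "0 \<le> 1 - \<theta> * s" and psd: "psd_op d (sample_op (- \<theta>) X J)"
    and tr: "trc d (sample_op (- \<theta>) X J ^^ p) < (1 - \<theta> * s) ^ p"
  shows "s * Re (dot d u u) \<le> gram X J u"
proof (rule ccontr)
  assume "\<not> ?thesis"
  then have less: "gram X J u < s * Re (dot d u u)" by simp
  interpret psd_op d "sample_op (- \<theta>) X J" by fact
  have "Re (dot d u u) \<noteq> 0" using less gram_nonneg[of X J u] by auto
  then have "0 < Re (dot d u u)" using Re_dot_self_nonneg[of d u] by simp
  then have "(1 - \<theta> * s) ^ p \<le> trc d (sample_op (- \<theta>) X J ^^ p)"
  proof (rule power_le_trc_pow[OF _ s])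
    have "\<theta> * gram X J u \<le> \<theta> * (s * Re (dot d u u))" using less \<theta> by (intro mult_left_mono) simp_all
    then show "(1 - \<theta> * s) * Re (dot d u u) \<le> Re (dot d (sample_op (- \<theta>) X J u) u)"
      unfolding sample_op_form by (simp add: algebra_simps)
  qed
  with tr show False by simp
qed

end

section \<open>Hilbert spaces of functions\<close>

lemma sum_fun_at: "(\<Sum>k\<in>A. F k) x = (\<Sum>k\<in>A. F k x)" for F :: "'k \<Rightarrow> 'a \<Rightarrow> complex"
  by (induction A rule: infinite_finite_induct) simp_all

lemma fun_module: "Modules.module (fun_scale :: complex \<Rightarrow> ('a \<Rightarrow> complex) \<Rightarrow> 'a \<Rightarrow> complex)"
  by unfold_locales (simp_all add: fun_eq_iff algebra_simps)

context function_hilbert_space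
begin

lemma H_zero: "0 \<in> H"
  using subspace unfolding Modules.module.subspace_def[OF fun_module] by blast

lemma H_add: "f \<in> H \<Longrightarrow> g \<in> H \<Longrightarrow> f + g \<in> H"
  using subspace unfolding Modules.module.subspace_def[OF fun_module] by blast

lemma H_scale: "f \<in> H \<Longrightarrow> fun_scale c f \<in> H"
  using subspace unfolding Modules.module.subspace_def[OF fun_module] by blast

lemma diff_as_add: "f - g = f + fun_scale (- 1) g"
  by (simp add: fun_eq_iff)

lemma H_diff: "f \<in> H \<Longrightarrow> g \<in> H \<Longrightarrow> f - g \<in> H"
  unfolding diff_as_add by (intro H_add H_scale)

lemma H_sum: "(\<And>k. k \<in> A \<Longrightarrow> F k \<in> H) \<Longrightarrow> (\<Sum>k\<in>A. F k) \<in> H"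
  by (induction A rule: infinite_finite_induct) (simp_all add: H_zero H_add)

lemma ip_diff: "\<lbrakk>f \<in> H; g \<in> H; h \<in> H\<rbrakk> \<Longrightarrow> ip (f - g) h = ip f h - ip g h"
  unfolding diff_as_add by (simp only: ip_add H_scale ip_scale) simp

lemma ip_add_right: "\<lbrakk>f \<in> H; g \<in> H; h \<in> H\<rbrakk> \<Longrightarrow> ip h (f + g) = ip h f + ip h g"
  using ip_commute[of "f + g" h] ip_commute[of f h] ip_commute[of g h] by (simp add: ip_add H_add)

lemma ip_scale_right: "\<lbrakk>f \<in> H; h \<in> H\<rbrakk> \<Longrightarrow> ip h (fun_scale c f) = cnj c * ip h f"
    by (metis H_scale complex_cnj_mult ip_commute ip_scale)

lemma ip_diff_right: "\<lbrakk>f \<in> H; g \<in> H; h \<in> H\<rbrakk> \<Longrightarrow> ip h (f - g) = ip h f - ip h g"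
  using ip_commute[of "f - g" h] ip_commute[of f h] ip_commute[of g h] by (simp add: ip_diff H_diff)

lemma ip_zero_left: "h \<in> H \<Longrightarrow> ip 0 h = 0"
  using ip_add[of 0 0 h] H_zero by simp

lemma ip_sum: "(\<And>k. k \<in> A \<Longrightarrow> F k \<in> H) \<Longrightarrow> h \<in> H \<Longrightarrow> ip (\<Sum>k\<in>A. F k) h = (\<Sum>k\<in>A. ip (F k) h)"
  by (induction A rule: infinite_finite_induct) (simp_all add: ip_zero_left ip_add H_sum)

abbreviation nrm where "nrm \<equiv> ip_norm ip"

lemma nrm_sq: "f \<in> H \<Longrightarrow> (nrm f)\<^sup>2 = Re (ip f f)"
  unfolding ip_norm_def using ip_nonneg by simp

lemma nrm_nonneg: "f \<in> H \<Longrightarrow> 0 \<le> nrm f"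
  unfolding ip_norm_def using ip_nonneg by simp

lemma ip_self: "f \<in> H \<Longrightarrow> ip f f = complex_of_real ((nrm f)\<^sup>2)"
  using ip_commute[of f f] nrm_sq[of f] by (simp add: complex_eq_iff)

lemma nrm_eq_0: "f \<in> H \<Longrightarrow> nrm f = 0 \<longleftrightarrow> f = 0"
  by (metis H_zero ip_definite ip_self ip_zero_left of_real_0 of_real_eq_0_iff power_zero_numeral zero_eq_power2)

lemma nrm_add_scale_sq:
  assumes "f \<in> H" "g \<in> H"
  shows "(nrm (f + fun_scale t g))\<^sup>2 = (nrm f)\<^sup>2 + 2 * Re (t * ip g f) + (cmod t)\<^sup>2 * (nrm g)\<^sup>2"
proof -
  have "ip (f + fun_scale t g) (f + fun_scale t g)
      = ip f f + cnj t * ip f g + t * ip g f + t * cnj t * ip g g"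
    using assms by (simp only: ip_add ip_add_right ip_scale ip_scale_right H_add H_scale) (simp only: algebra_simps)
  moreover have "Re (cnj t * ip f g) = Re (t * ip g f)"
    using ip_commute[OF assms] by simp
  moreover have "Re (t * cnj t * ip g g) = (cmod t)\<^sup>2 * (nrm g)\<^sup>2"
    unfolding ip_self[OF assms(2)] using Re_mult_cnj[of t] by simp
  ultimately show ?thesis
    using assms by (simp only: nrm_sq H_add H_scale plus_complex.simps)
qed

lemma nrm_add_sq:
  assumes "f \<in> H" "g \<in> H"
  shows "(nrm (f + g))\<^sup>2 = (nrm f)\<^sup>2 + 2 * Re (ip f g) + (nrm g)\<^sup>2"
proof -
  have "fun_scale 1 g = g" by simp
  then show ?thesis using nrm_add_scale_sq[OF assms, of 1] ip_commute[OF assms] by simp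
qed

lemma nrm_diff_sq:
  assumes "f \<in> H" "g \<in> H"
  shows "(nrm (f - g))\<^sup>2 = (nrm f)\<^sup>2 - 2 * Re (ip f g) + (nrm g)\<^sup>2"
  unfolding diff_as_add nrm_add_scale_sq[OF assms] ip_commute[OF assms] by simp

lemma CS: "f \<in> H \<Longrightarrow> g \<in> H \<Longrightarrow> cmod (ip f g) \<le> nrm f * nrm g"
proof -
  assume f: "f \<in> H" and g: "g \<in> H"
  have "(cmod (ip g f))\<^sup>2 \<le> (nrm f)\<^sup>2 * (nrm g)\<^sup>2"
  proof (rule quadratic_form_CS)
    show "0 \<le> (nrm f)\<^sup>2 + 2 * Re (t * ip g f) + (cmod t)\<^sup>2 * (nrm g)\<^sup>2" for t
      unfolding nrm_add_scale_sq[OF f g, symmetric] by (rule zero_le_power2)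
  qed simp_all
  then have "cmod (ip g f) \<le> nrm f * nrm g"
    unfolding power_mult_distrib[symmetric]
    by (rule power2_le_imp_le) (simp add: nrm_nonneg f g)
  moreover have "cmod (ip g f) = cmod (ip f g)" using ip_commute[OF f g] by simp
  ultimately show ?thesis by simp
qed

lemma nrm_triangle: "f \<in> H \<Longrightarrow> g \<in> H \<Longrightarrow> nrm (f + g) \<le> nrm f + nrm g"
proof (rule power2_le_imp_le)
  assume f: "f \<in> H" and g: "g \<in> H"
  have "Re (ip f g) \<le> nrm f * nrm g"
    using CS[OF f g] complex_Re_le_cmod[of "ip f g"] by linarith
  then show "(nrm (f + g))\<^sup>2 \<le> (nrm f + nrm g)\<^sup>2"
    unfolding nrm_add_sq[OF f g] by (simp add: power2_sum)
qed (simp add: nrm_nonneg)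

lemma nrm_scale: "f \<in> H \<Longrightarrow> nrm (fun_scale c f) = cmod c * nrm f"
proof (rule power2_eq_imp_eq)
  assume f: "f \<in> H"
  have "ip (fun_scale c f) (fun_scale c f) = c * cnj c * ip f f"
    using f by (simp only: ip_scale ip_scale_right H_scale mult.assoc)
  then show "(nrm (fun_scale c f))\<^sup>2 = (cmod c * nrm f)\<^sup>2"
    using f Re_mult_cnj[of c] unfolding nrm_sq[OF H_scale[OF f]] ip_self[OF f] by (simp add: power_mult_distrib)
  show "0 \<le> nrm (fun_scale c f)" by (rule nrm_nonneg[OF H_scale[OF f]])
  show "0 \<le> cmod c * nrm f" by (intro mult_nonneg_nonneg nrm_nonneg f) simp
qed

lemma nrm_minus: "f \<in> H \<Longrightarrow> g \<in> H \<Longrightarrow> nrm (f - g) = nrm (g - f)"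
  by (rule power2_eq_imp_eq)
     (simp_all add: nrm_diff_sq[of f g] nrm_diff_sq[of g f] ip_commute[of f g] nrm_nonneg H_diff)

lemma nrm_triangle_diff:
  assumes "f \<in> H" "g \<in> H" "h \<in> H" shows "nrm (f - h) \<le> nrm (f - g) + nrm (g - h)"
  using nrm_triangle[OF H_diff[OF assms(1,2)] H_diff[OF assms(2,3)]] by simp

lemma Metric_space_ip: "Metric_space H (ip_dist H ip)"
proof
  show "0 \<le> ip_dist H ip f g" for f g
    by (simp add: ip_dist_def nrm_nonneg H_diff)
  show "ip_dist H ip f g = ip_dist H ip g f" for f g
    by (auto simp: ip_dist_def nrm_minus)
  show "ip_dist H ip f g = 0 \<longleftrightarrow> f = g" if "f \<in> H" "g \<in> H" for f g
    using that by (simp add: ip_dist_def nrm_eq_0 H_diff)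
  show "ip_dist H ip f h \<le> ip_dist H ip f g + ip_dist H ip g h" if "f \<in> H" "g \<in> H" "h \<in> H" for f g h
    using that nrm_triangle_diff by (simp add: ip_dist_def)
qed

lemma Cauchy_limit:
  assumes "\<And>i. f i \<in> H" and "\<And>\<epsilon>. 0 < \<epsilon> \<Longrightarrow> \<exists>N. \<forall>i\<ge>N. \<forall>j\<ge>N. nrm (f i - f j) < \<epsilon>"
  obtains g where "g \<in> H" "(\<lambda>i. nrm (f i - g)) \<longlonglongrightarrow> 0"
proof -
  interpret M: Metric_space H "ip_dist H ip" by (rule Metric_space_ip)
  have "M.MCauchy f"
    unfolding M.MCauchy_def using assms by (auto simp: ip_dist_def)
  then obtain g where "limitin M.mtopology f g sequentially"
    using complete unfolding M.mcomplete_def by blast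
  then have "g \<in> H" "(\<lambda>i. ip_dist H ip (f i) g) \<longlonglongrightarrow> 0"
    unfolding M.limitin_metric_dist_null by auto
  with assms(1) that show ?thesis by (simp add: ip_dist_def)
qed

lemma ip_tendsto:
  assumes "\<And>i. f i \<in> H" "g \<in> H" "h \<in> H" "(\<lambda>i. nrm (f i - g)) \<longlonglongrightarrow> 0"
  shows "(\<lambda>i. ip (f i) h) \<longlonglongrightarrow> ip g h"
proof (rule LIM_zero_cancel, rule Lim_null_comparison)
  show "\<forall>\<^sub>F i in sequentially. norm (ip (f i) h - ip g h) \<le> nrm (f i - g) * nrm h"
    using CS[of "f _ - g" h] assms by (simp add: ip_diff H_diff)
  show "(\<lambda>i. nrm (f i - g) * nrm h) \<longlonglongrightarrow> 0" using tendsto_mult_left_zero[OF assms(4)] .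
qed

lemma nrm_tendsto:
  assumes "\<And>i. f i \<in> H" "g \<in> H" "(\<lambda>i. nrm (f i - g)) \<longlonglongrightarrow> 0"
  shows "(\<lambda>i. nrm (f i)) \<longlonglongrightarrow> nrm g"
proof (rule LIM_zero_cancel, rule Lim_null_comparison[OF _ assms(3)])
  have "\<bar>nrm (f i) - nrm g\<bar> \<le> nrm (f i - g)" for i
    using nrm_triangle[of "f i - g" g] nrm_triangle[of "g - f i" "f i"] nrm_minus[of "f i" g] assms
    by (simp add: H_diff)
  then show "\<forall>\<^sub>F i in sequentially. norm (nrm (f i) - nrm g) \<le> nrm (f i - g)" by simp
qed

text \<open>
  The representing vector is the minimiser of \<open>\<parallel>h\<parallel>\<^sup>2 - 2 Re \<phi>(h)\<close>.  By the parallelogram law minimising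
  sequences are Cauchy, and at the minimum the linear part of the variation vanishes.
\<close>

lemma riesz:
  assumes add: "\<And>f g. f \<in> H \<Longrightarrow> g \<in> H \<Longrightarrow> \<phi> (f + g) = \<phi> f + \<phi> g"
    and scale: "\<And>f c. f \<in> H \<Longrightarrow> \<phi> (fun_scale c f) = c * \<phi> f"
    and bounded: "\<And>f. f \<in> H \<Longrightarrow> cmod (\<phi> f) \<le> b * nrm f"
  obtains h where "h \<in> H" "\<And>f. f \<in> H \<Longrightarrow> \<phi> f = ip f h"
proof -
  define J where "J h = (nrm h)\<^sup>2 - 2 * Re (\<phi> h)" for h
  define I where "I = Inf (J ` H)"
  have lower: "- b\<^sup>2 \<le> J h" if "h \<in> H" for h
  proof -
    have "Re (\<phi> h) \<le> b * nrm h" using bounded[OF that] complex_Re_le_cmod[of "\<phi> h"] by linarith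
    moreover have "0 \<le> (nrm h - b)\<^sup>2" by simp
    ultimately show ?thesis unfolding J_def by (simp add: power2_diff algebra_simps)
  qed
  have bdd: "bdd_below (J ` H)" using lower by (rule bdd_belowI2)
  have I_le: "I \<le> J h" if "h \<in> H" for h unfolding I_def using that bdd by (rule cINF_lower[rotated])
  have "\<exists>h\<in>H. J h < I + inverse (real (Suc i))" for i
  proof -
    have "I < I + inverse (real (Suc i))" by simp
    then obtain z where "z \<in> J ` H" "z < I + inverse (real (Suc i))"
      unfolding I_def using cInf_lessD[of "J ` H"] H_zero by (metis empty_iff image_is_empty)
    then show ?thesis by auto
  qed
  then obtain f where f: "\<And>i. f i \<in> H" and J_f: "\<And>i. J (f i) < I + inverse (real (Suc i))" by metis
  have close: "(nrm (f i - f j))\<^sup>2 \<le> 2 * inverse (real (Suc i)) + 2 * inverse (real (Suc j))" for i j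
  proof -
    define m where "m = fun_scale (1/2) (f i + f j)"
    have m: "m \<in> H" unfolding m_def by (intro H_scale H_add f)
    have "(nrm m)\<^sup>2 = (nrm (f i + f j))\<^sup>2 / 4"
      unfolding m_def nrm_scale[OF H_add[OF f f]] by (simp add: power_divide)
    moreover have "Re (\<phi> m) = (Re (\<phi> (f i)) + Re (\<phi> (f j))) / 2"
      unfolding m_def scale[OF H_add[OF f f]] add[OF f f] by simp
    ultimately have "4 * J m = (nrm (f i + f j))\<^sup>2 - 4 * Re (\<phi> (f i)) - 4 * Re (\<phi> (f j))"
      unfolding J_def by simp
    moreover have "(nrm (f i - f j))\<^sup>2 + (nrm (f i + f j))\<^sup>2 = 2 * (nrm (f i))\<^sup>2 + 2 * (nrm (f j))\<^sup>2"
      by (simp add: nrm_add_sq nrm_diff_sq f)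
    ultimately have "(nrm (f i - f j))\<^sup>2 = 2 * J (f i) + 2 * J (f j) - 4 * J m"
      unfolding J_def by simp
    with J_f[of i] J_f[of j] I_le[OF m] show ?thesis by simp
  qed
  obtain h where h: "h \<in> H" and lim: "(\<lambda>i. nrm (f i - h)) \<longlonglongrightarrow> 0"
  proof (rule Cauchy_limit[of f, OF f])
    fix \<epsilon> :: real assume e: "0 < \<epsilon>"
    then obtain N where N: "inverse (real (Suc N)) < \<epsilon>\<^sup>2 / 4"
      using reals_Archimedean[of "\<epsilon>\<^sup>2 / 4"] by auto
    have "nrm (f i - f j) < \<epsilon>" if "i \<ge> N" "j \<ge> N" for i j
    proof -
      have inv: "inverse (real (Suc k)) \<le> inverse (real (Suc N))" if "k \<ge> N" for k
        using that by (intro le_imp_inverse_le) auto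
      have "(nrm (f i - f j))\<^sup>2 < \<epsilon>\<^sup>2"
        using close[of i j] N inv[OF \<open>i \<ge> N\<close>] inv[OF \<open>j \<ge> N\<close>] by linarith
      with e show ?thesis by (simp add: power2_less_imp_less)
    qed
    then show "\<exists>N. \<forall>i\<ge>N. \<forall>j\<ge>N. nrm (f i - f j) < \<epsilon>" by blast
  qed (rule that)
  have "(\<lambda>i. \<phi> (f i)) \<longlonglongrightarrow> \<phi> h"
  proof (rule LIM_zero_cancel, rule Lim_null_comparison)
    have "\<phi> (f i) - \<phi> h = \<phi> (f i - h)" for i
      using add[of "f i - h" h] f h by (simp add: H_diff)
    then show "\<forall>\<^sub>F i in sequentially. norm (\<phi> (f i) - \<phi> h) \<le> b * nrm (f i - h)"
      using bounded by (simp add: H_diff f h)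
    show "(\<lambda>i. b * nrm (f i - h)) \<longlonglongrightarrow> 0" using tendsto_mult_right_zero[OF lim] .
  qed
  then have "(\<lambda>i. J (f i)) \<longlonglongrightarrow> J h"
    unfolding J_def by (intro tendsto_intros nrm_tendsto f h lim)
  moreover have "(\<lambda>i. I + inverse (real (Suc i))) \<longlonglongrightarrow> I"
    using tendsto_add[OF tendsto_const LIMSEQ_inverse_real_of_nat, of I] by simp
  ultimately have Jh: "J h \<le> I"
    by (rule LIMSEQ_le) (use J_f less_imp_le in blast)
  have "\<phi> g = ip g h" if g: "g \<in> H" for g
  proof -
    have "(cmod (ip g h - \<phi> g))\<^sup>2 \<le> 0 * (nrm g)\<^sup>2"
    proof (rule quadratic_form_CS)
      fix t
      have "J (h + fun_scale t g) = J h + 2 * Re (t * (ip g h - \<phi> g)) + (cmod t)\<^sup>2 * (nrm g)\<^sup>2"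
        unfolding J_def nrm_add_scale_sq[OF h g] add[OF h H_scale[OF g]] scale[OF g]
        by (simp add: algebra_simps)
      moreover have "I \<le> J (h + fun_scale t g)" by (intro I_le H_add H_scale h g)
      ultimately show "0 \<le> 0 + 2 * Re (t * (ip g h - \<phi> g)) + (cmod t)\<^sup>2 * (nrm g)\<^sup>2"
        using Jh by simp
    qed simp_all
    then show ?thesis by simp
  qed
  with h that show ?thesis by blast
qed

lemma dense_sequence:
  assumes "separable_ip H ip"
  obtains g where "\<And>j::nat. g j \<in> H" "\<And>f \<epsilon>. f \<in> H \<Longrightarrow> 0 < \<epsilon> \<Longrightarrow> \<exists>j. nrm (f - g j) < \<epsilon>"
proof -
  interpret M: Metric_space H "ip_dist H ip" by (rule Metric_space_ip)
  obtain Q where Q: "countable Q" "Q \<subseteq> H" "M.mtopology closure_of Q = H"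
    using assms unfolding separable_ip_def separable_space_def by auto
  have dense: "\<exists>q\<in>Q. nrm (f - q) < \<epsilon>" if "f \<in> H" "0 < \<epsilon>" for f \<epsilon>
  proof -
    have "f \<in> M.mtopology closure_of Q" using Q that by simp
    then obtain q where "q \<in> Q" "q \<in> M.mball f \<epsilon>"
      using \<open>0 < \<epsilon>\<close> unfolding M.metric_closure_of by auto
    with Q \<open>f \<in> H\<close> show ?thesis by (auto simp: ip_dist_def M.in_mball subset_iff)
  qed
  have "Q \<noteq> {}" using dense[of 0 1] H_zero by auto
  then obtain g :: "nat \<Rightarrow> _" where g: "range g = Q"
    using Q(1) by (metis range_from_nat_into)
  show ?thesis
  proof (rule that[of g])
    show "g j \<in> H" for j using g Q(2) by auto
    show "\<exists>j. nrm (f - g j) < \<epsilon>" if "f \<in> H" "0 < \<epsilon>" for f \<epsilon>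
      using dense[OF that] g by auto
  qed
qed

text \<open>
  A dense sequence need not meet the unit ball densely near its boundary; approximating
  \<open>(1 - \<eta>) f\<close> to within \<open>\<eta>\<close> stays inside the ball.
\<close>

lemma dense_sequence_ball:
  assumes "separable_ip H ip"
  obtains g where "\<And>j::nat. g j \<in> H" "\<And>j. nrm (g j) \<le> 1"
    "\<And>f \<epsilon>. f \<in> H \<Longrightarrow> nrm f \<le> 1 \<Longrightarrow> 0 < \<epsilon> \<Longrightarrow> \<exists>j. nrm (f - g j) < \<epsilon>"
proof -
  obtain g where g: "\<And>j::nat. g j \<in> H" and dense: "\<And>f \<epsilon>. f \<in> H \<Longrightarrow> 0 < \<epsilon> \<Longrightarrow> \<exists>j. nrm (f - g j) < \<epsilon>"
    using dense_sequence[OF assms] by blast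
  define g' where "g' j = (if nrm (g j) \<le> 1 then g j else 0)" for j
  show ?thesis
  proof (rule that[of g'])
    show "g' j \<in> H" for j by (simp add: g'_def g H_zero)
    show "nrm (g' j) \<le> 1" for j using nrm_eq_0[OF H_zero] by (simp add: g'_def)
    fix f \<epsilon> assume f: "f \<in> H" "nrm f \<le> 1" and "0 < (\<epsilon>::real)"
    define \<eta> where "\<eta> = min \<epsilon> 1 / 2"
    have \<eta>: "0 < \<eta>" "\<eta> \<le> 1 / 2" "2 * \<eta> \<le> \<epsilon>" using \<open>0 < \<epsilon>\<close> by (auto simp: \<eta>_def)
    let ?f = "fun_scale (complex_of_real (1 - \<eta>)) f"
    have f': "?f \<in> H" by (rule H_scale) fact
    obtain j where j: "nrm (?f - g j) < \<eta>" using dense[OF f' \<eta>(1)] by blast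
    have c: "cmod (complex_of_real (1 - \<eta>)) = 1 - \<eta>" using \<eta> unfolding norm_of_real by simp
    have "nrm ?f = (1 - \<eta>) * nrm f" unfolding nrm_scale[OF f(1)] c ..
    also have "\<dots> \<le> 1 - \<eta>" using f(2) \<eta> mult_left_mono[of "nrm f" 1 "1 - \<eta>"] by simp
    finally have "nrm ?f \<le> 1 - \<eta>" .
    moreover have "nrm (g j) \<le> nrm (g j - ?f) + nrm ?f"
      using nrm_triangle[OF H_diff[OF g[of j] f'] f'] by simp
    ultimately have "nrm (g j) \<le> 1" using j nrm_minus[OF f' g[of j]] by simp
    then have g': "g' j = g j" by (simp add: g'_def)
    have "f - ?f = fun_scale (complex_of_real \<eta>) f" by (simp add: fun_eq_iff algebra_simps)
    then have "nrm (f - ?f) = \<eta> * nrm f" using \<eta> by (simp only: nrm_scale[OF f(1)] norm_of_real abs_of_pos)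
    also have "\<dots> \<le> \<eta>" using f(2) \<eta> mult_left_mono[of "nrm f" 1 \<eta>] by simp
    finally have "nrm (f - g j) < 2 * \<eta>"
      using nrm_triangle_diff[OF f(1) f' g[of j]] j by simp
    then show "\<exists>j. nrm (f - g' j) < \<epsilon>" using g' \<eta> by (intro exI[of _ j]) simp
  qed
qed

end

section \<open>The embedding into the square-integrable functions\<close>

text \<open>
  The constant \<open>C\<close> bounds the norm of every point evaluation.
\<close>

locale embedded_rkhs = rkhs D K H ip + prob_space \<rho>
  for D :: "'a set" and K H ip and \<rho> :: "'a measure" +
  fixes lam :: "nat \<Rightarrow> real" and e :: "nat \<Rightarrow> 'a \<Rightarrow> complex" and C :: real
  assumes space_rho: "space \<rho> = D"
    and H_measurable [measurable]: "\<And>f. f \<in> H \<Longrightarrow> f \<in> borel_measurable \<rho>"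
    and C_nonneg: "0 \<le> C"
    and kernel_bound: "\<And>x. x \<in> D \<Longrightarrow> Re (K x x) \<le> C\<^sup>2"
    and separable: "separable_ip H ip"
    and eigensystem: "embedding_eigensystem H ip \<rho> lam e"
begin

lemma nrm_kernel_section: "x \<in> D \<Longrightarrow> nrm (kernel_section D K x) \<le> C"
proof (rule power2_le_imp_le[OF _ C_nonneg])
  assume x: "x \<in> D"
  have "ip (kernel_section D K x) (kernel_section D K x) = K x x"
    using reproducing[OF kernel_section_in[OF x] x] x by (simp add: kernel_section_def)
  then show "(nrm (kernel_section D K x))\<^sup>2 \<le> C\<^sup>2"
    using kernel_bound[OF x] by (simp add: nrm_sq kernel_section_in x)
qed

lemma eval_bound: assumes f: "f \<in> H" shows "cmod (f x) \<le> C * nrm f"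
proof (cases "x \<in> D")
  case True
  have "cmod (f x) \<le> nrm f * nrm (kernel_section D K x)"
    unfolding reproducing[OF f True] by (intro CS f kernel_section_in True)
  also have "\<dots> \<le> nrm f * C" by (intro mult_left_mono nrm_kernel_section True nrm_nonneg f)
  finally show ?thesis by (simp add: mult.commute)
next
  case False
  then show ?thesis using vanish_outside[OF f False] C_nonneg nrm_nonneg[OF f] by simp
qed

lemma L2_integrable: assumes "f \<in> H" "g \<in> H" shows "integrable \<rho> (\<lambda>x. f x * cnj (g x))"
proof (rule integrable_const_bound[where B="(C * nrm f) * (C * nrm g)"])
  show "AE x in \<rho>. norm (f x * cnj (g x)) \<le> (C * nrm f) * (C * nrm g)"
    unfolding norm_mult complex_mod_cnj using assms
    by (intro AE_I2 mult_mono eval_bound) (auto intro!: mult_nonneg_nonneg C_nonneg nrm_nonneg)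
  show "(\<lambda>x. f x * cnj (g x)) \<in> borel_measurable \<rho>"
    using assms by measurable
qed

abbreviation lip where "lip \<equiv> L2_ip \<rho>"

definition L2_sq :: "('a \<Rightarrow> complex) \<Rightarrow> real" where "L2_sq f = (LINT x|\<rho>. (cmod (f x))\<^sup>2)"

lemma sq_integrable: assumes "f \<in> H" shows "integrable \<rho> (\<lambda>x. (cmod (f x))\<^sup>2)"
  using integrable_Re[OF L2_integrable[OF assms assms]] unfolding Re_mult_cnj .

lemma lip_self: assumes "f \<in> H" shows "lip f f = complex_of_real (L2_sq f)"
  unfolding L2_ip_def L2_sq_def integral_complex_of_real[symmetric] complex_norm_square ..

lemma L2_sq_nonneg: "0 \<le> L2_sq f" by (simp add: L2_sq_def)

lemma lip_add: "\<lbrakk>f \<in> H; g \<in> H; h \<in> H\<rbrakk> \<Longrightarrow> lip (f + g) h = lip f h + lip g h"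
  unfolding L2_ip_def by (simp add: algebra_simps L2_integrable)

lemma lip_scale: "lip (fun_scale c f) h = c * lip f h"
  unfolding L2_ip_def by (simp add: mult.assoc)

lemma lip_commute: "lip g f = cnj (lip f g)"
  unfolding L2_ip_def Bochner_Integration.integral_cnj[symmetric] by (simp add: mult.commute)

lemma lip_add_right: "\<lbrakk>f \<in> H; g \<in> H; h \<in> H\<rbrakk> \<Longrightarrow> lip h (f + g) = lip h f + lip h g"
  using lip_commute[of h "f + g"] lip_commute[of h f] lip_commute[of h g] by (simp add: lip_add)

lemma lip_scale_right: "lip h (fun_scale c f) = cnj c * lip h f"
  using lip_commute[of h "fun_scale c f"] lip_commute[of h f] by (simp add: lip_scale)

lemma lip_diff: "\<lbrakk>f \<in> H; g \<in> H; h \<in> H\<rbrakk> \<Longrightarrow> lip (f - g) h = lip f h - lip g h"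
  unfolding L2_ip_def by (simp add: algebra_simps L2_integrable)

lemma lip_sum: "(\<And>k. k \<in> A \<Longrightarrow> F k \<in> H) \<Longrightarrow> h \<in> H \<Longrightarrow> lip (\<Sum>k\<in>A. F k) h = (\<Sum>k\<in>A. lip (F k) h)"
proof (induction A rule: infinite_finite_induct)
  case (insert x F')
  then have "lip (F x + (\<Sum>k\<in>F'. F k)) h = lip (F x) h + lip (\<Sum>k\<in>F'. F k) h"
    by (intro lip_add H_sum) auto
  moreover have "lip (\<Sum>k\<in>F'. F k) h = (\<Sum>k\<in>F'. lip (F k) h)" using insert by auto
  ultimately show ?case unfolding sum.insert[OF insert(1,2)] by (simp only:)
qed (simp_all add: L2_ip_def)

lemma L2_sq_le: assumes "f \<in> H" shows "L2_sq f \<le> C\<^sup>2 * (nrm f)\<^sup>2"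
proof -
  have "L2_sq f \<le> (LINT x|\<rho>. (C * nrm f)\<^sup>2)"
    unfolding L2_sq_def using assms by (intro integral_mono sq_integrable power_mono eval_bound) auto
  then show ?thesis by (simp add: prob_space power_mult_distrib)
qed

lemma L2_sq_add_scale:
  assumes "f \<in> H" "g \<in> H"
  shows "L2_sq (f + fun_scale t g) = L2_sq f + 2 * Re (t * lip g f) + (cmod t)\<^sup>2 * L2_sq g"
proof -
  note m = H_add H_scale assms
  have "lip (f + fun_scale t g) (f + fun_scale t g)
      = lip f f + cnj t * lip f g + t * lip g f + t * cnj t * lip g g"
    using assms by (simp only: lip_add lip_add_right lip_scale lip_scale_right H_add H_scale) (simp only: algebra_simps)
  then have "complex_of_real (L2_sq (f + fun_scale t g)) = complex_of_real (L2_sq f) + cnj t * lip f g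
      + t * lip g f + t * cnj t * complex_of_real (L2_sq g)"
    by (simp only: lip_self m)
  from arg_cong[OF this, of Re] have "L2_sq (f + fun_scale t g) = L2_sq f + Re (cnj t * lip f g) + Re (t * lip g f) + Re (t * cnj t) * L2_sq g"
    by simp
  moreover have "Re (cnj t * lip f g) = Re (t * lip g f)" unfolding lip_commute[of g f] by simp
  ultimately show ?thesis unfolding Re_mult_cnj by simp
qed

lemma lip_CS: assumes "f \<in> H" "g \<in> H" shows "(cmod (lip f g))\<^sup>2 \<le> L2_sq f * L2_sq g"
proof -
  have "(cmod (lip g f))\<^sup>2 \<le> L2_sq f * L2_sq g"
  proof (rule quadratic_form_CS)
    show "0 \<le> L2_sq f + 2 * Re (t * lip g f) + (cmod t)\<^sup>2 * L2_sq g" for t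
      unfolding L2_sq_add_scale[OF assms, symmetric] by (rule L2_sq_nonneg)
  qed (rule L2_sq_nonneg)+
  then show ?thesis unfolding lip_commute[of g f] by simp
qed

lemma lip_bound: assumes "f \<in> H" "g \<in> H" shows "cmod (lip f g) \<le> C\<^sup>2 * nrm g * nrm f"
proof (rule power2_le_imp_le)
  have "(cmod (lip f g))\<^sup>2 \<le> (C\<^sup>2 * (nrm f)\<^sup>2) * (C\<^sup>2 * (nrm g)\<^sup>2)"
    using assms by (intro order_trans[OF lip_CS] mult_mono L2_sq_le L2_sq_nonneg) auto
  then show "(cmod (lip f g))\<^sup>2 \<le> (C\<^sup>2 * nrm g * nrm f)\<^sup>2"
    by (simp add: power_mult_distrib power2_eq_square mult_ac)
qed (use assms in \<open>auto intro!: mult_nonneg_nonneg nrm_nonneg\<close>)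

text \<open>
  The adjoint is a definite description; Riesz representation supplies the existence without which the
  eigenvalue equations would carry no information.
\<close>

lemma embedding_gram_eq_iff:
  assumes u: "u \<in> H" and h: "h \<in> H"
  shows "embedding_gram H ip \<rho> u = h \<longleftrightarrow> (\<forall>f\<in>H. lip f u = ip f h)"
proof -
  obtain r where r: "r \<in> H" "\<And>f. f \<in> H \<Longrightarrow> lip f u = ip f r"
    by (rule riesz[of "\<lambda>f. lip f u" "C\<^sup>2 * nrm u"]) (auto simp: lip_add lip_scale u lip_bound)
  have uniq: "s = r" if "s \<in> H" "\<forall>f\<in>H. lip f u = ip f s" for s
  proof -
    have "ip (s - r) (s - r) = 0"
      using that r by (simp add: ip_diff_right H_diff)
    then show ?thesis using ip_definite[of "s - r"] that r by (simp add: H_diff)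
  qed
  have "embedding_gram H ip \<rho> u = r"
    unfolding embedding_gram_def embedding_adjoint_def embedding_def o_def
    using r uniq by (intro the_equality) auto
  then show ?thesis using uniq[OF h] r by auto
qed

lemma lam_pos: "1 \<le> k \<Longrightarrow> 0 < lam k"
  using eigensystem unfolding embedding_eigensystem_def by blast

lemma lam_antimono: assumes "1 \<le> j" "j \<le> k" shows "lam k \<le> lam j"
  using assms(2,1)
proof (induction k rule: dec_induct)
  case (step k)
  then have "lam (Suc k) \<le> lam k" using eigensystem unfolding embedding_eigensystem_def by auto
  with step show ?case by simp
qed simp

lemma e_in_H: "1 \<le> k \<Longrightarrow> e k \<in> H"
  using eigensystem unfolding embedding_eigensystem_def by blast

lemma e_orthonormal: "1 \<le> j \<Longrightarrow> 1 \<le> k \<Longrightarrow> ip (e j) (e k) = (if j = k then 1 else 0)"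
  using eigensystem unfolding embedding_eigensystem_def by blast

lemma lip_e: assumes "1 \<le> k" "f \<in> H" shows "lip f (e k) = complex_of_real (lam k) * ip f (e k)"
proof -
  have "embedding_gram H ip \<rho> (e k) = fun_scale (complex_of_real (lam k)) (e k)"
    using eigensystem assms unfolding embedding_eigensystem_def by blast
  then have "lip f (e k) = ip f (fun_scale (complex_of_real (lam k)) (e k))"
    using embedding_gram_eq_iff[OF e_in_H H_scale[OF e_in_H]] assms by blast
  then show ?thesis using assms by (simp only: ip_scale_right e_in_H) simp
qed

text \<open>
  Weak sequential compactness of the unit ball, in the only form needed.  The inner products with a dense
  sequence lie in a compact product of discs, so they converge along a subsequence; by density so do
  the inner products with the kernel sections, which are the point values.
\<close>

lemma pointwise_convergent_subsequence:
  assumes f: "\<And>i. f i \<in> H" "\<And>i. nrm (f i) \<le> 1"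
  obtains r where "strict_mono (r :: nat \<Rightarrow> nat)" "\<And>x. convergent (\<lambda>i. f (r i) x)"
proof -
  obtain g where g: "\<And>j::nat. g j \<in> H" and dense: "\<And>h \<epsilon>. h \<in> H \<Longrightarrow> 0 < \<epsilon> \<Longrightarrow> \<exists>j. nrm (h - g j) < \<epsilon>"
    using dense_sequence[OF separable] by blast
  define S :: "(nat \<Rightarrow> complex) set" where "S = PiE UNIV (\<lambda>j. cball 0 (nrm (g j)))"
  have "compactin (product_topology (\<lambda>i. euclidean) UNIV) S"
    unfolding S_def compactin_PiE by simp
  then have "compact S" unfolding euclidean_product_topology by simp
  then have "seq_compact S" by (rule compact_imp_seq_compact)
  moreover have "(\<lambda>j. ip (f i) (g j)) \<in> S" for i
  proof -
    have "cmod (ip (f i) (g j)) \<le> nrm (g j)" for j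
      using CS[OF f(1)[of i] g[of j]] mult_right_mono[OF f(2)[of i] nrm_nonneg[OF g[of j]]] by simp
    then show ?thesis unfolding S_def by (auto simp: PiE_UNIV_domain)
  qed
  ultimately obtain l r where r: "strict_mono r" and l: "((\<lambda>i j. ip (f i) (g j)) \<circ> r) \<longlonglongrightarrow> l"
    by (meson seq_compactE)
  have conv: "(\<lambda>i. ip (f (r i)) (g j)) \<longlonglongrightarrow> l j" for j
  proof -
    have "isCont (\<lambda>x::nat \<Rightarrow> complex. x j) l"
      using continuous_on_product_coordinates[of j] continuous_on_eq_continuous_at[OF open_UNIV] by blast
    from isCont_tendsto_compose[OF this l] show ?thesis by (simp add: o_def)
  qed
  have "convergent (\<lambda>i. f (r i) x)" for x
  proof (cases "x \<in> D")
    case True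
    let ?k = "kernel_section D K x"
    have k: "?k \<in> H" by (rule kernel_section_in[OF True])
    have "Cauchy (\<lambda>i. f (r i) x)"
    proof (rule metric_CauchyI)
      fix \<epsilon> :: real assume "0 < \<epsilon>"
      then obtain j where j: "nrm (?k - g j) < \<epsilon> / 4" using dense[OF k, of "\<epsilon> / 4"] by auto
      have "Cauchy (\<lambda>i. ip (f (r i)) (g j))" using conv LIMSEQ_imp_Cauchy by blast
      then obtain N where N: "\<And>a b. a \<ge> N \<Longrightarrow> b \<ge> N \<Longrightarrow> dist (ip (f (r a)) (g j)) (ip (f (r b)) (g j)) < \<epsilon> / 2"
        using \<open>0 < \<epsilon>\<close> metric_CauchyD[of _ "\<epsilon> / 2"] by (metis half_gt_zero)
      have app: "cmod (f i x - ip (f i) (g j)) < \<epsilon> / 4" for i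
      proof -
        have "f i x - ip (f i) (g j) = ip (f i) (?k - g j)"
          using reproducing[OF f(1) True] by (simp add: ip_diff_right f k g)
        also have "cmod \<dots> \<le> nrm (f i) * nrm (?k - g j)" by (intro CS f H_diff k g)
        also have "\<dots> \<le> 1 * nrm (?k - g j)" by (intro mult_right_mono f nrm_nonneg H_diff k g)
        finally show ?thesis using j by simp
      qed
      have "dist (f (r a) x) (f (r b) x) < \<epsilon>" if "a \<ge> N" "b \<ge> N" for a b
      proof -
        have "f (r a) x - f (r b) x = (f (r a) x - ip (f (r a)) (g j))
            + (ip (f (r a)) (g j) - ip (f (r b)) (g j)) - (f (r b) x - ip (f (r b)) (g j))" by simp
        then have "cmod (f (r a) x - f (r b) x) \<le> cmod (f (r a) x - ip (f (r a)) (g j))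
            + cmod (ip (f (r a)) (g j) - ip (f (r b)) (g j)) + cmod (f (r b) x - ip (f (r b)) (g j))"
          by (metis norm_triangle_ineq norm_triangle_ineq4 order_trans add_right_mono)
        with app[of "r a"] app[of "r b"] N[OF that] show ?thesis by (simp add: dist_norm)
      qed
      then show "\<exists>M. \<forall>m\<ge>M. \<forall>n\<ge>M. dist (f (r m) x) (f (r n) x) < \<epsilon>" by blast
    qed
    then show ?thesis by (rule Cauchy_convergent)
  next
    case False
    then show ?thesis using vanish_outside[OF f(1) False] by (simp add: convergent_const)
  qed
  with r that show ?thesis by blast
qed

lemma L2_sq_parallelogram: assumes "f \<in> H" "g \<in> H" shows "L2_sq (f + g) + L2_sq (f - g) = 2 * L2_sq f + 2 * L2_sq g"
proof -
  have "fun_scale 1 g = g" by simp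
  then show ?thesis
    using L2_sq_add_scale[OF assms, of 1] L2_sq_add_scale[OF assms, of "- 1"] unfolding diff_as_add[symmetric] by simp
qed

text \<open>
  The embedding is compact: the elements of the unit ball are bounded by \<open>C\<close>, so dominated convergence
  turns pointwise convergence into convergence in \<open>L\<^sub>2\<close>.  The limit is a function that need not
  belong to \<open>H\<close>, and hence only mutual distances are recorded.
\<close>

lemma L2_Cauchy_subsequence:
  assumes f: "\<And>i. f i \<in> H" "\<And>i. nrm (f i) \<le> 1"
  obtains r \<delta> where "strict_mono (r :: nat \<Rightarrow> nat)" "\<delta> \<longlonglongrightarrow> 0"
    "\<And>i j. L2_sq (f (r i) - f (r j)) \<le> \<delta> i + \<delta> j"
proof -
  obtain r where r: "strict_mono r" and conv: "\<And>x. convergent (\<lambda>i. f (r i) x)"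
    by (rule pointwise_convergent_subsequence[of f, OF f]) (rule that)
  define F where "F x = lim (\<lambda>i. f (r i) x)" for x
  have F: "(\<lambda>i. f (r i) x) \<longlonglongrightarrow> F x" for x
    unfolding F_def using conv[of x] unfolding convergent_LIMSEQ_iff .
  have Fm [measurable]: "F \<in> borel_measurable \<rho>"
    by (rule borel_measurable_LIMSEQ_metric[where f="\<lambda>i. f (r i)"]) (use F f in auto)
  have fb: "cmod (f i x) \<le> C" for i x
    using eval_bound[OF f(1)[of i], of x] mult_left_mono[OF f(2)[of i] C_nonneg] by simp
  have Fb: "cmod (F x) \<le> C" for x
    by (rule LIMSEQ_le_const2[OF tendsto_norm[OF F]]) (use fb in blast)
  have diff_b: "cmod (f (r i) x - F x) \<le> 2 * C" for i x
    using norm_triangle_ineq4[of "f (r i) x" "F x"] fb[of "r i" x] Fb[of x] by simp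
  have [measurable]: "f i \<in> borel_measurable \<rho>" for i by (rule H_measurable[OF f(1)])
  have int: "integrable \<rho> (\<lambda>x. (cmod (f (r i) x - F x))\<^sup>2)" for i
  proof (rule integrable_const_bound[where B="(2 * C)\<^sup>2"])
    show "AE x in \<rho>. norm ((cmod (f (r i) x - F x))\<^sup>2) \<le> (2 * C)\<^sup>2"
      unfolding real_norm_def abs_power2 by (intro AE_I2 power_mono diff_b norm_ge_zero)
  qed measurable
  define \<delta> where "\<delta> i = 2 * (LINT x|\<rho>. (cmod (f (r i) x - F x))\<^sup>2)" for i
  have "(\<lambda>i. LINT x|\<rho>. (cmod (f (r i) x - F x))\<^sup>2) \<longlonglongrightarrow> (LINT x|\<rho>. 0)"
  proof (rule integral_dominated_convergence[where w="\<lambda>_. (2 * C)\<^sup>2"])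
    show "AE x in \<rho>. (\<lambda>i. (cmod (f (r i) x - F x))\<^sup>2) \<longlonglongrightarrow> 0"
    proof (intro AE_I2)
      fix x
      have "(\<lambda>i. (cmod (f (r i) x - F x))\<^sup>2) \<longlonglongrightarrow> (cmod (F x - F x))\<^sup>2"
        by (intro tendsto_intros F)
      then show "(\<lambda>i. (cmod (f (r i) x - F x))\<^sup>2) \<longlonglongrightarrow> 0" by simp
    qed
    show "AE x in \<rho>. norm ((cmod (f (r i) x - F x))\<^sup>2) \<le> (2 * C)\<^sup>2" for i
      unfolding real_norm_def abs_power2 by (intro AE_I2 power_mono diff_b norm_ge_zero)
  qed simp_all
  then have "\<delta> \<longlonglongrightarrow> 0" unfolding \<delta>_def using tendsto_mult_right_zero by fastforce
  moreover have "L2_sq (f (r i) - f (r j)) \<le> \<delta> i + \<delta> j" for i j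
  proof -
    have "L2_sq (f (r i) - f (r j)) \<le> (LINT x|\<rho>. 2 * (cmod (f (r i) x - F x))\<^sup>2 + 2 * (cmod (f (r j) x - F x))\<^sup>2)"
      unfolding L2_sq_def
    proof (rule integral_mono)
      show "integrable \<rho> (\<lambda>x. (cmod ((f (r i) - f (r j)) x))\<^sup>2)" by (intro sq_integrable H_diff f)
      show "integrable \<rho> (\<lambda>x. 2 * (cmod (f (r i) x - F x))\<^sup>2 + 2 * (cmod (f (r j) x - F x))\<^sup>2)"
        using int by simp
      fix x
      let ?a = "cmod (f (r i) x - F x)" and ?b = "cmod (f (r j) x - F x)"
      have "cmod ((f (r i) - f (r j)) x) \<le> ?a + ?b"
        using norm_triangle_ineq4[of "f (r i) x - F x" "f (r j) x - F x"] by simp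
      then have "(cmod ((f (r i) - f (r j)) x))\<^sup>2 \<le> (?a + ?b)\<^sup>2" by (intro power_mono) auto
      also have "\<dots> \<le> 2 * ?a\<^sup>2 + 2 * ?b\<^sup>2"
        using zero_le_power2[of "?a - ?b"] by (simp only: power2_diff power2_sum)
      finally show "(cmod ((f (r i) - f (r j)) x))\<^sup>2 \<le> 2 * ?a\<^sup>2 + 2 * ?b\<^sup>2" .
    qed
    also have "\<dots> = \<delta> i + \<delta> j" unfolding \<delta>_def using int by simp
    finally show ?thesis .
  qed
  ultimately show ?thesis using r that by blast
qed

end

section \<open>Variational characterisation of the eigenvalues\<close>

lemma fun_scale_one: "fun_scale 1 h = h" by simp

lemma sum_Suc_shift: "(\<Sum>k<n. F (Suc k)) = (\<Sum>k\<in>{1..<Suc n}. F k)" for F :: "nat \<Rightarrow> 'b::comm_monoid_add"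
  by (induction n) simp_all

context embedded_rkhs
begin

lemma L2_sq_tendsto:
  assumes f: "\<And>i. f i \<in> H" "g \<in> H" and lim: "(\<lambda>i. nrm (f i - g)) \<longlonglongrightarrow> 0"
  shows "(\<lambda>i. L2_sq (f i)) \<longlonglongrightarrow> L2_sq g"
proof -
  have c: "g + (f i - g) = f i" for i by (simp add: fun_eq_iff)
  have "L2_sq (f i) = L2_sq g + 2 * Re (lip (f i - g) g) + L2_sq (f i - g)" for i
    using L2_sq_add_scale[OF f(2) H_diff[OF f(1)[of i] f(2)], of 1]
    unfolding fun_scale_one c norm_one power_one mult_1 .
  then have e: "(\<lambda>i. L2_sq (f i)) = (\<lambda>i. L2_sq g + 2 * Re (lip (f i - g) g) + L2_sq (f i - g))" by simp
  have 1: "(\<lambda>i. lip (f i - g) g) \<longlonglongrightarrow> 0"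
  proof (rule Lim_null_comparison)
    show "\<forall>\<^sub>F i in sequentially. norm (lip (f i - g) g) \<le> C\<^sup>2 * nrm g * nrm (f i - g)"
      by (intro always_eventually allI lip_bound H_diff f)
    show "(\<lambda>i. C\<^sup>2 * nrm g * nrm (f i - g)) \<longlonglongrightarrow> 0" by (rule tendsto_mult_right_zero[OF lim])
  qed
  have 2: "(\<lambda>i. L2_sq (f i - g)) \<longlonglongrightarrow> 0"
  proof (rule Lim_null_comparison)
    show "\<forall>\<^sub>F i in sequentially. norm (L2_sq (f i - g)) \<le> C\<^sup>2 * (nrm (f i - g))\<^sup>2"
      using L2_sq_le f by (intro always_eventually allI) (simp add: L2_sq_nonneg H_diff)
    show "(\<lambda>i. C\<^sup>2 * (nrm (f i - g))\<^sup>2) \<longlonglongrightarrow> 0"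
    proof (rule tendsto_mult_right_zero)
      show "(\<lambda>i. (nrm (f i - g))\<^sup>2) \<longlonglongrightarrow> 0" using tendsto_power[OF lim, of 2] by simp
    qed
  qed
  show ?thesis unfolding e using tendsto_add[OF tendsto_add[OF tendsto_const tendsto_mult[OF tendsto_const tendsto_Re[OF 1]]] 2]
    by simp
qed

text \<open>
  The index \<open>m\<close> itself is excluded here and in \<open>proj\<close>, to match the \<open>m - 1\<close> basis functions of the least squares operator.
\<close>

definition orth :: "nat \<Rightarrow> ('a \<Rightarrow> complex) set" where
  "orth m = {f \<in> H. \<forall>k\<in>{1..<m}. ip f (e k) = 0}"

lemma orth_add_scale: "f \<in> orth m \<Longrightarrow> g \<in> orth m \<Longrightarrow> f + fun_scale t g \<in> orth m"
proof -
  assume fg: "f \<in> orth m" "g \<in> orth m"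
  then have "ip (f + fun_scale t g) (e k) = 0" if "k \<in> {1..<m}" for k
    using that unfolding orth_def by (subst ip_add) (auto simp: H_scale e_in_H ip_scale)
  with fg show ?thesis unfolding orth_def by (simp add: H_add H_scale)
qed

definition proj :: "nat \<Rightarrow> ('a \<Rightarrow> complex) \<Rightarrow> 'a \<Rightarrow> complex" where
  "proj m f = (\<Sum>k\<in>{1..<m}. fun_scale (ip f (e k)) (e k))"

lemma proj_in_H: "proj m f \<in> H"
  unfolding proj_def by (intro H_sum H_scale e_in_H) simp

lemma ip_proj: assumes "h \<in> H" shows "ip (proj m f) h = (\<Sum>k\<in>{1..<m}. ip f (e k) * ip (e k) h)"
proof -
  have "ip (proj m f) h = (\<Sum>k\<in>{1..<m}. ip (fun_scale (ip f (e k)) (e k)) h)"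
    unfolding proj_def by (intro ip_sum H_scale e_in_H assms) simp
  also have "\<dots> = (\<Sum>k\<in>{1..<m}. ip f (e k) * ip (e k) h)"
    by (intro sum.cong refl ip_scale e_in_H assms) simp
  finally show ?thesis .
qed

lemma proj_at: "proj m f x = (\<Sum>k\<in>{1..<m}. ip f (e k) * e k x)"
  unfolding proj_def sum_fun_at ..

lemma residual_orth: assumes f: "f \<in> H" shows "f - proj m f \<in> orth m"
proof -
  have "ip (f - proj m f) (e k) = 0" if k: "k \<in> {1..<m}" for k
  proof -
    have k1: "1 \<le> k" using k by simp
    have "ip (proj m f) (e k) = (\<Sum>j\<in>{1..<m}. if j = k then ip f (e j) else 0)"
      unfolding ip_proj[OF e_in_H[OF k1]] using k1
      by (intro sum.cong refl) (simp add: e_orthonormal)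
    also have "\<dots> = ip f (e k)" using k by simp
    finally show ?thesis using k f by (simp add: ip_diff proj_in_H e_in_H)
  qed
  then show ?thesis unfolding orth_def using f by (simp add: H_diff proj_in_H)
qed

lemma residual_nrm: assumes f: "f \<in> H"
  shows "(nrm (f - proj m f))\<^sup>2 = (nrm f)\<^sup>2 - (\<Sum>k\<in>{1..<m}. (cmod (ip f (e k)))\<^sup>2)"
proof -
  define r where "r = f - proj m f"
  have r: "r \<in> H" unfolding r_def by (intro H_diff f proj_in_H)
  have z: "ip (proj m f) r = 0"
  proof -
    have "ip (e k) r = 0" if "k \<in> {1..<m}" for k
      using residual_orth[OF f, of m] that ip_commute[OF r e_in_H, of k] unfolding orth_def r_def by simp
    then show ?thesis unfolding ip_proj[OF r] by simp
  qed
  have "ip r r = ip f r - ip (proj m f) r" using ip_diff[OF f proj_in_H r] unfolding r_def .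
  also have "\<dots> = cnj (ip r f)" using z ip_commute[OF r f] by simp
  also have "ip r f = ip f f - (\<Sum>k\<in>{1..<m}. ip f (e k) * ip (e k) f)"
    unfolding r_def ip_diff[OF f proj_in_H f] ip_proj[OF f] ..
  also have "(\<Sum>k\<in>{1..<m}. ip f (e k) * ip (e k) f) = (\<Sum>k\<in>{1..<m}. complex_of_real ((cmod (ip f (e k)))\<^sup>2))"
    unfolding complex_norm_square using ip_commute[OF f e_in_H] by (intro sum.cong) auto
  finally have "Re (ip r r) = Re (ip f f) - (\<Sum>k\<in>{1..<m}. (cmod (ip f (e k)))\<^sup>2)"
    unfolding of_real_sum[symmetric] by simp
  then show ?thesis unfolding r_def[symmetric] nrm_sq[OF r] nrm_sq[OF f] .
qed

lemma bessel: "f \<in> H \<Longrightarrow> (\<Sum>k\<in>{1..<m}. (cmod (ip f (e k)))\<^sup>2) \<le> (nrm f)\<^sup>2"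
  using residual_nrm[of f m] zero_le_power2[of "nrm (f - proj m f)"] by linarith

lemma residual_nrm_le: assumes "f \<in> H" shows "nrm (f - proj m f) \<le> nrm f"
proof (rule power2_le_imp_le)
  show "(nrm (f - proj m f))\<^sup>2 \<le> (nrm f)\<^sup>2"
    unfolding residual_nrm[OF assms] by (simp add: sum_nonneg)
qed (rule nrm_nonneg[OF assms])

text \<open>
  Bessel's inequality for the kernel section at \<open>x\<close>, whose coefficients are the conjugates of \<open>e k x\<close>.
\<close>

lemma bessel_e: assumes "finite A" "A \<subseteq> {1..}" shows "(\<Sum>k\<in>A. (cmod (e k x))\<^sup>2) \<le> C\<^sup>2"
proof (cases "x \<in> D")
  case True
  let ?k = "kernel_section D K x"
  have k: "?k \<in> H" by (rule kernel_section_in[OF True])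
  have "cmod (e j x) = cmod (ip ?k (e j))" if "1 \<le> j" for j
    using reproducing[OF e_in_H[OF that] True] ip_commute[OF k e_in_H[OF that]] by simp
  then have "(\<Sum>k\<in>A. (cmod (e k x))\<^sup>2) = (\<Sum>k\<in>A. (cmod (ip ?k (e k)))\<^sup>2)"
    using assms by (intro sum.cong) auto
  also have "\<dots> \<le> (\<Sum>k\<in>{1..<Suc (Max A)}. (cmod (ip ?k (e k)))\<^sup>2)"
    using assms by (intro sum_mono2) (auto simp: less_Suc_eq_le)
  also have "\<dots> \<le> (nrm ?k)\<^sup>2" by (rule bessel[OF k])
  also have "\<dots> \<le> C\<^sup>2" by (intro power_mono nrm_kernel_section True nrm_nonneg k)
  finally show ?thesis .
next
  case False
  have "(\<Sum>k\<in>A. (cmod (e k x))\<^sup>2) = 0"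
    using vanish_outside[OF e_in_H False] assms by (intro sum.neutral) auto
  then show ?thesis by simp
qed

text \<open>
  A maximising sequence that is Cauchy in \<open>L\<^sub>2\<close> is Cauchy in \<open>H\<close> as well: the midpoints of late members
  almost attain the maximum \<open>s\<close>, hence have norm almost \<open>1\<close>, and the parallelogram law forces the
  members to be close to each other.
\<close>

lemma maximizer:
  assumes s: "0 < s" and sup: "\<And>f. f \<in> orth m \<Longrightarrow> L2_sq f \<le> s * (nrm f)\<^sup>2"
    and approx: "\<And>\<epsilon>. 0 < \<epsilon> \<Longrightarrow> \<exists>f\<in>orth m. nrm f \<le> 1 \<and> s - \<epsilon> < L2_sq f"
  obtains f where "f \<in> orth m" "nrm f \<le> 1" "L2_sq f = s"
proof -
  have "\<exists>f\<in>orth m. nrm f \<le> 1 \<and> s - inverse (real (Suc i)) < L2_sq f" for i by (rule approx) simp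
  then obtain f where f: "\<And>i. f i \<in> orth m" "\<And>i. nrm (f i) \<le> 1"
    "\<And>i. s - inverse (real (Suc i)) < L2_sq (f i)" by metis
  have fH: "f i \<in> H" for i using f(1)[of i] by (simp add: orth_def)
  obtain r \<delta> where r: "strict_mono r" and \<delta>: "\<delta> \<longlonglongrightarrow> 0"
    and d: "\<And>i j. L2_sq (f (r i) - f (r j)) \<le> \<delta> i + \<delta> j"
    by (rule L2_Cauchy_subsequence[of f, OF fH f(2)]) (rule that)
  \<comment> \<open>How far the \<open>i\<close>th member is from maximality, together with its error \<open>\<delta> i\<close> in \<open>L\<^sub>2\<close> distance.\<close>
  define \<gamma> where "\<gamma> i = (2 * inverse (real (Suc i)) + \<delta> i) / s" for i
  have \<gamma>: "\<gamma> \<longlonglongrightarrow> 0"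
    unfolding \<gamma>_def
    using tendsto_divide[OF tendsto_add[OF tendsto_mult_right_zero[OF LIMSEQ_inverse_real_of_nat, of 2] \<delta>] tendsto_const, of s] s
    by simp
  have L2_sq_r: "s - inverse (real (Suc i)) < L2_sq (f (r i))" for i
  proof -
    have "inverse (real (Suc (r i))) \<le> inverse (real (Suc i))"
      using seq_suble[OF r, of i] by (intro le_imp_inverse_le) auto
    then show ?thesis using f(3)[of "r i"] by linarith
  qed
  have close: "(nrm (f (r i) - f (r j)))\<^sup>2 \<le> \<gamma> i + \<gamma> j" for i j
  proof -
    let ?a = "f (r i)" and ?b = "f (r j)"
    have one: "fun_scale 1 ?b = ?b" by simp
    have "L2_sq (?a + ?b) \<le> s * (nrm (?a + ?b))\<^sup>2"
      using sup[OF orth_add_scale[OF f(1) f(1), of "r i" 1 "r j"]] unfolding one .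
    moreover have "(nrm (?a - ?b))\<^sup>2 + (nrm (?a + ?b))\<^sup>2 = 2 * (nrm ?a)\<^sup>2 + 2 * (nrm ?b)\<^sup>2"
      by (simp add: nrm_add_sq nrm_diff_sq fH)
    moreover have "(nrm ?a)\<^sup>2 \<le> 1" "(nrm ?b)\<^sup>2 \<le> 1"
      using f(2) nrm_nonneg[OF fH] by (simp_all add: power_le_one)
    ultimately have "(nrm (?a - ?b))\<^sup>2 + (nrm (?a + ?b))\<^sup>2 \<le> 4"
      and le: "L2_sq (?a + ?b) \<le> s * (nrm (?a + ?b))\<^sup>2" by linarith+
    then have "s * ((nrm (?a - ?b))\<^sup>2 + (nrm (?a + ?b))\<^sup>2) \<le> s * 4"
      using s by (intro mult_left_mono) simp_all
    with le have "s * (nrm (?a - ?b))\<^sup>2 \<le> 4 * s - L2_sq (?a + ?b)"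
      unfolding distrib_left by linarith
    also have "\<dots> \<le> (2 * inverse (real (Suc i)) + \<delta> i) + (2 * inverse (real (Suc j)) + \<delta> j)"
      using L2_sq_parallelogram[OF fH fH, of "r i" "r j"] d[of i j] L2_sq_r[of i] L2_sq_r[of j] by linarith
    also have "\<dots> = s * (\<gamma> i + \<gamma> j)"
      using s unfolding \<gamma>_def distrib_left by simp
    finally show ?thesis using s by simp
  qed
  obtain g where g: "g \<in> H" and lim: "(\<lambda>i. nrm (f (r i) - g)) \<longlonglongrightarrow> 0"
  proof (rule Cauchy_limit[of "\<lambda>i. f (r i)", OF fH])
    fix \<epsilon> :: real assume e: "0 < \<epsilon>"
    then have "0 < \<epsilon>\<^sup>2 / 2" by simp
    from order_tendstoD(2)[OF \<gamma> this] obtain N where N: "\<And>i. i \<ge> N \<Longrightarrow> \<gamma> i < \<epsilon>\<^sup>2 / 2"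
      unfolding eventually_sequentially by blast
    have "nrm (f (r i) - f (r j)) < \<epsilon>" if "i \<ge> N" "j \<ge> N" for i j
    proof (rule power2_less_imp_less)
      show "(nrm (f (r i) - f (r j)))\<^sup>2 < \<epsilon>\<^sup>2" using close[of i j] N[OF that(1)] N[OF that(2)] by linarith
    qed (use e in simp)
    then show "\<exists>N. \<forall>i\<ge>N. \<forall>j\<ge>N. nrm (f (r i) - f (r j)) < \<epsilon>" by blast
  qed (rule that)
  have g_orth: "g \<in> orth m"
  proof -
    have "ip g (e k) = 0" if k: "k \<in> {1..<m}" for k
    proof -
      have "(\<lambda>i. ip (f (r i)) (e k)) \<longlonglongrightarrow> ip g (e k)"
        using k by (intro ip_tendsto fH g e_in_H lim) simp
      moreover have "ip (f (r i)) (e k) = 0" for i using f(1)[of "r i"] k by (simp add: orth_def)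
      ultimately show ?thesis by (simp add: LIMSEQ_const_iff)
    qed
    with g show ?thesis by (simp add: orth_def)
  qed
  have g1: "nrm g \<le> 1"
    by (rule LIMSEQ_le_const2[OF nrm_tendsto[OF fH g lim]]) (use f(2) in blast)
  have "s \<le> L2_sq g"
  proof (rule LIMSEQ_le)
    show "(\<lambda>i. s - inverse (real (Suc i))) \<longlonglongrightarrow> s"
      using tendsto_diff[OF tendsto_const LIMSEQ_inverse_real_of_nat, of s] by simp
    show "(\<lambda>i. L2_sq (f (r i))) \<longlonglongrightarrow> L2_sq g" by (rule L2_sq_tendsto[OF fH g lim])
    show "\<exists>N. \<forall>n\<ge>N. s - inverse (real (Suc n)) \<le> L2_sq (f (r n))" using L2_sq_r less_imp_le by blast
  qed
  moreover have "L2_sq g \<le> s"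
  proof -
    have "s * (nrm g)\<^sup>2 \<le> s * 1"
      by (intro mult_left_mono power_le_one nrm_nonneg g g1) (use s in simp)
    with sup[OF g_orth] show ?thesis by simp
  qed
  ultimately show ?thesis using that g_orth g1 by simp
qed

text \<open>
  Let \<open>s\<close> be the supremum of the squared \<open>L\<^sub>2\<close> norm over the unit ball of the complement.  If \<open>s > \<lambda>\<^sub>m\<close>, a
  maximiser is an eigenvector for \<open>s\<close>, since it minimises the positive form \<open>s \<parallel>\<cdot>\<parallel>\<^sup>2 - \<parallel>\<cdot>\<parallel>\<^sup>2\<^bsub>L2\<^esub>\<close>.  So it lies in the
  span of the \<open>e k\<close> with \<open>lam k = s\<close>; all of these have \<open>k < m\<close>, and the maximiser is orthogonal to them.
\<close>

lemma L2_norm_le_on_orth: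
  assumes m: "1 \<le> m" and f: "f \<in> orth m"
  shows "L2_sq f \<le> lam m * (nrm f)\<^sup>2"
proof -
  let ?S = "{L2_sq g |g. g \<in> orth m \<and> nrm g \<le> 1}"
  define s where "s = Sup ?S"
  have bdd: "bdd_above ?S"
  proof (rule bdd_aboveI)
    fix z assume "z \<in> ?S"
    then obtain g where g: "g \<in> H" "nrm g \<le> 1" "z = L2_sq g" by (auto simp: orth_def)
    have "(nrm g)\<^sup>2 \<le> 1" by (rule power_le_one[OF nrm_nonneg[OF g(1)] g(2)])
    then have "C\<^sup>2 * (nrm g)\<^sup>2 \<le> C\<^sup>2 * 1" by (intro mult_left_mono) simp_all
    with L2_sq_le[OF g(1)] g(3) show "z \<le> C\<^sup>2" by simp
  qed
  have z_orth: "0 \<in> orth m" unfolding orth_def by (auto simp: H_zero ip_zero_left e_in_H)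
  have ne: "?S \<noteq> {}" using z_orth nrm_eq_0[OF H_zero] by force
  have unit: "L2_sq g \<le> s" if "g \<in> orth m" "nrm g \<le> 1" for g
    unfolding s_def using that by (intro cSup_upper bdd) auto
  have s0: "0 \<le> s" using unit[OF z_orth] L2_sq_nonneg[of 0] nrm_eq_0[OF H_zero] by simp
  have sup: "L2_sq g \<le> s * (nrm g)\<^sup>2" if g: "g \<in> orth m" for g
  proof (cases "g = 0")
    case True
    then show ?thesis using s0 by (simp add: L2_sq_def)
  next
    case False
    have gH: "g \<in> H" using g by (simp add: orth_def)
    have n: "0 < nrm g" using False nrm_eq_0[OF gH] nrm_nonneg[OF gH] by simp
    let ?c = "complex_of_real (1 / nrm g)"
    have "0 + fun_scale ?c g \<in> orth m" by (rule orth_add_scale[OF z_orth g])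
    then have o: "fun_scale ?c g \<in> orth m" by simp
    have "nrm (fun_scale ?c g) = 1" unfolding nrm_scale[OF gH] norm_of_real using n by simp
    then have "L2_sq (fun_scale ?c g) \<le> s" using unit[OF o] by simp
    moreover have "L2_sq (fun_scale ?c g) = (1 / nrm g)\<^sup>2 * L2_sq g"
      unfolding L2_sq_def norm_mult power_mult_distrib norm_of_real power2_abs by (rule integral_mult_right_zero)
    ultimately have "(1 / nrm g)\<^sup>2 * L2_sq g \<le> s" by (simp only:)
    then show ?thesis using n by (simp add: field_simps power2_eq_square)
  qed
  have "s \<le> lam m"
  proof (rule ccontr)
    assume "\<not> s \<le> lam m"
    then have s_lam: "lam m < s" by simp
    then have s_pos: "0 < s" using lam_pos[OF m] by simp
    obtain g where g: "g \<in> orth m" "nrm g \<le> 1" "L2_sq g = s"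
    proof (rule maximizer[OF s_pos sup])
      fix \<epsilon> :: real assume "0 < \<epsilon>"
      then have "s - \<epsilon> < Sup ?S" unfolding s_def by simp
      from less_cSupD[OF ne this] show "\<exists>f\<in>orth m. nrm f \<le> 1 \<and> s - \<epsilon> < L2_sq f" by auto
    qed (auto intro: that)
    have gH: "g \<in> H" using g by (simp add: orth_def)
    have "s * (nrm g)\<^sup>2 \<le> s * 1"
      by (intro mult_left_mono power_le_one nrm_nonneg gH g(2)) (use s_pos in simp)
    then have ng: "s * (nrm g)\<^sup>2 = s" using sup[OF g(1)] g(3) by simp
    have eq_orth: "lip h g = s * ip h g" if h: "h \<in> orth m" for h
    proof -
      have hH: "h \<in> H" using h by (simp add: orth_def)
      have "(cmod (s * ip h g - lip h g))\<^sup>2 \<le> 0 * (s * (nrm h)\<^sup>2 - L2_sq h)"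
      proof (rule quadratic_form_CS)
        show "0 \<le> s * (nrm h)\<^sup>2 - L2_sq h" using sup[OF h] by simp
        fix t
        have "L2_sq (g + fun_scale t h) \<le> s * (nrm (g + fun_scale t h))\<^sup>2"
          by (rule sup[OF orth_add_scale[OF g(1) h]])
        then show "0 \<le> 0 + 2 * Re (t * (s * ip h g - lip h g)) + (cmod t)\<^sup>2 * (s * (nrm h)\<^sup>2 - L2_sq h)"
          unfolding L2_sq_add_scale[OF gH hH] nrm_add_scale_sq[OF gH hH] using ng g(3)
          by (simp add: algebra_simps)
      qed simp
      then show ?thesis by simp
    qed
    have eq: "lip h g = s * ip h g" if h: "h \<in> H" for h
    proof -
      have gz: "ip (e k) g = 0" "lip (e k) g = 0" if k: "k \<in> {1..<m}" for k
      proof -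
        have k1: "1 \<le> k" using k by simp
        have z: "ip g (e k) = 0" using g(1) k by (simp add: orth_def)
        then show "ip (e k) g = 0" using ip_commute[OF gH e_in_H[OF k1]] by simp
        show "lip (e k) g = 0" using lip_commute[of "e k" g] lip_e[OF k1 gH] z by simp
      qed
      have ip0: "ip (proj m h) g = 0" unfolding ip_proj[OF gH] by (intro sum.neutral) (simp add: gz)
      have "lip (proj m h) g = (\<Sum>k\<in>{1..<m}. lip (fun_scale (ip h (e k)) (e k)) g)"
        unfolding proj_def by (intro lip_sum H_scale e_in_H gH) simp
      also have "\<dots> = 0" by (intro sum.neutral ballI) (simp only: lip_scale gz mult_zero_right)
      finally have lip0: "lip (proj m h) g = 0" .
      have "lip (h - proj m h) g = s * ip (h - proj m h) g" by (rule eq_orth[OF residual_orth[OF h]])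
      then show ?thesis
        unfolding lip_diff[OF h proj_in_H gH] ip_diff[OF h proj_in_H gH] ip0 lip0 by simp
    qed
    have "embedding_gram H ip \<rho> g = fun_scale (complex_of_real s) g"
      unfolding embedding_gram_eq_iff[OF gH H_scale[OF gH]]
      by (intro ballI) (simp only: ip_scale_right[OF gH] eq complex_cnj_complex_of_real)
    then have "g \<in> fun_span {e k |k. 1 \<le> k \<and> lam k = s}"
      using eigensystem s_pos gH unfolding embedding_eigensystem_def by blast
    moreover have "fun_span {e k |k. 1 \<le> k \<and> lam k = s} \<subseteq> {h \<in> H. ip g h = 0}"
    proof (rule Modules.module.span_minimal[OF fun_module])
      show "fun_subspace {h \<in> H. ip g h = 0}"
        unfolding Modules.module.subspace_def[OF fun_module]
        using ip_commute[OF H_zero gH] ip_zero_left[OF gH]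
        by (auto simp: H_zero H_add H_scale ip_add_right gH ip_scale_right)
      show "{e k |k. 1 \<le> k \<and> lam k = s} \<subseteq> {h \<in> H. ip g h = 0}"
      proof
        fix x assume "x \<in> {e k |k. 1 \<le> k \<and> lam k = s}"
        then obtain k where k: "1 \<le> k" "lam k = s" "x = e k" by auto
        have "k < m" using lam_antimono[OF m, of k] k s_lam by (cases "k < m") auto
        then show "x \<in> {h \<in> H. ip g h = 0}" using g(1) k by (simp add: orth_def e_in_H)
      qed
    qed
    ultimately have "g \<in> {h \<in> H. ip g h = 0}" by blast
    then have "ip g g = 0" by simp
    then have "g = 0" using ip_definite[OF gH] by simp
    then show False using g(3) s_pos by (simp add: L2_sq_def)
  qed
  then show ?thesis
    using sup[OF f] mult_right_mono[of s "lam m" "(nrm f)\<^sup>2"] by simp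
qed

lemma L2_sq_e: assumes "1 \<le> k" shows "L2_sq (e k) = lam k"
proof -
  have "complex_of_real (L2_sq (e k)) = complex_of_real (lam k)"
    using lip_self[OF e_in_H[OF assms]] lip_e[OF assms e_in_H[OF assms]] e_orthonormal[OF assms assms] by simp
  then show ?thesis by (simp only: of_real_eq_iff)
qed

text \<open>
  The embedding has finite trace: integrating Bessel's inequality gives \<open>n \<lambda>\<^sub>n \<le> \<lambda>\<^sub>1 + \<dots> + \<lambda>\<^sub>n \<le> C\<^sup>2\<close>.
\<close>

lemma lam_tendsto_0: "lam \<longlonglongrightarrow> 0"
proof (rule Lim_null_comparison)
  have "real n * lam n \<le> C\<^sup>2" for n
  proof -
    have "real n * lam n = (\<Sum>k\<in>{1..<Suc n}. lam n)" by simp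
    also have "\<dots> \<le> (\<Sum>k\<in>{1..<Suc n}. lam k)" by (intro sum_mono lam_antimono) auto
    also have "\<dots> = (\<Sum>k\<in>{1..<Suc n}. L2_sq (e k))" by (intro sum.cong) (auto simp: L2_sq_e)
    also have "\<dots> = (LINT x|\<rho>. (\<Sum>k\<in>{1..<Suc n}. (cmod (e k x))\<^sup>2))"
      unfolding L2_sq_def by (rule Bochner_Integration.integral_sum[symmetric]) (intro sq_integrable e_in_H, simp)
    also have "\<dots> \<le> (LINT x|\<rho>. C\<^sup>2)"
      by (intro integral_mono Bochner_Integration.integrable_sum sq_integrable e_in_H bessel_e) auto
    finally show ?thesis by (simp add: prob_space)
  qed
  then show "\<forall>\<^sub>F n in sequentially. norm (lam n) \<le> C\<^sup>2 * inverse (real n)"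
    using lam_pos by (intro eventually_sequentiallyI[of 1]) (simp add: field_simps less_imp_le)
  show "(\<lambda>n. C\<^sup>2 * inverse (real n)) \<longlonglongrightarrow> 0"
    by (rule tendsto_mult_right_zero[OF tendsto_inverse_0_at_top[OF filterlim_real_sequentially]])
qed

lemma proj_convergent: assumes f: "f \<in> H" shows "convergent (\<lambda>m. proj (Suc m) f x)"
proof -
  let ?a = "\<lambda>k. ip f (e (Suc k)) * e (Suc k) x"
  have "summable (\<lambda>k. norm (?a k))"
  proof (rule summableI_nonneg_bounded)
    fix n
    have "norm (?a k) \<le> (cmod (ip f (e (Suc k))))\<^sup>2 + (cmod (e (Suc k) x))\<^sup>2" for k
    proof -
      have "2 * (cmod (ip f (e (Suc k))) * cmod (e (Suc k) x)) \<le> (cmod (ip f (e (Suc k))))\<^sup>2 + (cmod (e (Suc k) x))\<^sup>2"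
        using zero_le_power2[of "cmod (ip f (e (Suc k))) - cmod (e (Suc k) x)"] by (simp add: power2_diff)
      moreover have "0 \<le> cmod (ip f (e (Suc k))) * cmod (e (Suc k) x)" by simp
      ultimately show ?thesis unfolding norm_mult by linarith
    qed
    then have "(\<Sum>k<n. norm (?a k)) \<le> (\<Sum>k<n. (cmod (ip f (e (Suc k))))\<^sup>2 + (cmod (e (Suc k) x))\<^sup>2)"
      by (rule sum_mono)
    also have "\<dots> \<le> (nrm f)\<^sup>2 + C\<^sup>2"
      unfolding sum.distrib sum_Suc_shift[of "\<lambda>k. (cmod (ip f (e k)))\<^sup>2"] sum_Suc_shift[of "\<lambda>k. (cmod (e k x))\<^sup>2"]
      by (intro add_mono bessel[OF f] bessel_e) auto
    finally show "(\<Sum>k<n. norm (?a k)) \<le> (nrm f)\<^sup>2 + C\<^sup>2" .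
  qed simp
  then have "summable ?a" by (rule summable_norm_cancel)
  then have "convergent (\<lambda>n. \<Sum>k<n. ?a k)" by (simp add: summable_iff_convergent)
  moreover have "(\<Sum>k<n. ?a k) = proj (Suc n) f x" for n
    unfolding proj_at by (rule sum_Suc_shift)
  ultimately show ?thesis by simp
qed

text \<open>
  The residuals converge pointwise, boundedly, and to zero in \<open>L\<^sub>2\<close> because \<open>\<lambda>\<^sub>m\<close> tends to zero.  So their pointwise
  limit vanishes almost everywhere.
\<close>

lemma AE_expansion_single:
  assumes f: "f \<in> H"
  shows "AE x in \<rho>. (\<lambda>m. proj (Suc m) f x) \<longlonglongrightarrow> f x"
proof -
  define r where "r x = f x - lim (\<lambda>m. proj (Suc m) f x)" for x
  have lim: "(\<lambda>m. (f - proj (Suc m) f) x) \<longlonglongrightarrow> r x" for x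
    using tendsto_diff[OF tendsto_const[of "f x"] proj_convergent[OF f, of x, unfolded convergent_LIMSEQ_iff]]
    unfolding r_def by simp
  have Rm [measurable]: "f - proj m f \<in> borel_measurable \<rho>" for m
    by (intro H_measurable H_diff f proj_in_H)
  have rm [measurable]: "r \<in> borel_measurable \<rho>"
    by (rule borel_measurable_LIMSEQ_metric[of "\<lambda>m. f - proj (Suc m) f"]) (use Rm lim in auto)
  have bound: "norm ((cmod ((f - proj m f) x))\<^sup>2) \<le> (C * nrm f)\<^sup>2" for m x
  proof -
    have "cmod ((f - proj m f) x) \<le> C * nrm (f - proj m f)" by (intro eval_bound H_diff f proj_in_H)
    also have "\<dots> \<le> C * nrm f" by (intro mult_left_mono residual_nrm_le f C_nonneg)
    finally show ?thesis unfolding real_norm_def abs_power2 by (intro power_mono) auto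
  qed
  have lim2: "(\<lambda>m. (cmod ((f - proj (Suc m) f) x))\<^sup>2) \<longlonglongrightarrow> (cmod (r x))\<^sup>2" for x
    by (intro tendsto_intros lim)
  have mm: "(\<lambda>x. (cmod ((f - proj m f) x))\<^sup>2) \<in> borel_measurable \<rho>" for m
    using Rm[of m] by measurable
  have int: "integrable \<rho> (\<lambda>x. (cmod (r x))\<^sup>2)"
    and conv: "(\<lambda>m. L2_sq (f - proj (Suc m) f)) \<longlonglongrightarrow> (LINT x|\<rho>. (cmod (r x))\<^sup>2)"
    unfolding L2_sq_def
    using integrable_dominated_convergence[where s="\<lambda>m x. (cmod ((f - proj (Suc m) f) x))\<^sup>2" and w="\<lambda>_. (C * nrm f)\<^sup>2" and M=\<rho> and f="\<lambda>x. (cmod (r x))\<^sup>2"]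
      integral_dominated_convergence[where s="\<lambda>m x. (cmod ((f - proj (Suc m) f) x))\<^sup>2" and w="\<lambda>_. (C * nrm f)\<^sup>2" and M=\<rho> and f="\<lambda>x. (cmod (r x))\<^sup>2"]
      bound lim2 mm by auto
  have "(\<lambda>m. L2_sq (f - proj (Suc m) f)) \<longlonglongrightarrow> 0"
  proof (rule Lim_null_comparison)
    have "L2_sq (f - proj (Suc m) f) \<le> lam (Suc m) * (nrm f)\<^sup>2" for m
    proof -
      have "L2_sq (f - proj (Suc m) f) \<le> lam (Suc m) * (nrm (f - proj (Suc m) f))\<^sup>2"
        by (intro L2_norm_le_on_orth residual_orth f) simp
      also have "\<dots> \<le> lam (Suc m) * (nrm f)\<^sup>2"
        by (intro mult_left_mono power_mono residual_nrm_le f nrm_nonneg H_diff proj_in_H less_imp_le[OF lam_pos]) simp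
      finally show ?thesis .
    qed
    then show "\<forall>\<^sub>F m in sequentially. norm (L2_sq (f - proj (Suc m) f)) \<le> lam (Suc m) * (nrm f)\<^sup>2"
      by (simp add: L2_sq_nonneg)
    show "(\<lambda>m. lam (Suc m) * (nrm f)\<^sup>2) \<longlonglongrightarrow> 0"
      by (rule tendsto_mult_left_zero[OF LIMSEQ_Suc[OF lam_tendsto_0]])
  qed
  with conv have "(LINT x|\<rho>. (cmod (r x))\<^sup>2) = 0" by (rule LIMSEQ_unique)
  then have "AE x in \<rho>. (cmod (r x))\<^sup>2 = 0"
    using integral_nonneg_eq_0_iff_AE[OF int] by simp
  then show ?thesis
  proof eventually_elim
    case (elim x)
    then have "(\<lambda>m. (f - proj (Suc m) f) x) \<longlonglongrightarrow> 0" using lim[of x] by simp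
    from tendsto_diff[OF tendsto_const[of "f x"] this] show ?case by simp
  qed
qed

lemma proj_diff: assumes "f \<in> H" "g \<in> H" shows "proj m (f - g) = proj m f - proj m g"
proof
  fix x
  have "proj m (f - g) x = (\<Sum>k\<in>{1..<m}. ip f (e k) * e k x - ip g (e k) * e k x)"
    unfolding proj_at by (intro sum.cong refl) (simp add: ip_diff assms e_in_H algebra_simps)
  then show "proj m (f - g) x = (proj m f - proj m g) x" by (simp add: sum_subtractf proj_at)
qed

text \<open>
  One null set serves all \<open>f\<close>: it is chosen for a dense sequence, and the residual at a point is bounded by
  \<open>C\<close> times the norm, uniformly in the truncation.
\<close>

lemma AE_expansion: "AE x in \<rho>. \<forall>f\<in>H. (\<lambda>m. proj (Suc m) f x) \<longlonglongrightarrow> f x"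
proof -
  obtain g where g: "\<And>j::nat. g j \<in> H" and dense: "\<And>h \<epsilon>. h \<in> H \<Longrightarrow> 0 < \<epsilon> \<Longrightarrow> \<exists>j. nrm (h - g j) < \<epsilon>"
    using dense_sequence[OF separable] by blast
  have "AE x in \<rho>. \<forall>j. (\<lambda>m. proj (Suc m) (g j) x) \<longlonglongrightarrow> g j x"
    unfolding AE_all_countable using AE_expansion_single[OF g] by blast
  then show ?thesis
  proof eventually_elim
    case (elim x)
    show ?case
    proof
      fix f assume f: "f \<in> H"
      show "(\<lambda>m. proj (Suc m) f x) \<longlonglongrightarrow> f x"
      proof (rule LIMSEQ_I)
        fix \<epsilon> :: real assume e: "0 < \<epsilon>"
        define \<eta> where "\<eta> = \<epsilon> / 2 / (C + 1)"
        have \<eta>: "0 < \<eta>" "C * \<eta> \<le> \<epsilon> / 2" using e C_nonneg by (auto simp: \<eta>_def field_simps)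
        obtain j where j: "nrm (f - g j) < \<eta>" using dense[OF f \<eta>(1)] by blast
        obtain N where N: "\<And>m. m \<ge> N \<Longrightarrow> norm (proj (Suc m) (g j) x - g j x) < \<epsilon> / 2"
          using LIMSEQ_D[OF elim[rule_format, of j], of "\<epsilon> / 2"] e by auto
        have "norm (proj (Suc m) f x - f x) < \<epsilon>" if "m \<ge> N" for m
        proof -
          let ?h = "f - g j"
          have h: "?h \<in> H" by (intro H_diff f g)
          have "cmod ((?h - proj (Suc m) ?h) x) \<le> C * nrm (?h - proj (Suc m) ?h)"
            by (intro eval_bound H_diff h proj_in_H)
          also have "\<dots> \<le> C * nrm ?h" by (intro mult_left_mono residual_nrm_le h C_nonneg)
          also have "\<dots> \<le> C * \<eta>" using j by (intro mult_left_mono C_nonneg) simp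
          finally have 1: "cmod ((?h - proj (Suc m) ?h) x) \<le> \<epsilon> / 2" using \<eta>(2) by simp
          have "f x - proj (Suc m) f x = (?h - proj (Suc m) ?h) x - (proj (Suc m) (g j) x - g j x)"
            unfolding proj_diff[OF f g] by simp
          then have "cmod (f x - proj (Suc m) f x) \<le> cmod ((?h - proj (Suc m) ?h) x) + cmod (proj (Suc m) (g j) x - g j x)"
            by (simp only: norm_triangle_ineq4)
          with 1 have "cmod (f x - proj (Suc m) f x) \<le> \<epsilon> / 2 + cmod (proj (Suc m) (g j) x - g j x)"
            by linarith
          with N[OF that] show ?thesis by (simp add: norm_minus_commute)
        qed
        then show "\<exists>N. \<forall>m\<ge>N. norm (proj (Suc m) f x - f x) < \<epsilon>" by blast
      qed
    qed
  qed
qed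

end

section \<open>Linear algebra of least squares\<close>

lemma mult_vec_at:
  assumes "A \<in> carrier_mat n d" "v \<in> carrier_vec d" "j < n"
  shows "(A *\<^sub>v v) $ j = (\<Sum>k<d. A $$ (j, k) * v $ k)"
  using assms by (simp add: scalar_prod_def lessThan_atLeast0)

lemma smult_mult_vec:
  fixes A :: "complex Matrix.mat"
  assumes "A \<in> carrier_mat n d" "v \<in> carrier_vec d"
  shows "(c \<cdot>\<^sub>m A) *\<^sub>v v = c \<cdot>\<^sub>v (A *\<^sub>v v)"
proof (rule eq_vecI)
  fix i assume "i < dim_vec (c \<cdot>\<^sub>v (A *\<^sub>v v))"
  then have i: "i < n" using assms by simp
  have "((c \<cdot>\<^sub>m A) *\<^sub>v v) $ i = (\<Sum>k<d. (c \<cdot>\<^sub>m A) $$ (i, k) * v $ k)"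
    by (rule mult_vec_at[OF smult_carrier_mat[OF assms(1)] assms(2) i])
  also have "\<dots> = c * (\<Sum>k<d. A $$ (i, k) * v $ k)"
    using assms i by (simp add: sum_distrib_left mult.assoc)
  finally show "((c \<cdot>\<^sub>m A) *\<^sub>v v) $ i = (c \<cdot>\<^sub>v (A *\<^sub>v v)) $ i"
    using mult_vec_at[OF assms i] i assms by simp
qed (use assms in simp)

text \<open>
  The rank is the dimension of the span of the set of columns, so the distinctness of the columns has to be
  derived in both directions.
\<close>

lemma full_column_rank_iff_kernel:
  fixes A :: "complex Matrix.mat"
  assumes A: "A \<in> carrier_mat n d"
  shows "full_column_rank A \<longleftrightarrow> (\<forall>v\<in>carrier_vec d. A *\<^sub>v v = 0\<^sub>v n \<longrightarrow> v = 0\<^sub>v d)"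
proof -
  interpret V: vec_space "TYPE(complex)" n .
  have dims: "dim_row A = n" "dim_col A = d" using A by auto
  show ?thesis
    unfolding full_column_rank_def dims
  proof
    assume r: "V.rank A = d"
    have "distinct (cols A)"
    proof -
      obtain S where S: "maximal S (\<lambda>T. T \<subseteq> set (cols A) \<and> V.lin_indpt T)"
        using maximal_exists[of "\<lambda>T. T \<subseteq> set (cols A) \<and> V.lin_indpt T" "card (set (cols A))" "{}"]
        by (meson List.finite_set card_mono empty_iff empty_subsetI V.finite_lin_indpt2 rev_finite_subset)
      then have "card S \<le> card (set (cols A))" by (simp add: card_mono maximal_def)
      then have "length (cols A) \<le> card (set (cols A))"
        using V.rank_card_indpt[OF A S] r dims by simp
      then show ?thesis by (intro card_distinct) (use card_length[of "cols A"] in simp)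
    qed
    note dist = this
    have indpt: "V.lin_indpt (set (cols A))" by (rule V.full_rank_lin_indpt[OF A r dist])
    show "\<forall>v\<in>carrier_vec d. A *\<^sub>v v = 0\<^sub>v n \<longrightarrow> v = 0\<^sub>v d"
    proof (intro ballI impI, rule ccontr)
      fix v assume "v \<in> carrier_vec d" "A *\<^sub>v v = 0\<^sub>v n" "v \<noteq> 0\<^sub>v d"
      with V.lin_depI[OF A this(1) this(3) this(2) dist] indpt show False by simp
    qed
  next
    assume k: "\<forall>v\<in>carrier_vec d. A *\<^sub>v v = 0\<^sub>v n \<longrightarrow> v = 0\<^sub>v d"
    have dist: "distinct (cols A)"
      unfolding distinct_conv_nth
    proof (intro allI impI notI)
      fix i j assume ij: "i < length (cols A)" "j < length (cols A)" "i \<noteq> j" and eq: "cols A ! i = cols A ! j"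
      have ijd: "i < d" "j < d" using ij dims by auto
      have "col A i = col A j" using eq ijd dims by simp
      then have entry: "A $$ (r, i) = A $$ (r, j)" if "r < n" for r
        using that ijd dims by (metis index_col)
      have "(A *\<^sub>v (unit_vec d i - unit_vec d j)) $ r = 0" if "r < n" for r
      proof -
        have "(A *\<^sub>v (unit_vec d i - unit_vec d j)) $ r = (\<Sum>k<d. A $$ (r, k) * (unit_vec d i - unit_vec d j) $ k)"
          by (rule mult_vec_at[OF A minus_carrier_vec[OF unit_vec_carrier unit_vec_carrier] that])
        also have "\<dots> = (\<Sum>k<d. (if k = i then A $$ (r, k) else 0) - (if k = j then A $$ (r, k) else 0))"
          using ijd by (intro sum.cong refl) (simp add: unit_vec_def)
        also have "\<dots> = A $$ (r, i) - A $$ (r, j)" using ijd by (simp add: sum_subtractf)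
        finally show ?thesis using entry[OF that] by simp
      qed
      then have "A *\<^sub>v (unit_vec d i - unit_vec d j) = 0\<^sub>v n" using dims by (intro eq_vecI) auto
      then have "unit_vec d i - unit_vec d j = (0\<^sub>v d :: complex Matrix.vec)" using k by simp
      then have "(unit_vec d i - unit_vec d j) $ i = (0\<^sub>v d :: complex Matrix.vec) $ i" by simp
      then show False using ijd ij(3) by simp
    qed
    have "V.lin_indpt (set (cols A))"
    proof
      assume "V.lin_dep (set (cols A))"
      then obtain v where "v \<in> carrier_vec d" "v \<noteq> 0\<^sub>v d" "A *\<^sub>v v = 0\<^sub>v n"
        by (rule V.lin_depE[OF A _ dist])
      with k show False by simp
    qed
    then show "V.rank A = d" by (rule V.lin_indpt_full_rank[OF A dist])
  qed
qed

lemma mat_adjoint_carrier: "A \<in> carrier_mat n d \<Longrightarrow> mat_adjoint A \<in> carrier_mat d n"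
  unfolding mat_adjoint_def by auto

lemma mat_adjoint_index:
  fixes A :: "complex Matrix.mat"
  assumes "A \<in> carrier_mat n d" "i < d" "j < n"
  shows "mat_adjoint A $$ (i, j) = cnj (A $$ (j, i))"
  using assms unfolding mat_adjoint_def by (simp add: mat_of_rows_index conjugate_complex_def)

lemma gram_mult_vec:
  fixes A :: "complex Matrix.mat"
  assumes A: "A \<in> carrier_mat n d" and v: "v \<in> carrier_vec d"
  shows "(mat_adjoint A * A) *\<^sub>v v = mat_adjoint A *\<^sub>v (A *\<^sub>v v)"
  by (rule assoc_mult_mat_vec[OF mat_adjoint_carrier[OF A] A v])

lemma gram_form:
  fixes A :: "complex Matrix.mat"
  assumes A: "A \<in> carrier_mat n d" and v: "v \<in> carrier_vec d" and w: "w \<in> carrier_vec n"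
  shows "(\<Sum>k<d. cnj (v $ k) * (mat_adjoint A *\<^sub>v w) $ k) = (\<Sum>j<n. cnj ((A *\<^sub>v v) $ j) * w $ j)"
proof -
  have "(\<Sum>k<d. cnj (v $ k) * (mat_adjoint A *\<^sub>v w) $ k) = (\<Sum>k<d. \<Sum>j<n. cnj (v $ k) * (cnj (A $$ (j, k)) * w $ j))"
    using mult_vec_at[OF mat_adjoint_carrier[OF A] w] mat_adjoint_index[OF A]
    by (intro sum.cong refl) (simp add: sum_distrib_left)
  also have "\<dots> = (\<Sum>j<n. \<Sum>k<d. cnj (v $ k) * (cnj (A $$ (j, k)) * w $ j))" by (rule sum.swap)
  also have "\<dots> = (\<Sum>j<n. cnj ((A *\<^sub>v v) $ j) * w $ j)"
    using mult_vec_at[OF A v] by (intro sum.cong refl) (simp add: sum_distrib_left sum_distrib_right mult_ac)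
  finally show ?thesis .
qed

text \<open>
  \<open>A\<close> and \<open>A\<^sup>* A\<close> have the same kernel.  The determinant is the form of the rank condition that is
  visibly measurable.
\<close>

lemma det_gram_iff_full_column_rank:
  fixes A :: "complex Matrix.mat"
  assumes A: "A \<in> carrier_mat n d"
  shows "full_column_rank A \<longleftrightarrow> det (mat_adjoint A * A) \<noteq> 0"
proof -
  have G: "mat_adjoint A * A \<in> carrier_mat d d" using mat_adjoint_carrier[OF A] A by auto
  have "(mat_adjoint A * A) *\<^sub>v v = 0\<^sub>v d \<longleftrightarrow> A *\<^sub>v v = 0\<^sub>v n" if v: "v \<in> carrier_vec d" for v
  proof
    assume z: "(mat_adjoint A * A) *\<^sub>v v = 0\<^sub>v d"
    have Av: "A *\<^sub>v v \<in> carrier_vec n" using A v by auto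
    have "(\<Sum>j<n. cnj ((A *\<^sub>v v) $ j) * (A *\<^sub>v v) $ j) = 0"
      unfolding gram_form[OF A v Av, symmetric] gram_mult_vec[OF A v, symmetric] z by simp
    then have "complex_of_real (\<Sum>j<n. (cmod ((A *\<^sub>v v) $ j))\<^sup>2) = 0"
      unfolding of_real_sum complex_norm_square by (simp add: mult.commute)
    then have "(\<Sum>j<n. (cmod ((A *\<^sub>v v) $ j))\<^sup>2) = 0" by (simp only: of_real_eq_0_iff)
    then have "\<forall>j<n. (A *\<^sub>v v) $ j = 0" by (simp add: sum_nonneg_eq_0_iff)
    then show "A *\<^sub>v v = 0\<^sub>v n" using Av A by (intro eq_vecI) auto
  next
    assume "A *\<^sub>v v = 0\<^sub>v n"
    then show "(mat_adjoint A * A) *\<^sub>v v = 0\<^sub>v d"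
      unfolding gram_mult_vec[OF A v] using mat_adjoint_carrier[OF A] by (intro eq_vecI) auto
  qed
  then show ?thesis
    unfolding full_column_rank_iff_kernel[OF A] det_0_iff_vec_prod_zero[OF G] by blast
qed

text \<open>
  The inverse computed by Gauss--Jordan elimination is the one of Cramer's rule, which depends measurably on
  the entries.
\<close>

lemma mat_inverse_adj:
  fixes G :: "complex Matrix.mat"
  assumes G: "G \<in> carrier_mat d d" and det: "det G \<noteq> 0"
  shows "the (mat_inverse G) = (1 / det G) \<cdot>\<^sub>m adj_mat G"
proof -
  have "G \<in> Units (ring_mat TYPE(complex) d ())" by (rule det_non_zero_imp_unit[OF G det])
  then obtain B where B: "mat_inverse G = Some B" using mat_inverse(1)[OF G, where b="()"] by (cases "mat_inverse G") auto
  then have BG: "B * G = 1\<^sub>m d" and Bc: "B \<in> carrier_mat d d" using mat_inverse(2)[OF G B] by auto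
  note a = adj_mat[OF G]
  have "adj_mat G = (B * G) * adj_mat G" using a(1) by (simp add: BG)
  also have "\<dots> = B * (G * adj_mat G)" by (rule assoc_mult_mat[OF Bc G a(1)])
  also have "\<dots> = det G \<cdot>\<^sub>m B"
    unfolding a(2) mult_smult_distrib[OF Bc one_carrier_mat] right_mult_one_mat[OF Bc] ..
  finally have "(1 / det G) \<cdot>\<^sub>m adj_mat G = B" using det Bc by (intro eq_matI) auto
  with B show ?thesis by simp
qed

lemma lsq_matrix_carrier: "lsq_matrix \<eta> m n x \<in> carrier_mat n (m - 1)"
  by (simp add: lsq_matrix_def)

abbreviation lsq_gram :: "(nat \<Rightarrow> 'a \<Rightarrow> complex) \<Rightarrow> nat \<Rightarrow> nat \<Rightarrow> (nat \<Rightarrow> 'a) \<Rightarrow> complex Matrix.mat" where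
  "lsq_gram \<eta> m n x \<equiv> mat_adjoint (lsq_matrix \<eta> m n x) * lsq_matrix \<eta> m n x"

lemma lsq_coeffs_carrier:
  assumes "det (lsq_gram \<eta> m n x) \<noteq> 0" 
  shows "lsq_coeffs \<eta> m n x f \<in> carrier_vec (m - 1)"
    and "lsq_coeffs \<eta> m n x f = (1 / det (lsq_gram \<eta> m n x)) \<cdot>\<^sub>v
      (adj_mat (lsq_gram \<eta> m n x) *\<^sub>v (mat_adjoint (lsq_matrix \<eta> m n x) *\<^sub>v Matrix.vec n (\<lambda>j. f (x (Suc j)))))"
    and "(lsq_gram \<eta> m n x) *\<^sub>v lsq_coeffs \<eta> m n x f
      = mat_adjoint (lsq_matrix \<eta> m n x) *\<^sub>v Matrix.vec n (\<lambda>j. f (x (Suc j)))"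
proof -
  let ?L = "lsq_matrix \<eta> m n x" and ?d = "m - 1"
  have L: "?L \<in> carrier_mat n ?d" by (rule lsq_matrix_carrier)
  have La: "mat_adjoint ?L \<in> carrier_mat ?d n" by (rule mat_adjoint_carrier[OF L])
  have G: "(lsq_gram \<eta> m n x) \<in> carrier_mat ?d ?d" using L La by auto
  have f: "Matrix.vec n (\<lambda>j. f (x (Suc j))) \<in> carrier_vec n" by simp
  have w: "mat_adjoint ?L *\<^sub>v Matrix.vec n (\<lambda>j. f (x (Suc j))) \<in> carrier_vec ?d" (is "?w \<in> _")
    using La f by auto
  note a = adj_mat[OF G]
  have c: "lsq_coeffs \<eta> m n x f = ((1 / det (lsq_gram \<eta> m n x)) \<cdot>\<^sub>m adj_mat (lsq_gram \<eta> m n x)) *\<^sub>v ?w"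
    unfolding lsq_coeffs_def Let_def mat_inverse_adj[OF G assms]
    by (rule assoc_mult_mat_vec[OF smult_carrier_mat[OF a(1)] La f])
  show c': "lsq_coeffs \<eta> m n x f = (1 / det (lsq_gram \<eta> m n x)) \<cdot>\<^sub>v (adj_mat (lsq_gram \<eta> m n x) *\<^sub>v ?w)"
    unfolding c by (rule smult_mult_vec[OF a(1) w])
  then show "lsq_coeffs \<eta> m n x f \<in> carrier_vec ?d" using a(1) w by auto
  have "(lsq_gram \<eta> m n x) *\<^sub>v (adj_mat (lsq_gram \<eta> m n x) *\<^sub>v ?w) = ((lsq_gram \<eta> m n x) * adj_mat (lsq_gram \<eta> m n x)) *\<^sub>v ?w"
    by (rule assoc_mult_mat_vec[OF G a(1) w, symmetric])
  also have "\<dots> = det (lsq_gram \<eta> m n x) \<cdot>\<^sub>v ?w" unfolding a(2) smult_mult_vec[OF one_carrier_mat w]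
    using w by simp
  finally have "(lsq_gram \<eta> m n x) *\<^sub>v (adj_mat (lsq_gram \<eta> m n x) *\<^sub>v ?w) = det (lsq_gram \<eta> m n x) \<cdot>\<^sub>v ?w" .
  moreover have "(lsq_gram \<eta> m n x) *\<^sub>v ((1 / det (lsq_gram \<eta> m n x)) \<cdot>\<^sub>v (adj_mat (lsq_gram \<eta> m n x) *\<^sub>v ?w)) = (1 / det (lsq_gram \<eta> m n x)) \<cdot>\<^sub>v ((lsq_gram \<eta> m n x) *\<^sub>v (adj_mat (lsq_gram \<eta> m n x) *\<^sub>v ?w))"
    by (rule mult_mat_vec[OF G]) (use a(1) w in auto)
  ultimately show "(lsq_gram \<eta> m n x) *\<^sub>v lsq_coeffs \<eta> m n x f = ?w"
    unfolding c' using assms w by (simp add: smult_smult_assoc)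
qed

lemma lsq_coeffs_unique:
  assumes det: "det (lsq_gram \<eta> m n x) \<noteq> 0" 
    and c: "c \<in> carrier_vec (m - 1)"
    and eq: "(lsq_gram \<eta> m n x) *\<^sub>v c = mat_adjoint (lsq_matrix \<eta> m n x) *\<^sub>v Matrix.vec n (\<lambda>j. f (x (Suc j)))"
  shows "c = lsq_coeffs \<eta> m n x f"
proof -
  let ?L = "lsq_matrix \<eta> m n x" and ?d = "m - 1" and ?c = "lsq_coeffs \<eta> m n x f"
  have G: "(lsq_gram \<eta> m n x) \<in> carrier_mat ?d ?d" 
    by (rule mult_carrier_mat[OF mat_adjoint_carrier[OF lsq_matrix_carrier] lsq_matrix_carrier])
  have c': "?c \<in> carrier_vec ?d" by (rule lsq_coeffs_carrier[OF det])
  have "(lsq_gram \<eta> m n x) *\<^sub>v (c - ?c) = (lsq_gram \<eta> m n x) *\<^sub>v c - (lsq_gram \<eta> m n x) *\<^sub>v ?c" by (rule mult_minus_distrib_mat_vec[OF G c c'])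
  also have "\<dots> = 0\<^sub>v ?d"
    unfolding eq lsq_coeffs_carrier(3)[OF det] using mat_adjoint_carrier[OF lsq_matrix_carrier[of \<eta> m n x]] by auto
  finally have "c - ?c = 0\<^sub>v ?d" using det det_0_iff_vec_prod_zero[OF G] minus_carrier_vec[OF c c'] by blast
  then have "(c - ?c) $ i = 0" if "i < ?d" for i using that by simp
  then show ?thesis using c c' by (intro eq_vecI) auto
qed

text \<open>
  The fitted values \<open>L c\<close> are the orthogonal projection of the data, so \<open>s \<parallel>c\<parallel>\<^sup>2 \<le> \<parallel>L c\<parallel>\<^sup>2 \<le> \<parallel>f(X)\<parallel>\<^sup>2\<close>.
\<close>

lemma lsq_stability:
  assumes s: "0 < s" and lower: "\<And>u. s * (\<Sum>i<m-1. (cmod (u i))\<^sup>2) \<le> (\<Sum>j<n. (cmod (\<Sum>i<m-1. u i * \<eta> (Suc i) (x (Suc j))))\<^sup>2)"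
  shows "det (lsq_gram \<eta> m n x) \<noteq> 0" (is ?A)
    and "s * (\<Sum>i<m-1. (cmod (lsq_coeffs \<eta> m n x f $ i))\<^sup>2) \<le> (\<Sum>j<n. (cmod (f (x (Suc j))))\<^sup>2)" (is ?B)
proof -
  let ?L = "lsq_matrix \<eta> m n x" and ?d = "m - 1"
  have L: "?L \<in> carrier_mat n ?d" by (rule lsq_matrix_carrier)
  have Lv: "(?L *\<^sub>v v) $ j = (\<Sum>i<?d. v $ i * \<eta> (Suc i) (x (Suc j)))" if "v \<in> carrier_vec ?d" "j < n" for v j
    unfolding mult_vec_at[OF L that] using that(2) by (intro sum.cong refl) (simp add: lsq_matrix_def mult.commute)
  show det: ?A
    unfolding det_gram_iff_full_column_rank[OF L, symmetric] full_column_rank_iff_kernel[OF L]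
  proof (intro ballI impI)
    fix v :: "complex Matrix.vec" assume v: "v \<in> carrier_vec ?d" and z: "?L *\<^sub>v v = 0\<^sub>v n"
    have "(\<Sum>i<?d. v $ i * \<eta> (Suc i) (x (Suc j))) = 0" if "j < n" for j
      using Lv[OF v that] that unfolding z by simp
    then have "s * (\<Sum>i<?d. (cmod (v $ i))\<^sup>2) \<le> 0" using lower[of "\<lambda>i. v $ i"] by simp
    then have "(\<Sum>i<?d. (cmod (v $ i))\<^sup>2) \<le> 0" using s by (simp add: mult_le_0_iff)
    moreover have "0 \<le> (\<Sum>i<?d. (cmod (v $ i))\<^sup>2)" by (intro sum_nonneg) simp
    ultimately have "(\<Sum>i<?d. (cmod (v $ i))\<^sup>2) = 0" by linarith
    then have "\<forall>i<?d. v $ i = 0" by (simp add: sum_nonneg_eq_0_iff)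
    then show "v = 0\<^sub>v ?d" using v by (intro eq_vecI) auto
  qed
  let ?c = "lsq_coeffs \<eta> m n x f" and ?f = "Matrix.vec n (\<lambda>j. f (x (Suc j)))"
  have c: "?c \<in> carrier_vec ?d" by (rule lsq_coeffs_carrier[OF det])
  have Lc: "?L *\<^sub>v ?c \<in> carrier_vec n" using L c by auto
  define A where "A = (\<Sum>j<n. (cmod ((?L *\<^sub>v ?c) $ j))\<^sup>2)"
  define F where "F = (\<Sum>j<n. (cmod (f (x (Suc j))))\<^sup>2)"
  have "complex_of_real A = (\<Sum>j<n. cnj ((?L *\<^sub>v ?c) $ j) * (?L *\<^sub>v ?c) $ j)"
    unfolding A_def of_real_sum complex_norm_square by (simp add: mult.commute)
  also have "\<dots> = (\<Sum>j<n. cnj ((?L *\<^sub>v ?c) $ j) * ?f $ j)"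
    unfolding gram_form[OF L c Lc, symmetric] gram_form[OF L c vec_carrier, symmetric]
      gram_mult_vec[OF L c, symmetric] lsq_coeffs_carrier(3)[OF det] ..
  finally have "Re (complex_of_real A) = Re (\<Sum>j<n. cnj ((?L *\<^sub>v ?c) $ j) * ?f $ j)" by (rule arg_cong)
  then have "A \<le> cmod (\<Sum>j<n. cnj ((?L *\<^sub>v ?c) $ j) * ?f $ j)"
    unfolding Re_complex_of_real using complex_Re_le_cmod by (rule ord_eq_le_trans)
  also have "\<dots> \<le> (\<Sum>j<n. cmod ((?L *\<^sub>v ?c) $ j) * cmod (f (x (Suc j))))"
    by (rule sum_norm_le) (simp add: norm_mult)
  also have "\<dots> \<le> (\<Sum>j<n. ((cmod ((?L *\<^sub>v ?c) $ j))\<^sup>2 + (cmod (f (x (Suc j))))\<^sup>2) / 2)"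
  proof (rule sum_mono)
    fix j
    show "cmod ((?L *\<^sub>v ?c) $ j) * cmod (f (x (Suc j))) \<le> ((cmod ((?L *\<^sub>v ?c) $ j))\<^sup>2 + (cmod (f (x (Suc j))))\<^sup>2) / 2"
      using zero_le_power2[of "cmod ((?L *\<^sub>v ?c) $ j) - cmod (f (x (Suc j)))"] by (simp add: power2_diff)
  qed
  also have "\<dots> = (A + F) / 2" by (simp add: A_def F_def sum_divide_distrib[symmetric] sum.distrib)
  finally have "A \<le> F" by simp
  moreover have "s * (\<Sum>i<?d. (cmod (?c $ i))\<^sup>2) \<le> A"
    using lower[of "\<lambda>i. ?c $ i"] unfolding A_def by (simp add: Lv[OF c])
  ultimately show ?B unfolding F_def by simp
qed

lemma lsq_operator_conv: "lsq_operator \<eta> m n x f = (\<Sum>i<m-1. fun_scale (lsq_coeffs \<eta> m n x f $ i) (\<eta> (Suc i)))"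
proof
  fix z
  have "(\<Sum>k=1..m-1. lsq_coeffs \<eta> m n x f $ (k - 1) * \<eta> k z) = (\<Sum>k\<in>{1..<Suc (m-1)}. lsq_coeffs \<eta> m n x f $ (k - 1) * \<eta> k z)"
    by (simp only: atLeastLessThanSuc_atLeastAtMost)
  also have "\<dots> = (\<Sum>i<m-1. lsq_coeffs \<eta> m n x f $ i * \<eta> (Suc i) z)"
    by (subst sum_Suc_shift[symmetric]) simp
  finally show "lsq_operator \<eta> m n x f z = (\<Sum>i<m-1. fun_scale (lsq_coeffs \<eta> m n x f $ i) (\<eta> (Suc i))) z"
    unfolding lsq_operator_def sum_fun_at .
qed

text \<open>
  Least squares is linear and reproduces the span of the basis functions; both follow from the uniqueness of the
  solution of the normal equations.
\<close>

lemma lsq_residual_invariant: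
  assumes det: "det (lsq_gram \<eta> m n x) \<noteq> 0"
    and fg: "f - g = (\<Sum>i<m-1. fun_scale (b i) (\<eta> (Suc i)))"
  shows "f - lsq_operator \<eta> m n x f = g - lsq_operator \<eta> m n x g"
proof -
  let ?L = "lsq_matrix \<eta> m n x" and ?d = "m - 1"
  have L: "?L \<in> carrier_mat n ?d" by (rule lsq_matrix_carrier)
  have La: "mat_adjoint ?L \<in> carrier_mat ?d n" by (rule mat_adjoint_carrier[OF L])
  have G: "(lsq_gram \<eta> m n x) \<in> carrier_mat ?d ?d" using L La by auto
  let ?b = "Matrix.vec ?d b" and ?c = "lsq_coeffs \<eta> m n x g"
  have b: "?b \<in> carrier_vec ?d" by simp
  have c: "?c \<in> carrier_vec ?d" by (rule lsq_coeffs_carrier[OF det])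
  have Lb: "?L *\<^sub>v ?b \<in> carrier_vec n" using L b by auto
  have pt: "f z - g z = (\<Sum>i<?d. b i * \<eta> (Suc i) z)" for z
    using fun_cong[OF fg, of z] by (simp add: sum_fun_at)
  have split: "Matrix.vec n (\<lambda>j. f (x (Suc j))) = ?L *\<^sub>v ?b + Matrix.vec n (\<lambda>j. g (x (Suc j)))"
  proof (rule eq_vecI)
    fix j assume "j < dim_vec (?L *\<^sub>v ?b + Matrix.vec n (\<lambda>j. g (x (Suc j))))"
    then have j: "j < n" by simp
    have "(?L *\<^sub>v ?b) $ j = (\<Sum>i<?d. b i * \<eta> (Suc i) (x (Suc j)))"
      unfolding mult_vec_at[OF L b j] using j by (intro sum.cong refl) (simp add: lsq_matrix_def)
    then show "Matrix.vec n (\<lambda>j. f (x (Suc j))) $ j = (?L *\<^sub>v ?b + Matrix.vec n (\<lambda>j. g (x (Suc j)))) $ j"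
      using j Lb pt[of "x (Suc j)"] by (simp add: algebra_simps)
  qed (use L in simp)
  have "(lsq_gram \<eta> m n x) *\<^sub>v (?b + ?c) = (lsq_gram \<eta> m n x) *\<^sub>v ?b + (lsq_gram \<eta> m n x) *\<^sub>v ?c" by (rule mult_add_distrib_mat_vec[OF G b c])
  also have "\<dots> = mat_adjoint ?L *\<^sub>v (?L *\<^sub>v ?b) + mat_adjoint ?L *\<^sub>v Matrix.vec n (\<lambda>j. g (x (Suc j)))"
    unfolding gram_mult_vec[OF L b] lsq_coeffs_carrier(3)[OF det] ..
  also have "\<dots> = mat_adjoint ?L *\<^sub>v Matrix.vec n (\<lambda>j. f (x (Suc j)))"
    unfolding split by (rule mult_add_distrib_mat_vec[OF La Lb, symmetric]) simp
  finally have "?b + ?c = lsq_coeffs \<eta> m n x f"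
    using b c by (intro lsq_coeffs_unique[OF det]) auto
  then have coef: "lsq_coeffs \<eta> m n x f $ i = b i + ?c $ i" if "i < ?d" for i
    using that c by (metis b carrier_vecD index_add_vec(1) index_vec)
  show ?thesis
  proof
    fix z
    have "(\<Sum>i<?d. lsq_coeffs \<eta> m n x f $ i * \<eta> (Suc i) z) = (\<Sum>i<?d. b i * \<eta> (Suc i) z) + (\<Sum>i<?d. ?c $ i * \<eta> (Suc i) z)"
      unfolding sum.distrib[symmetric] by (intro sum.cong refl) (simp add: coef algebra_simps)
    then show "(f - lsq_operator \<eta> m n x f) z = (g - lsq_operator \<eta> m n x g) z"
      unfolding lsq_operator_conv minus_apply sum_fun_at using pt[of z] by (simp add: algebra_simps)
  qed
qed

section \<open>The reconstruction error and the measurability of the event\<close>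

lemma measurable_det:
  fixes A :: "'w \<Rightarrow> complex Matrix.mat"
  assumes A: "\<And>\<omega>. A \<omega> \<in> carrier_mat d d"
    and entries: "\<And>i j. i < d \<Longrightarrow> j < d \<Longrightarrow> (\<lambda>\<omega>. A \<omega> $$ (i, j)) \<in> borel_measurable M"
  shows "(\<lambda>\<omega>. det (A \<omega>)) \<in> borel_measurable M"
  unfolding det_def'[OF A]
proof (intro borel_measurable_sum borel_measurable_times borel_measurable_prod borel_measurable_const)
  fix p i assume "p \<in> {p. p permutes {0..<d}}" "i \<in> {0..<d}"
  then show "(\<lambda>\<omega>. A \<omega> $$ (i, p i)) \<in> borel_measurable M"
    using permutes_in_image[of p "{0..<d}" i] by (intro entries) auto
qed

lemma measurable_adj_mat:
  fixes A :: "'w \<Rightarrow> complex Matrix.mat"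
  assumes A: "\<And>\<omega>. A \<omega> \<in> carrier_mat d d"
    and entries: "\<And>i j. i < d \<Longrightarrow> j < d \<Longrightarrow> (\<lambda>\<omega>. A \<omega> $$ (i, j)) \<in> borel_measurable M"
    and ij: "i < d" "j < d"
  shows "(\<lambda>\<omega>. adj_mat (A \<omega>) $$ (i, j)) \<in> borel_measurable M"
proof -
  have dims: "dim_row (A \<omega>) = d" "dim_col (A \<omega>) = d" for \<omega> using A[of \<omega>] by auto
  have "(\<lambda>\<omega>. det (mat_delete (A \<omega>) j i)) \<in> borel_measurable M"
  proof (rule measurable_det[OF mat_delete_carrier[OF A]])
    fix k l assume kl: "k < d - 1" "l < d - 1"
    have "(\<lambda>\<omega>. mat_delete (A \<omega>) j i $$ (k, l)) = (\<lambda>\<omega>. A \<omega> $$ (if k < j then k else Suc k, if l < i then l else Suc l))"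
      using kl by (simp add: mat_delete_def dims)
    also have "\<dots> \<in> borel_measurable M" by (rule entries) (use kl in auto)
    finally show "(\<lambda>\<omega>. mat_delete (A \<omega>) j i $$ (k, l)) \<in> borel_measurable M" .
  qed
  then have "(\<lambda>\<omega>. (- 1) ^ (j + i) * det (mat_delete (A \<omega>) j i)) \<in> borel_measurable M"
    by (intro borel_measurable_times borel_measurable_const)
  then show ?thesis using ij by (simp add: adj_mat_def cofactor_def dims)
qed

lemma lsq_matrix_adjoint_index:
  assumes "i < m - 1" "j < n"
  shows "mat_adjoint (lsq_matrix \<eta> m n x) $$ (i, j) = cnj (\<eta> (Suc i) (x (Suc j)))"
  unfolding mat_adjoint_index[OF lsq_matrix_carrier assms] using assms by (simp add: lsq_matrix_def)

context embedded_rkhs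
begin

abbreviation \<eta> where "\<eta> \<equiv> L2_normalized lam e"

lemma eta_conv: "\<eta> k = fun_scale (complex_of_real (lam k powr (-1/2))) (e k)"
  by (simp add: L2_normalized_def)

lemma eta_in_H: "1 \<le> k \<Longrightarrow> \<eta> k \<in> H"
  unfolding eta_conv by (intro H_scale e_in_H)

lemma normalization_sq: assumes "1 \<le> k" shows "(lam k powr (-1/2))\<^sup>2 * lam k = 1"
proof -
  have p: "0 < lam k" by (rule lam_pos[OF assms])
  have "(lam k powr (-1/2))\<^sup>2 = lam k powr (-1)"
    unfolding power2_eq_square powr_add[symmetric] by simp
  then show ?thesis using p by (simp add: powr_minus)
qed

lemma lip_e_e: assumes "1 \<le> j" "1 \<le> k" shows "lip (e j) (e k) = (if j = k then complex_of_real (lam k) else 0)"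
  using lip_e[OF assms(2) e_in_H[OF assms(1)]] e_orthonormal[OF assms] by simp

lemma eta_orthonormal: assumes "1 \<le> j" "1 \<le> k" shows "lip (\<eta> j) (\<eta> k) = (if j = k then 1 else 0)"
proof -
  have "lip (\<eta> j) (\<eta> k) = complex_of_real (lam j powr (-1/2)) * (complex_of_real (lam k powr (-1/2)) * lip (e j) (e k))"
    unfolding eta_conv lip_scale lip_scale_right by simp
  moreover have "complex_of_real (lam k powr (-1/2)) * (complex_of_real (lam k powr (-1/2)) * complex_of_real (lam k)) = 1"
    using normalization_sq[OF assms(2)] by (metis mult.assoc of_real_1 of_real_mult power2_eq_square)
  ultimately show ?thesis using lip_e_e[OF assms] by auto
qed

lemma L2_norm_sq_eq: "h \<in> H \<Longrightarrow> L2_norm_sq \<rho> h = ennreal (L2_sq h)"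
  unfolding L2_norm_sq_def L2_sq_def by (intro nn_integral_eq_integral sq_integrable) auto

definition comb :: "nat \<Rightarrow> (nat \<Rightarrow> complex) \<Rightarrow> 'a \<Rightarrow> complex" where
  "comb d c = (\<Sum>i<d. fun_scale (c i) (\<eta> (Suc i)))"

lemma comb_in_H: "comb d c \<in> H"
  unfolding comb_def by (intro H_sum H_scale eta_in_H) simp

lemma lip_comb: assumes "f \<in> H" shows "lip (comb d c) f = (\<Sum>i<d. c i * lip (\<eta> (Suc i)) f)"
proof -
  have "lip (comb d c) f = (\<Sum>i<d. lip (fun_scale (c i) (\<eta> (Suc i))) f)"
    unfolding comb_def by (intro lip_sum H_scale eta_in_H assms) simp
  then show ?thesis by (simp only: lip_scale)
qed

lemma L2_sq_comb: "L2_sq (comb d c) = (\<Sum>i<d. (cmod (c i))\<^sup>2)"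
proof -
  have "lip (\<eta> (Suc i)) (comb d c) = cnj (c i)" if "i < d" for i
  proof -
    have "lip (comb d c) (\<eta> (Suc i)) = (\<Sum>l<d. if l = i then c l else 0)"
      unfolding lip_comb[OF eta_in_H[of "Suc i", simplified]] by (intro sum.cong refl) (simp add: eta_orthonormal)
    also have "\<dots> = c i" using that by simp
    finally show ?thesis using lip_commute[of "\<eta> (Suc i)" "comb d c"] by simp
  qed
  then have "lip (comb d c) (comb d c) = (\<Sum>i<d. complex_of_real ((cmod (c i))\<^sup>2))"
    unfolding lip_comb[OF comb_in_H] complex_norm_square by simp
  then have "complex_of_real (L2_sq (comb d c)) = complex_of_real (\<Sum>i<d. (cmod (c i))\<^sup>2)"
    unfolding lip_self[OF comb_in_H] of_real_sum .
  then show ?thesis by (simp only: of_real_eq_iff)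
qed

lemma L2_sq_diff_comb:
  assumes "f \<in> H"
  shows "L2_sq (f - comb d c) = L2_sq f - 2 * Re (\<Sum>i<d. c i * lip (\<eta> (Suc i)) f) + (\<Sum>i<d. (cmod (c i))\<^sup>2)"
  unfolding diff_as_add L2_sq_add_scale[OF assms comb_in_H] lip_comb[OF assms] L2_sq_comb by simp

lemma lsq_operator_comb: "lsq_operator \<eta> m n x f = comb (m - 1) (\<lambda>i. lsq_coeffs \<eta> m n x f $ i)"
  unfolding lsq_operator_conv comb_def ..

text \<open>
  At a node where the eigenfunction expansions converge to the function, the residual is the tail of the expansion.
\<close>

lemma residual_at_node:
  assumes f: "f \<in> H" and m: "1 \<le> m" and lim: "(\<lambda>M. proj (Suc M) f z) \<longlonglongrightarrow> f z"
  shows "(\<lambda>r. \<Sum>i<r. ip f (e (m + i)) * e (m + i) z) \<longlonglongrightarrow> (f - proj m f) z"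
proof -
  have "proj (m + r) f z = proj m f z + (\<Sum>i<r. ip f (e (m + i)) * e (m + i) z)" for r
    by (induction r) (use m in \<open>simp_all add: proj_at\<close>)
  then have e: "(\<Sum>i<r. ip f (e (m + i)) * e (m + i) z) = proj (m + r) f z - proj m f z" for r by simp
  have "(\<lambda>M. proj M f z) \<longlonglongrightarrow> f z" using lim by (rule LIMSEQ_imp_Suc)
  then have "(\<lambda>r. proj (m + r) f z) \<longlonglongrightarrow> f z"
    using LIMSEQ_ignore_initial_segment[of "\<lambda>M. proj M f z" "f z" m] by (simp add: add.commute)
  then show ?thesis unfolding e minus_apply by (intro tendsto_intros)
qed

lemma lsq_worst_error_bound:
  assumes m: "1 \<le> m" and n: "1 \<le> n" and s: "0 \<le> s"
    and nodes: "\<And>j f. j < n \<Longrightarrow> f \<in> H \<Longrightarrow> (\<lambda>M. proj (Suc M) f (x (Suc j))) \<longlonglongrightarrow> f (x (Suc j))"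
    and lower: "\<And>u. real n / 2 * (\<Sum>i<m-1. (cmod (u i))\<^sup>2)
      \<le> (\<Sum>j<n. (cmod (\<Sum>i<m-1. u i * \<eta> (Suc i) (x (Suc j))))\<^sup>2)"
    and upper: "\<And>r u. (\<Sum>j<n. (cmod (\<Sum>i<r. u i * e (m + i) (x (Suc j))))\<^sup>2) \<le> s * (\<Sum>i<r. (cmod (u i))\<^sup>2)"
  shows "det (lsq_gram \<eta> m n x) \<noteq> 0"
    and "lsq_worst_error_sq H ip \<rho> \<eta> m n x \<le> ennreal (lam m + 2 / real n * s)"
proof -
  have n2: "0 < real n / 2" using n by simp
  show det: "det (lsq_gram \<eta> m n x) \<noteq> 0" by (rule lsq_stability(1)[where s="real n / 2" and \<eta>=\<eta> and m=m and n=n and x=x, OF n2 lower])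
  show "lsq_worst_error_sq H ip \<rho> \<eta> m n x \<le> ennreal (lam m + 2 / real n * s)"
    unfolding lsq_worst_error_sq_def
  proof (rule SUP_least)
    fix f assume "f \<in> {f \<in> H. nrm f \<le> 1}"
    then have f: "f \<in> H" and f1: "nrm f \<le> 1" by auto
    have f1': "(nrm f)\<^sup>2 \<le> 1" using nrm_nonneg[OF f] f1 by (intro power_le_one)
    define g where "g = f - proj m f"
    have g: "g \<in> H" "g \<in> orth m" unfolding g_def using residual_orth[OF f] by (auto simp: orth_def)
    have g1: "(nrm g)\<^sup>2 \<le> 1"
      using power_mono[OF residual_nrm_le[OF f, of m] nrm_nonneg[OF g(1)[unfolded g_def]], of 2] f1' by (simp add: g_def)
    let ?c = "lsq_coeffs \<eta> m n x g"
    have fg: "f - g = (\<Sum>i<m-1. fun_scale (ip f (e (Suc i)) / complex_of_real (lam (Suc i) powr (-1/2))) (\<eta> (Suc i)))"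
    proof -
      have "f - g = proj m f" by (simp add: g_def fun_eq_iff)
      also have "\<dots> = (\<Sum>k\<in>{1..<Suc (m-1)}. fun_scale (ip f (e k)) (e k))" using m by (simp add: proj_def)
      also have "\<dots> = (\<Sum>i<m-1. fun_scale (ip f (e (Suc i))) (e (Suc i)))" by (rule sum_Suc_shift[symmetric])
      also have "\<dots> = (\<Sum>i<m-1. fun_scale (ip f (e (Suc i)) / complex_of_real (lam (Suc i) powr (-1/2))) (\<eta> (Suc i)))"
      proof (intro sum.cong refl)
        fix i
        have "complex_of_real (lam (Suc i) powr (-1/2)) \<noteq> 0" using lam_pos[of "Suc i"] by simp
        then show "fun_scale (ip f (e (Suc i))) (e (Suc i))
          = fun_scale (ip f (e (Suc i)) / complex_of_real (lam (Suc i) powr (-1/2))) (\<eta> (Suc i))"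
          unfolding eta_conv fun_eq_iff by simp
      qed
      finally show ?thesis .
    qed
    have err: "f - lsq_operator \<eta> m n x f = g - comb (m-1) (\<lambda>i. ?c $ i)"
    proof -
      have "lsq_operator \<eta> m n x g = comb (m-1) (\<lambda>i. ?c $ i)" by (rule lsq_operator_comb)
      then show ?thesis using lsq_residual_invariant[OF det fg] by (simp only:)
    qed
    have lz: "lip (\<eta> (Suc i)) g = 0" if "i < m - 1" for i
    proof -
      have "lip g (e (Suc i)) = 0" using lip_e[of "Suc i" g] g that by (simp add: orth_def)
      then have "lip (e (Suc i)) g = 0" using lip_commute[of "e (Suc i)" g] by simp
      then show ?thesis unfolding eta_conv lip_scale by simp
    qed
    have samples: "(\<Sum>j<n. (cmod (g (x (Suc j))))\<^sup>2) \<le> s"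
    proof (rule LIMSEQ_le_const2)
      show "(\<lambda>r. \<Sum>j<n. (cmod (\<Sum>i<r. ip f (e (m + i)) * e (m + i) (x (Suc j))))\<^sup>2)
          \<longlonglongrightarrow> (\<Sum>j<n. (cmod (g (x (Suc j))))\<^sup>2)"
        unfolding g_def by (intro tendsto_sum tendsto_power tendsto_norm residual_at_node f m nodes) auto
      have "(\<Sum>j<n. (cmod (\<Sum>i<r. ip f (e (m + i)) * e (m + i) (x (Suc j))))\<^sup>2) \<le> s" for r
      proof -
        have "(\<Sum>i<r. (cmod (ip f (e (m + i))))\<^sup>2) = (\<Sum>k\<in>(\<lambda>i. m + i) ` {..<r}. (cmod (ip f (e k)))\<^sup>2)"
          by (subst sum.reindex) auto
        also have "\<dots> \<le> (\<Sum>k\<in>{1..<m + r}. (cmod (ip f (e k)))\<^sup>2)"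
          using m by (intro sum_mono2) auto
        also have "\<dots> \<le> 1" using bessel[OF f, of "m + r"] f1' by simp
        finally have "s * (\<Sum>i<r. (cmod (ip f (e (m + i))))\<^sup>2) \<le> s * 1" using s by (rule mult_left_mono)
        with upper[of "\<lambda>i. ip f (e (m + i))" r] show ?thesis by simp
      qed
      then show "\<exists>N. \<forall>r\<ge>N. (\<Sum>j<n. (cmod (\<Sum>i<r. ip f (e (m + i)) * e (m + i) (x (Suc j))))\<^sup>2) \<le> s" by blast
    qed
    have "L2_sq (g - comb (m-1) (\<lambda>i. ?c $ i)) = L2_sq g + (\<Sum>i<m-1. (cmod (?c $ i))\<^sup>2)"
      unfolding L2_sq_diff_comb[OF g(1)] using lz by simp
    moreover have "L2_sq g \<le> lam m"
    proof -
      have "lam m * (nrm g)\<^sup>2 \<le> lam m * 1" using g1 lam_pos[OF m] by (intro mult_left_mono) simp_all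
      with L2_norm_le_on_orth[OF m g(2)] show ?thesis by simp
    qed
    moreover have "(\<Sum>i<m-1. (cmod (?c $ i))\<^sup>2) \<le> 2 / real n * s"
    proof -
      have "real n / 2 * (\<Sum>i<m-1. (cmod (?c $ i))\<^sup>2) \<le> s"
        using lsq_stability(2)[where s="real n / 2" and \<eta>=\<eta> and m=m and n=n and x=x and f=g, OF n2 lower] samples by (rule order_trans)
      then show ?thesis using n by (simp add: field_simps)
    qed
    ultimately show "L2_norm_sq \<rho> (f - lsq_operator \<eta> m n x f) \<le> ennreal (lam m + 2 / real n * s)"
      unfolding err L2_norm_sq_eq[OF H_diff[OF g(1) comb_in_H]] by (intro ennreal_leI) linarith
  qed
qed

lemma lsq_coeffs_at:
  assumes det: "det (lsq_gram \<eta>' m n x) \<noteq> 0" and i: "i < m - 1"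
  shows "lsq_coeffs \<eta>' m n x f $ i = 1 / det (lsq_gram \<eta>' m n x)
    * (\<Sum>l<m-1. adj_mat (lsq_gram \<eta>' m n x) $$ (i, l) * (\<Sum>j<n. cnj (\<eta>' (Suc l) (x (Suc j))) * f (x (Suc j))))"
proof -
  let ?L = "lsq_matrix \<eta>' m n x" and ?d = "m - 1"
  have L: "?L \<in> carrier_mat n ?d" by (rule lsq_matrix_carrier)
  have La: "mat_adjoint ?L \<in> carrier_mat ?d n" by (rule mat_adjoint_carrier[OF L])
  have G: "lsq_gram \<eta>' m n x \<in> carrier_mat ?d ?d" by (rule mult_carrier_mat[OF La L])
  have v: "Matrix.vec n (\<lambda>j. f (x (Suc j))) \<in> carrier_vec n" by simp
  have w: "mat_adjoint ?L *\<^sub>v Matrix.vec n (\<lambda>j. f (x (Suc j))) \<in> carrier_vec ?d" using La v by auto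
  have wl: "(mat_adjoint ?L *\<^sub>v Matrix.vec n (\<lambda>j. f (x (Suc j)))) $ l
      = (\<Sum>j<n. cnj (\<eta>' (Suc l) (x (Suc j))) * f (x (Suc j)))" if "l < ?d" for l
    unfolding mult_vec_at[OF La v that] using that
    by (intro sum.cong refl) (simp add: lsq_matrix_adjoint_index)
  have "(adj_mat (lsq_gram \<eta>' m n x) *\<^sub>v (mat_adjoint ?L *\<^sub>v Matrix.vec n (\<lambda>j. f (x (Suc j))))) $ i
      = (\<Sum>l<?d. adj_mat (lsq_gram \<eta>' m n x) $$ (i, l) * (\<Sum>j<n. cnj (\<eta>' (Suc l) (x (Suc j))) * f (x (Suc j))))"
    unfolding mult_vec_at[OF adj_mat(1)[OF G] w i] by (intro sum.cong refl) (simp add: wl)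
  moreover have "dim_vec (adj_mat (lsq_gram \<eta>' m n x) *\<^sub>v (mat_adjoint ?L *\<^sub>v Matrix.vec n (\<lambda>j. f (x (Suc j))))) = ?d"
    using adj_mat(1)[OF G] by simp
  ultimately show ?thesis unfolding lsq_coeffs_carrier(2)[OF det] using i by simp
qed

text \<open>
  For fixed nodes the coefficients are continuous in the data, so convergence in \<open>H\<close> gives pointwise
  convergence of the residuals, and Fatou's lemma carries the bound from a dense subset of the ball to the
  whole ball.
\<close>

lemma worst_error_le_iff_dense:
  assumes g: "\<And>j::nat. g j \<in> H" "\<And>j. nrm (g j) \<le> 1"
    and dense: "\<And>f \<epsilon>. f \<in> H \<Longrightarrow> nrm f \<le> 1 \<Longrightarrow> 0 < \<epsilon> \<Longrightarrow> \<exists>j. nrm (f - g j) < \<epsilon>"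
    and det: "det (lsq_gram \<eta> m n x) \<noteq> 0"
  shows "lsq_worst_error_sq H ip \<rho> \<eta> m n x \<le> b
    \<longleftrightarrow> (\<forall>j. L2_norm_sq \<rho> (g j - lsq_operator \<eta> m n x (g j)) \<le> b)"
proof
  assume le: "lsq_worst_error_sq H ip \<rho> \<eta> m n x \<le> b"
  show "\<forall>j. L2_norm_sq \<rho> (g j - lsq_operator \<eta> m n x (g j)) \<le> b"
  proof
    fix j
    have "L2_norm_sq \<rho> (g j - lsq_operator \<eta> m n x (g j)) \<le> lsq_worst_error_sq H ip \<rho> \<eta> m n x"
      unfolding lsq_worst_error_sq_def by (rule SUP_upper) (simp add: g)
    with le show "L2_norm_sq \<rho> (g j - lsq_operator \<eta> m n x (g j)) \<le> b" by simp
  qed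
next
  assume le: "\<forall>j. L2_norm_sq \<rho> (g j - lsq_operator \<eta> m n x (g j)) \<le> b"
  show "lsq_worst_error_sq H ip \<rho> \<eta> m n x \<le> b"
    unfolding lsq_worst_error_sq_def
  proof (rule SUP_least)
    fix f assume "f \<in> {f \<in> H. nrm f \<le> 1}"
    then have f: "f \<in> H" "nrm f \<le> 1" by auto
    have "\<exists>j. nrm (f - g j) < inverse (real (Suc i))" for i by (rule dense[OF f]) simp
    then obtain \<sigma> where \<sigma>: "\<And>i. nrm (f - g (\<sigma> i)) < inverse (real (Suc i))" by metis
    have pt: "(\<lambda>i. g (\<sigma> i) z) \<longlonglongrightarrow> f z" for z
    proof (rule LIM_zero_cancel, rule Lim_null_comparison)
      show "\<forall>\<^sub>F i in sequentially. norm (g (\<sigma> i) z - f z) \<le> C * inverse (real (Suc i))"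
      proof (intro always_eventually allI)
        fix i
        have "cmod ((f - g (\<sigma> i)) z) \<le> C * nrm (f - g (\<sigma> i))" by (intro eval_bound H_diff f g)
        also have "\<dots> \<le> C * inverse (real (Suc i))" using \<sigma>[of i] by (intro mult_left_mono C_nonneg) simp
        finally show "norm (g (\<sigma> i) z - f z) \<le> C * inverse (real (Suc i))" by (simp add: norm_minus_commute)
      qed
      show "(\<lambda>i. C * inverse (real (Suc i))) \<longlonglongrightarrow> 0"
        by (rule tendsto_mult_right_zero[OF LIMSEQ_inverse_real_of_nat])
    qed
    have ct: "(\<lambda>i. lsq_coeffs \<eta> m n x (g (\<sigma> i)) $ l) \<longlonglongrightarrow> lsq_coeffs \<eta> m n x f $ l" if "l < m - 1" for l
      unfolding lsq_coeffs_at[OF det that] by (intro tendsto_intros pt)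
    define h where "h i = g (\<sigma> i) - lsq_operator \<eta> m n x (g (\<sigma> i))" for i
    define h0 where "h0 = f - lsq_operator \<eta> m n x f"
    have hH: "h i \<in> H" "h0 \<in> H" for i
      unfolding h_def h0_def lsq_operator_comb by (intro H_diff g f comb_in_H)+
    have ht: "(\<lambda>i. h i z) \<longlonglongrightarrow> h0 z" for z
      unfolding h_def h0_def lsq_operator_conv minus_apply sum_fun_at
      by (intro tendsto_intros pt ct) simp
    have [measurable]: "h i \<in> borel_measurable \<rho>" for i by (rule H_measurable[OF hH(1)])
    have "L2_norm_sq \<rho> h0 = (\<integral>\<^sup>+z. liminf (\<lambda>i. ennreal ((cmod (h i z))\<^sup>2)) \<partial>\<rho>)"
      unfolding L2_norm_sq_def
      by (intro nn_integral_cong lim_imp_Liminf[symmetric] tendsto_ennrealI tendsto_intros ht) simp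
    also have "\<dots> \<le> liminf (\<lambda>i. \<integral>\<^sup>+z. ennreal ((cmod (h i z))\<^sup>2) \<partial>\<rho>)"
      by (rule nn_integral_liminf) measurable
    also have "\<dots> \<le> b"
      using le by (intro Liminf_le always_eventually) (simp_all add: L2_norm_sq_def h_def)
    finally show "L2_norm_sq \<rho> (f - lsq_operator \<eta> m n x f) \<le> b" unfolding h0_def .
  qed
qed

lemma lsq_event_measurable:
  assumes X: "\<And>j. j < n \<Longrightarrow> X (Suc j) \<in> measurable P \<rho>"
  shows "{\<omega> \<in> space P. full_column_rank (lsq_matrix \<eta> m n (\<lambda>j. X j \<omega>)) \<and>
      lsq_worst_error_sq H ip \<rho> \<eta> m n (\<lambda>j. X j \<omega>) \<le> ennreal b} \<in> sets P" (is "?E \<in> _")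
proof -
  obtain g where g: "\<And>j::nat. g j \<in> H" "\<And>j. nrm (g j) \<le> 1"
    and dense: "\<And>f \<epsilon>. f \<in> H \<Longrightarrow> nrm f \<le> 1 \<Longrightarrow> 0 < \<epsilon> \<Longrightarrow> \<exists>j. nrm (f - g j) < \<epsilon>"
    using dense_sequence_ball[OF separable] by blast
  let ?G = "\<lambda>\<omega>. lsq_gram \<eta> m n (\<lambda>j. X j \<omega>)"
  let ?d = "m - 1"
  have L: "lsq_matrix \<eta> m n x \<in> carrier_mat n ?d" for x by (rule lsq_matrix_carrier)
  have G: "?G \<omega> \<in> carrier_mat ?d ?d" for \<omega> by (rule mult_carrier_mat[OF mat_adjoint_carrier[OF L] L])
  have Hm: "(\<lambda>\<omega>. f (X (Suc j) \<omega>)) \<in> borel_measurable P" if "j < n" "f \<in> H" for f j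
    by (rule measurable_compose[OF X[OF that(1)] H_measurable[OF that(2)]])
  have em: "(\<lambda>\<omega>. \<eta> (Suc i) (X (Suc j) \<omega>)) \<in> borel_measurable P" if "j < n" for i j
    by (rule Hm[OF that eta_in_H]) simp
  have entry: "?G \<omega> $$ (i, k) = (\<Sum>j<n. cnj (\<eta> (Suc i) (X (Suc j) \<omega>)) * \<eta> (Suc k) (X (Suc j) \<omega>))"
    if "i < ?d" "k < ?d" for i k \<omega>
  proof -
    have "?G \<omega> $$ (i, k) = (\<Sum>j<n. mat_adjoint (lsq_matrix \<eta> m n (\<lambda>j. X j \<omega>)) $$ (i, j) * lsq_matrix \<eta> m n (\<lambda>j. X j \<omega>) $$ (j, k))"
      using that L[of "\<lambda>j. X j \<omega>"] mat_adjoint_carrier[OF L[of "\<lambda>j. X j \<omega>"]]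
      by (simp add: times_mat_def scalar_prod_def lessThan_atLeast0)
    also have "\<dots> = (\<Sum>j<n. cnj (\<eta> (Suc i) (X (Suc j) \<omega>)) * \<eta> (Suc k) (X (Suc j) \<omega>))"
      using that by (intro sum.cong refl) (simp add: lsq_matrix_adjoint_index, simp add: lsq_matrix_def)
    finally show ?thesis .
  qed
  have entries: "(\<lambda>\<omega>. ?G \<omega> $$ (i, k)) \<in> borel_measurable P" if "i < ?d" "k < ?d" for i k
    unfolding entry[OF that]
    by (intro borel_measurable_sum borel_measurable_times borel_measurable_cnj em) auto
  have dm [measurable]: "(\<lambda>\<omega>. det (?G \<omega>)) \<in> borel_measurable P" by (rule measurable_det[OF G entries])
  define c where "c f \<omega> i = 1 / det (?G \<omega>)
    * (\<Sum>l<?d. adj_mat (?G \<omega>) $$ (i, l) * (\<Sum>j<n. cnj (\<eta> (Suc l) (X (Suc j) \<omega>)) * f (X (Suc j) \<omega>)))" for f \<omega> i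
  have cm: "(\<lambda>\<omega>. c f \<omega> i) \<in> borel_measurable P" if "f \<in> H" "i < ?d" for f i
    unfolding c_def
    by (intro borel_measurable_times borel_measurable_divide borel_measurable_sum borel_measurable_const dm
        measurable_adj_mat[OF G entries] borel_measurable_cnj em Hm that) (use that in auto)
  define err where "err f \<omega> = L2_sq f - 2 * Re (\<Sum>i<?d. c f \<omega> i * lip (\<eta> (Suc i)) f) + (\<Sum>i<?d. (cmod (c f \<omega> i))\<^sup>2)" for f \<omega>
  have cnm: "(\<lambda>\<omega>. cmod (c f \<omega> i)) \<in> borel_measurable P" if "f \<in> H" "i < ?d" for f i
    by (rule measurable_compose[OF cm[OF that]]) simp
  have errm: "err f \<in> borel_measurable P" if "f \<in> H" for f
    unfolding err_def
    by (intro borel_measurable_add borel_measurable_diff borel_measurable_const borel_measurable_times borel_measurable_Re[THEN measurable_compose[rotated]]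
        borel_measurable_sum borel_measurable_power cm cnm that) auto
  have "L2_norm_sq \<rho> (f - lsq_operator \<eta> m n (\<lambda>j. X j \<omega>) f) = ennreal (err f \<omega>)"
    if f: "f \<in> H" and det: "det (?G \<omega>) \<noteq> 0" for f \<omega>
  proof -
    have "(\<Sum>i<?d. lsq_coeffs \<eta> m n (\<lambda>j. X j \<omega>) f $ i * lip (\<eta> (Suc i)) f) = (\<Sum>i<?d. c f \<omega> i * lip (\<eta> (Suc i)) f)"
      "(\<Sum>i<?d. (cmod (lsq_coeffs \<eta> m n (\<lambda>j. X j \<omega>) f $ i))\<^sup>2) = (\<Sum>i<?d. (cmod (c f \<omega> i))\<^sup>2)"
      unfolding c_def by (intro sum.cong refl; simp add: lsq_coeffs_at[OF det])+
    then show ?thesis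
      unfolding lsq_operator_comb L2_norm_sq_eq[OF H_diff[OF f comb_in_H]] L2_sq_diff_comb[OF f] err_def by simp
  qed
  then have "?E = {\<omega> \<in> space P. det (?G \<omega>) \<noteq> 0 \<and> (\<forall>i. ennreal (err (g i) \<omega>) \<le> ennreal b)}"
    unfolding det_gram_iff_full_column_rank[OF L]
    using worst_error_le_iff_dense[OF g dense] g(1) by auto
  also have "\<dots> \<in> sets P" using errm[OF g(1)] by measurable
  finally show ?thesis .
qed

end

section \<open>Tail estimates for the extreme eigenvalues\<close>

lemma (in prob_space) markov_complement:
  assumes [measurable]: "f \<in> borel_measurable M" and V: "0 < V"
    and int: "(\<integral>\<^sup>+x. ennreal (f x) \<partial>M) \<le> ennreal (\<delta> * V)" and d: "0 \<le> \<delta>"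
  shows "1 - \<delta> \<le> prob {x \<in> space M. f x < V}"
proof -
  let ?A = "{x \<in> space M. V \<le> f x}"
  have "ennreal V * emeasure M ?A = (\<integral>\<^sup>+x. ennreal V * indicator ?A x \<partial>M)"
    by (subst nn_integral_cmult_indicator) auto
  also have "\<dots> \<le> (\<integral>\<^sup>+x. ennreal (f x) \<partial>M)"
    by (intro nn_integral_mono) (auto simp: indicator_def intro: ennreal_leI)
  also have "\<dots> \<le> ennreal (\<delta> * V)" by (rule int)
  finally have "ennreal (V * prob ?A) \<le> ennreal (\<delta> * V)"
    using V by (simp add: emeasure_eq_measure ennreal_mult')
  then have "V * prob ?A \<le> \<delta> * V" using d V by (simp add: ennreal_le_iff)
  then have "prob ?A \<le> \<delta>" using V by (simp add: mult.commute)
  moreover have "prob {x \<in> space M. f x < V} = 1 - prob ?A"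
    by (subst prob_compl[symmetric]) (auto intro!: arg_cong[of _ _ prob])
  ultimately show ?thesis by simp
qed

lemma one_plus_power_le_exp: "0 \<le> x \<Longrightarrow> (1 + x) ^ k \<le> exp (real k * x)" for x :: real
  using power_mono[OF exp_ge_add_one_self[of x], of k] by (simp add: exp_of_nat_mult)

lemma ln_8n_ge: assumes "1 \<le> n" shows "2 \<le> ln (8 * real n)"
proof -
  have "ln (8::real) = 3 * ln 2" using ln_realpow[of 2 3] by simp
  then have "2 \<le> ln (8::real)" using ln2_ge_two_thirds by simp
  also have "\<dots> \<le> ln (8 * real n)" using assms by simp
  finally show ?thesis .
qed

context sampled_frame
begin

text \<open>
  With \<open>L = ln (8 n)\<close>, a power \<open>p\<close> of order \<open>L\<close> and \<open>p \<theta> = L / (2 n M)\<close>, the expected value of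
  \<open>tr B\<^sup>p - d\<close> is at most \<open>8 n\<^sup>2\<close>.  If the norm exceeds \<open>s = 14 n M / \<delta>\<close>, this quantity is at least
  \<open>(1 + \<theta> s)\<^sup>p - 1\<close> with \<open>\<theta> s = 7 L / (p \<delta>) \<ge> 14 / (3 \<delta>)\<close>, and the choice of \<open>p\<close> makes this at least \<open>8 n\<^sup>2 / \<delta>\<close>.
\<close>

lemma upper_tail:
  fixes J :: "'i set"
  assumes J: "finite J" "card J = n" "1 \<le> n" and \<delta>: "0 < \<delta>" "\<delta> \<le> 1/3"
    and \<Lambda>: "\<And>i. i < d \<Longrightarrow> lam i \<le> \<Lambda>" and \<Lambda>0: "0 \<le> \<Lambda>"
    and M: "0 < M" "\<Lambda> \<le> M" "ln (8 * real n) / real n * T \<le> M"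
  obtains A where "A \<in> sets (PiM J (\<lambda>_. \<rho>))" "1 - \<delta> \<le> measure (PiM J (\<lambda>_. \<rho>)) A"
    "\<And>X u. X \<in> A \<Longrightarrow> gram X J u \<le> 14 * real n * M / \<delta> * Re (dot d u u)"
proof -
  define L where "L = ln (8 * real n)"
  define p where "p = nat \<lceil>L\<rceil>"
  define \<theta> where "\<theta> = L / (2 * real n * M * real p)"
  define s where "s = 14 * real n * M / \<delta>"
  define V where "V = (1 + \<theta> * s) ^ p - 1"
  define a where "a = real p * \<theta> * 2"
  have n0: "0 < real n" "1 \<le> real n" using J by simp_all
  have L2: "2 \<le> L" unfolding L_def by (rule ln_8n_ge[OF J(3)])
  have pL: "L \<le> real p" "real p \<le> L + 1" unfolding p_def using L2 by linarith+
  have p0: "0 < real p" "0 < p" using pL L2 by simp_all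
  have \<theta>0: "0 < \<theta>" unfolding \<theta>_def using L2 n0 M p0 by simp
  have s0: "0 \<le> s" unfolding s_def using n0 M \<delta> by simp
  have a: "a = L / (real n * M)" unfolding a_def \<theta>_def using p0 by (simp add: field_simps)
  have a0: "0 \<le> a" unfolding a using L2 n0 M by simp
  have aT: "a * T \<le> 1"
    using M n0 unfolding a L_def by (simp add: field_simps)
  have \<kappa>: "(1 + \<theta> * T) ^ (p - 1) \<le> 2"
  proof -
    have "(1 + \<theta> * T) ^ (p - 1) \<le> (1 + \<theta> * T) ^ p"
      using \<theta>0 T0 by (intro power_increasing) auto
    also have "\<dots> \<le> exp (real p * (\<theta> * T))" using \<theta>0 T0 by (intro one_plus_power_le_exp) simp
    also have "\<dots> \<le> exp (1 / 2)" using aT unfolding a_def by simp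
    also have "\<dots> \<le> 2" using exp_bound_half[of "1/2 :: real"] by simp
    finally show ?thesis .
  qed
  have growth: "(1 + a * \<Lambda>) ^ n \<le> 8 * real n"
  proof -
    have "(1 + a * \<Lambda>) ^ n \<le> exp (real n * (a * \<Lambda>))"
      using a0 \<Lambda>0 by (intro one_plus_power_le_exp) simp
    also have "\<dots> \<le> exp (real n * (a * M))"
      using a0 n0 M(2) by (simp add: mult_left_mono)
    also have "real n * (a * M) = L" unfolding a using n0 M by simp
    also have "exp L = 8 * real n" unfolding L_def using n0 by simp
    finally show ?thesis .
  qed
  have V_ge: "8 * (real n)\<^sup>2 \<le> \<delta> * V"
  proof -
    have \<theta>s: "\<theta> * s = 7 * L / (real p * \<delta>)"
      unfolding \<theta>_def s_def using n0 M by (simp add: field_simps)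
    have "14 / (3 * \<delta>) \<le> \<theta> * s"
      unfolding \<theta>s using pL L2 p0 \<delta> by (simp add: field_simps)
    moreover have "14 \<le> 14 / (3 * \<delta>)" using \<delta> by (simp add: field_simps)
    ultimately have X: "14 / (3 * \<delta>) \<le> 1 + \<theta> * s" "15 \<le> 1 + \<theta> * s" by linarith+
    have e2: "exp 2 \<le> (8::real)"
    proof -
      have "exp 2 \<le> exp (ln (8 * real 1))" using ln_8n_ge[of 1] by (simp only: exp_le_cancel_iff)
      then show ?thesis by simp
    qed
    \<comment> \<open>One factor \<open>1 + \<theta> s\<close> provides \<open>1 / \<delta>\<close>; the other \<open>p - 1 \<ge> L - 1\<close> factors are at least
      \<open>15 \<ge> exp 2\<close> and provide \<open>exp (2 L - 2) = (8 n)\<^sup>2 / exp 2\<close>.\<close>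
    have "8 * (real n)\<^sup>2 = (8 * real n)\<^sup>2 / 8" by (simp add: power2_eq_square)
    also have "\<dots> \<le> (8 * real n)\<^sup>2 / exp 2" using e2 by (intro divide_left_mono) simp_all
    also have "\<dots> = exp (2 * L - 2)"
      unfolding L_def using n0 by (simp add: exp_diff exp_double)
    also have "\<dots> \<le> exp (real (p - 1) * 2)" using pL p0 by (simp add: of_nat_diff)
    also have "\<dots> = exp 2 ^ (p - 1)" by (simp add: exp_of_nat_mult)
    also have "\<dots> \<le> (1 + \<theta> * s) ^ (p - 1)" using e2 X by (intro power_mono) simp_all
    finally have "14 / (3 * \<delta>) * (8 * (real n)\<^sup>2) \<le> (1 + \<theta> * s) * (1 + \<theta> * s) ^ (p - 1)"
      using X \<delta> by (intro mult_mono) simp_all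
    also have "\<dots> = V + 1" unfolding V_def using p0 by (cases p) simp_all
    finally have "\<delta> * (14 / (3 * \<delta>) * (8 * (real n)\<^sup>2)) \<le> \<delta> * (V + 1)" using \<delta> by (intro mult_left_mono) simp_all
    then have "112 / 3 * (real n)\<^sup>2 \<le> \<delta> * V + \<delta>" using \<delta> by (simp add: distrib_left)
    moreover have "1 \<le> (real n)\<^sup>2" using n0 by simp
    ultimately show ?thesis using \<delta> by linarith
  qed
  have V0: "0 < V"
  proof -
    have "0 < 8 * (real n)\<^sup>2" using n0 by simp
    with V_ge have "0 < \<delta> * V" by linarith
    with \<delta> show ?thesis by (simp add: zero_less_mult_iff)
  qed
  interpret PJ: prob_space "PiM J (\<lambda>_. \<rho>)" by (rule prob_space_PiM) (rule prob_space_axioms)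
  note [measurable] = measurable_trc[OF J(1), where \<theta>=\<theta> and k=p]
  let ?f = "\<lambda>X. trc d (sample_op \<theta> X J ^^ p) - real d"
  let ?A = "{X \<in> space (PiM J (\<lambda>_. \<rho>)). ?f X < V}"
  have "(\<integral>\<^sup>+X. ennreal (?f X) \<partial>PiM J (\<lambda>_. \<rho>)) \<le> ennreal (real (card J) * (a * T) * (1 + a * \<Lambda>) ^ card J)"
    using \<theta>0 by (intro upper_expectation[where \<kappa>=2] J(1) \<Lambda> \<Lambda>0 p0(2) \<kappa> a_def) simp
  also have "\<dots> \<le> ennreal (\<delta> * V)"
  proof (rule ennreal_leI)
    have "real n * (a * T) * (1 + a * \<Lambda>) ^ n \<le> real n * 1 * (8 * real n)"
      using a0 T0 \<Lambda>0 aT growth by (intro mult_mono) simp_all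
    also have "\<dots> \<le> \<delta> * V" using V_ge by (simp add: power2_eq_square mult_ac)
    finally show "real (card J) * (a * T) * (1 + a * \<Lambda>) ^ card J \<le> \<delta> * V" by (simp add: J(2))
  qed
  finally have "1 - \<delta> \<le> measure (PiM J (\<lambda>_. \<rho>)) ?A"
    using V0 \<delta> by (intro PJ.markov_complement) simp_all
  moreover have "?A \<in> sets (PiM J (\<lambda>_. \<rho>))" by measurable
  moreover have "gram X J u \<le> 14 * real n * M / \<delta> * Re (dot d u u)" if "X \<in> ?A" for X u
    using that gram_upper[OF \<theta>0 s0, where X=X and J=J and p=p and u=u] unfolding V_def s_def by simp
  ultimately show ?thesis using that by blast
qed

text \<open>
  The choice \<open>\<theta> = 1 / (8 n T)\<close> keeps \<open>\<theta> \<Sum>\<^sub>j y\<^sub>j y\<^sub>j\<^sup>*\<close> below \<open>1/8\<close> for every outcome, and \<open>p = 2 n\<close> makes \<open>p \<theta> = 1 / (4 T)\<close>.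
  The expected trace is then at most \<open>d exp (- 5 n / (28 T))\<close>, whereas an eigenvalue below \<open>n/2\<close>
  makes it at least \<open>exp (- 2 n / (15 T))\<close>.  The difference \<open>5/28 - 2/15 = 19/420\<close> of the rates, times
  \<open>n / T = 48 (\<dots>)\<close>, exceeds \<open>ln (2 n) - ln \<delta>\<close>.
\<close>

lemma lower_tail:
  fixes J :: "'i set"
  assumes J: "finite J" "card J = n" "1 \<le> n" and \<delta>: "0 < \<delta>" "\<delta> \<le> 1/3"
    and lam1: "\<And>i. i < d \<Longrightarrow> lam i = 1"
    and T: "T = real n / (48 * (sqrt 2 * ln (2 * real n) - ln \<delta>))"
  obtains A where "A \<in> sets (PiM J (\<lambda>_. \<rho>))" "1 - \<delta> \<le> measure (PiM J (\<lambda>_. \<rho>)) A"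
    "\<And>X u. X \<in> A \<Longrightarrow> real n / 2 * Re (dot d u u) \<le> gram X J u"
proof (cases "d = 0")
  case True
  interpret PJ: prob_space "PiM J (\<lambda>_. \<rho>)" by (rule prob_space_PiM) (rule prob_space_axioms)
  show ?thesis
  proof (rule that[of "space (PiM J (\<lambda>_. \<rho>))"])
    show "1 - \<delta> \<le> PJ.prob (space (PiM J (\<lambda>_. \<rho>)))" using \<delta> by (simp add: PJ.prob_space)
    show "real n / 2 * Re (dot d u u) \<le> gram X J u" for X u
      using gram_nonneg[of X J u] True by (simp add: dot_def)
  qed simp
next
  case False
  have n0: "0 < real n" "1 \<le> real n" using J by simp_all
  define L where "L = ln (2 * real n) - ln \<delta>"
  define Q where "Q = sqrt 2 * ln (2 * real n) - ln \<delta>"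
  have "0 \<le> ln (2 * real n)" using n0 by simp
  then have "1 * ln (2 * real n) \<le> sqrt 2 * ln (2 * real n)" by (intro mult_right_mono) simp_all
  then have LQ: "L \<le> Q" unfolding L_def Q_def by simp
  have "ln \<delta> \<le> \<delta> - 1" by (rule ln_le_minus_one[OF \<delta>(1)])
  then have L0: "1 / 2 \<le> L" unfolding L_def using \<delta> \<open>0 \<le> ln (2 * real n)\<close> by linarith
  have Q0: "1 / 2 \<le> Q" using LQ L0 by simp
  have TQ: "T = real n / (48 * Q)" unfolding T Q_def ..
  have T_le: "T \<le> real n" unfolding TQ using Q0 n0 by (simp add: field_simps)
  \<comment> \<open>The average of \<open>\<parallel>y\<parallel>\<^sup>2\<close> is \<open>d\<close>, so the uniform bound \<open>T\<close> is at least \<open>d\<close>.\<close>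
  have T1: "1 \<le> T"
  proof -
    have "1 \<le> real d" using False by simp
    also have "real d = (\<Sum>i<d. lam i)" by (simp add: lam1)
    also have "\<dots> \<le> T" by (rule sum_lam_le)
    finally show ?thesis .
  qed
  have dT: "real d \<le> T" using sum_lam_le by (simp add: lam1)
  define \<theta> where "\<theta> = 1 / (8 * real n * T)"
  define p where "p = 2 * n"
  define V where "V = (1 - \<theta> * (real n / 2)) ^ p"
  have \<theta>0: "0 < \<theta>" unfolding \<theta>_def using n0 T1 by simp
  have p0: "0 < p" using J by (simp add: p_def)
  have \<tau>: "\<theta> * (real (card J) * T) \<le> 1 / 8" unfolding \<theta>_def J(2) using n0 T1 by simp
  \<comment> \<open>\<open>(1 + 1 / (7 n))\<^bsup>2n\<^esup> \<le> exp (2/7)\<close>, and \<open>exp (- 2/7) \<ge> 5/7\<close>.\<close>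
  have \<kappa>: "5 / 7 * (1 + \<theta> * T / (1 - 1 / 8)) ^ (p - 1) \<le> 1"
  proof -
    have x: "\<theta> * T / (1 - 1 / 8) = 1 / (7 * real n)" unfolding \<theta>_def using n0 T1 by (simp add: field_simps)
    have "(1 + 1 / (7 * real n)) ^ (p - 1) \<le> (1 + 1 / (7 * real n)) ^ p"
      using n0 by (intro power_increasing) auto
    also have "\<dots> \<le> exp (real p * (1 / (7 * real n)))" using n0 by (intro one_plus_power_le_exp) simp
    also have "real p * (1 / (7 * real n)) = 2 / 7" unfolding p_def using n0 by (simp add: field_simps)
    finally have "5 / 7 * (1 + 1 / (7 * real n)) ^ (p - 1) \<le> exp (- (2 / 7)) * exp (2 / 7)"
      using exp_ge_add_one_self[of "- (2 / 7) :: real"] n0 by (intro mult_mono) simp_all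
    then show ?thesis unfolding x exp_add[symmetric] by simp
  qed
  have rate: "real p * \<theta> * (5 / 7) = 5 / (28 * T)" unfolding p_def \<theta>_def using n0 by (simp add: field_simps)
  have rate1: "real p * \<theta> * (5 / 7) \<le> 1" unfolding rate using T1 by (simp add: field_simps)
  have base: "1 - \<theta> * (real n / 2) = 1 - 1 / (16 * T)" unfolding \<theta>_def using n0 by (simp add: field_simps)
  have base0: "0 < 1 - \<theta> * (real n / 2)" unfolding base using T1 by (simp add: field_simps)
  have V0: "0 < V" unfolding V_def using base0 by simp
  have V_ge: "exp (- (2 * real n / (15 * T))) \<le> V"
  proof -
    have "exp (- (1 / (15 * T))) \<le> 1 - 1 / (16 * T)"
    proof -
      have "1 / (1 - 1 / (16 * T)) \<le> 1 + 1 / (15 * T)" using T1 by (simp add: field_simps)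
      also have "\<dots> \<le> exp (1 / (15 * T))" by (rule exp_ge_add_one_self)
      finally have "1 \<le> exp (1 / (15 * T)) * (1 - 1 / (16 * T))"
        using base0 unfolding base by (simp only: pos_divide_le_eq)
      then show ?thesis by (simp add: exp_minus field_simps)
    qed
    then have "exp (- (1 / (15 * T))) ^ p \<le> V" unfolding V_def base by (intro power_mono) simp_all
    then show ?thesis by (simp add: exp_of_nat_mult[symmetric] p_def)
  qed
  have bound: "real d * (1 - real p * \<theta> * (5 / 7)) ^ n \<le> \<delta> * V"
  proof -
    have "1 - 5 / (28 * T) \<le> exp (- (5 / (28 * T)))" using exp_ge_add_one_self[of "- (5 / (28 * T))"] by simp
    then have "(1 - 5 / (28 * T)) ^ n \<le> exp (- (5 / (28 * T))) ^ n"
      using rate1 unfolding rate by (intro power_mono) simp_all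
    also have "\<dots> = exp (- (5 * real n / (28 * T)))" by (simp add: exp_of_nat_mult[symmetric])
    also have "\<dots> = exp (- (19 / 420 * (real n / T))) * exp (- (2 * real n / (15 * T)))"
      unfolding exp_add[symmetric] using T1 by (simp add: field_simps)
    also have "\<dots> \<le> exp (- L) * V"
    proof (intro mult_mono V_ge)
      have "real n / T = 48 * Q" unfolding TQ using Q0 n0 by simp
      then have "L \<le> 19 / 420 * (real n / T)" using LQ L0 by simp
      then show "exp (- (19 / 420 * (real n / T))) \<le> exp (- L)" by simp
    qed simp_all
    also have "exp (- L) = \<delta> / (2 * real n)"
      unfolding L_def using n0 \<delta> by (simp add: exp_diff)
    finally have "real d * (1 - 5 / (28 * T)) ^ n \<le> real n * (\<delta> / (2 * real n) * V)"
      using dT T_le rate1 unfolding rate by (intro mult_mono) simp_all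
    also have "\<dots> = \<delta> * V / 2" using n0 by simp
    also have "\<dots> \<le> \<delta> * V" using \<delta> V0 by simp
    finally show ?thesis unfolding rate .
  qed
  interpret PJ: prob_space "PiM J (\<lambda>_. \<rho>)" by (rule prob_space_PiM) (rule prob_space_axioms)
  note [measurable] = measurable_trc[OF J(1), where \<theta>="- \<theta>" and k=p]
  let ?f = "\<lambda>X. trc d (sample_op (- \<theta>) X J ^^ p)"
  let ?A = "{X \<in> space (PiM J (\<lambda>_. \<rho>)). ?f X < V}"
  have "(\<integral>\<^sup>+X. ennreal (?f X) \<partial>PiM J (\<lambda>_. \<rho>)) \<le> ennreal (real d * (1 - real p * \<theta> * (5 / 7)) ^ card J)"
    using \<theta>0 by (intro lower_expectation[where \<tau>="1/8"] J(1) lam1 p0 \<tau> \<kappa> rate1) simp_all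
  also have "\<dots> \<le> ennreal (\<delta> * V)" using bound by (intro ennreal_leI) (simp add: J(2))
  finally have "1 - \<delta> \<le> measure (PiM J (\<lambda>_. \<rho>)) ?A"
    using V0 \<delta> by (intro PJ.markov_complement) simp_all
  moreover have "?A \<in> sets (PiM J (\<lambda>_. \<rho>))" by measurable
  moreover have "real n / 2 * Re (dot d u u) \<le> gram X J u" if "X \<in> ?A" for X u
  proof (rule gram_lower[OF \<theta>0])
    show "psd_op d (sample_op (- \<theta>) X J)"
      by (rule sample_op_neg_psd) (use \<theta>0 \<tau> that in \<open>auto simp: space_PiM\<close>)
    show "trc d (sample_op (- \<theta>) X J ^^ p) < (1 - \<theta> * (real n / 2)) ^ p" using that by (simp add: V_def)
  qed (use base0 in simp)
  ultimately show ?thesis using that by blast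
qed

end

section \<open>The probability estimate\<close>

context embedded_rkhs
begin

lemma eta_norm_sq: assumes "1 \<le> k" shows "(cmod (\<eta> k x))\<^sup>2 = (cmod (e k x))\<^sup>2 / (singular_number lam k)\<^sup>2"
proof -
  have p: "0 < lam k" by (rule lam_pos[OF assms])
  have "(lam k powr (-1/2))\<^sup>2 = 1 / lam k" using normalization_sq[OF assms] p by (simp add: field_simps)
  then have "(cmod (\<eta> k x))\<^sup>2 = 1 / lam k * (cmod (e k x))\<^sup>2"
    unfolding eta_conv norm_mult power_mult_distrib norm_of_real power2_abs by simp
  then show ?thesis using p by (simp add: singular_number_def)
qed

lemma eta_sum_le_spectral_N:
  assumes x: "x \<in> D"
  shows "(\<Sum>i<m-1. (cmod (\<eta> (Suc i) x))\<^sup>2) \<le> spectral_N D lam e m"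
proof -
  let ?F = "\<lambda>x. \<Sum>k=1..m-1. (cmod (e k x))\<^sup>2 / (singular_number lam k)\<^sup>2"
  have F: "?F x = (\<Sum>i<m-1. (cmod (\<eta> (Suc i) x))\<^sup>2)" for x
  proof -
    have "?F x = (\<Sum>k\<in>{1..<Suc (m-1)}. (cmod (\<eta> k x))\<^sup>2)"
      unfolding atLeastLessThanSuc_atLeastAtMost by (intro sum.cong refl) (simp add: eta_norm_sq)
    also have "\<dots> = (\<Sum>i<m-1. (cmod (\<eta> (Suc i) x))\<^sup>2)" by (rule sum_Suc_shift[symmetric])
    finally show ?thesis .
  qed
  have "bdd_above (?F ` D)"
  proof (rule bdd_aboveI2)
    fix z
    have "?F z \<le> (\<Sum>k=1..m-1. C\<^sup>2 / (singular_number lam k)\<^sup>2)"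
    proof (intro sum_mono divide_right_mono)
      fix k assume "k \<in> {1..m-1}"
      then show "(cmod (e k z))\<^sup>2 \<le> C\<^sup>2" using bessel_e[of "{k}" z] by simp
    qed simp
    then show "?F z \<le> (\<Sum>k=1..m-1. C\<^sup>2 / (singular_number lam k)\<^sup>2)" .
  qed
  then have "?F x \<le> spectral_N D lam e m" unfolding spectral_N_def using x by (intro cSUP_upper)
  then show ?thesis unfolding F .
qed

lemma e_sum_le_spectral_T:
  assumes x: "x \<in> D" and m: "1 \<le> m"
  shows "(\<Sum>i<r. (cmod (e (m + i) x))\<^sup>2) \<le> spectral_T D e m"
proof -
  have partial: "(\<Sum>i<r. (cmod (e (m + i) z))\<^sup>2) \<le> C\<^sup>2" for r z
  proof -
    have "(\<Sum>i<r. (cmod (e (m + i) z))\<^sup>2) = (\<Sum>k\<in>(\<lambda>i. m + i) ` {..<r}. (cmod (e k z))\<^sup>2)"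
      by (subst sum.reindex) auto
    also have "\<dots> \<le> C\<^sup>2" using m by (intro bessel_e) auto
    finally show ?thesis .
  qed
  have sm: "summable (\<lambda>i. (cmod (e (m + i) z))\<^sup>2)" for z
    by (rule summableI_nonneg_bounded[where x="C\<^sup>2"]) (simp_all add: partial)
  have "bdd_above ((\<lambda>z. \<Sum>i. (cmod (e (m + i) z))\<^sup>2) ` D)"
    by (rule bdd_aboveI2[where M="C\<^sup>2"]) (intro suminf_le_const sm partial)
  then have "(\<Sum>i. (cmod (e (m + i) x))\<^sup>2) \<le> spectral_T D e m"
    unfolding spectral_T_def using x by (intro cSUP_upper)
  moreover have "(\<Sum>i<r. (cmod (e (m + i) x))\<^sup>2) \<le> (\<Sum>i. (cmod (e (m + i) x))\<^sup>2)"
    by (rule sum_le_suminf[OF sm]) auto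
  ultimately show ?thesis by simp
qed

text \<open>
  The conjugates make \<open>dot\<close> of a coefficient vector with the feature vector at \<open>x\<close> the value at \<open>x\<close> of the
  corresponding linear combination.
\<close>

lemma eta_frame:
  assumes N: "spectral_N D lam e m \<le> N" "0 \<le> N"
  shows "sampled_frame \<rho> (\<lambda>i x. cnj (\<eta> (Suc i) x)) (m - 1) N (\<lambda>_. 1)"
proof (intro sampled_frame.intro sampled_frame_axioms.intro prob_space_axioms)
  show "(\<lambda>x. cnj (\<eta> (Suc i) x)) \<in> borel_measurable \<rho>" for i
    by (intro borel_measurable_cnj H_measurable eta_in_H) simp
  show "(\<Sum>i<m-1. (cmod (cnj (\<eta> (Suc i) x)))\<^sup>2) \<le> N" if "x \<in> space \<rho>" for x
    using eta_sum_le_spectral_N[of x m] N that by (simp add: space_rho)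
  show "(LINT x|\<rho>. cnj (\<eta> (Suc i) x) * cnj (cnj (\<eta> (Suc j) x))) = (if i = j then complex_of_real 1 else 0)" for i j
    using eta_orthonormal[of "Suc j" "Suc i"] by (auto simp: L2_ip_def mult.commute)
qed (rule N)

lemma e_frame:
  assumes m: "1 \<le> m" and T: "0 \<le> spectral_T D e m"
  shows "sampled_frame \<rho> (\<lambda>i x. cnj (e (m + i) x)) r (spectral_T D e m) (\<lambda>i. lam (m + i))"
proof (intro sampled_frame.intro sampled_frame_axioms.intro prob_space_axioms)
  show "(\<lambda>x. cnj (e (m + i) x)) \<in> borel_measurable \<rho>" for i
    using m by (intro borel_measurable_cnj H_measurable e_in_H) simp
  show "(\<Sum>i<r. (cmod (cnj (e (m + i) x)))\<^sup>2) \<le> spectral_T D e m" if "x \<in> space \<rho>" for x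
    using e_sum_le_spectral_T[OF _ m, of x r] that by (simp add: space_rho)
  show "(LINT x|\<rho>. cnj (e (m + i) x) * cnj (cnj (e (m + j) x))) = (if i = j then complex_of_real (lam (m + i)) else 0)" for i j
    using lip_e_e[of "m + j" "m + i"] m by (auto simp: L2_ip_def mult.commute)
qed (rule T)

lemma sum_nodes: "(\<Sum>j\<in>{1..n}. F j) = (\<Sum>j<n. F (Suc j))" for F :: "nat \<Rightarrow> real"
  unfolding sum_Suc_shift atLeastLessThanSuc_atLeastAtMost ..

lemma good_lower_event:
  assumes n: "1 \<le> n" and \<delta>: "0 < \<delta>" "\<delta> \<le> 1/3"
    and N: "spectral_N D lam e m \<le> real n / (48 * (sqrt 2 * ln (2 * real n) - ln \<delta>))"
  obtains A where "A \<in> sets (PiM {1..n} (\<lambda>_. \<rho>))" "1 - \<delta> \<le> measure (PiM {1..n} (\<lambda>_. \<rho>)) A"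
    "\<And>x u. x \<in> A \<Longrightarrow> real n / 2 * (\<Sum>i<m-1. (cmod (u i))\<^sup>2)
      \<le> (\<Sum>j<n. (cmod (\<Sum>i<m-1. u i * \<eta> (Suc i) (x (Suc j))))\<^sup>2)"
proof -
  define Nb where "Nb = real n / (48 * (sqrt 2 * ln (2 * real n) - ln \<delta>))"
  have "ln \<delta> \<le> 0" using \<delta> by simp
  moreover have "0 \<le> sqrt 2 * ln (2 * real n)" using n by (intro mult_nonneg_nonneg) simp_all
  ultimately have "0 \<le> Nb" unfolding Nb_def by (intro divide_nonneg_nonneg) simp_all
  then interpret F: sampled_frame \<rho> "\<lambda>i x. cnj (\<eta> (Suc i) x)" "m - 1" Nb "\<lambda>_. 1"
    using N by (intro eta_frame) (simp_all add: Nb_def)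
  obtain A where A: "A \<in> sets (PiM {1..n} (\<lambda>_. \<rho>))" "1 - \<delta> \<le> measure (PiM {1..n} (\<lambda>_. \<rho>)) A"
    and low: "\<And>X u. X \<in> A \<Longrightarrow> real n / 2 * Re (dot (m-1) u u) \<le> F.gram X {1..n} u"
    by (rule F.lower_tail[of "{1..n}" n \<delta>]) (use n \<delta> in \<open>auto simp: Nb_def\<close>)
  show ?thesis
  proof (rule that[OF A])
    fix x u assume "x \<in> A"
    from low[OF this, of u] show "real n / 2 * (\<Sum>i<m-1. (cmod (u i))\<^sup>2)
      \<le> (\<Sum>j<n. (cmod (\<Sum>i<m-1. u i * \<eta> (Suc i) (x (Suc j))))\<^sup>2)"
      unfolding F.gram_def sum_nodes by (simp add: dot_self dot_def)
  qed
qed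

text \<open>
  The tail is treated through its truncations to \<open>r\<close> terms.  Each truncation has an event of probability at
  least \<open>1 - \<delta>\<close>, and so has the event that infinitely many of them occur.  That event suffices, because the
  bound for \<open>r'\<close> terms contains the bound for every \<open>r \<le> r'\<close>.
\<close>

lemma good_upper_event:
  assumes n: "1 \<le> n" and m: "1 \<le> m" and \<delta>: "0 < \<delta>" "\<delta> \<le> 1/3"
    and M: "lam m \<le> M" "ln (8 * real n) / real n * spectral_T D e m \<le> M"
  obtains A where "A \<in> sets (PiM {1..n} (\<lambda>_. \<rho>))" "1 - \<delta> \<le> measure (PiM {1..n} (\<lambda>_. \<rho>)) A"
    "\<And>x r u. x \<in> A \<Longrightarrow> (\<Sum>j<n. (cmod (\<Sum>i<r. u i * e (m + i) (x (Suc j))))\<^sup>2)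
      \<le> 14 * real n * M / \<delta> * (\<Sum>i<r. (cmod (u i))\<^sup>2)"
proof -
  have Tnn: "0 \<le> spectral_T D e m"
  proof -
    obtain x where "x \<in> D" using not_empty space_rho by auto
    then show ?thesis using e_sum_le_spectral_T[OF _ m, of x 0] by simp
  qed
  have M0: "0 < M" using lam_pos[OF m] M by simp
  let ?PM = "PiM {1..n} (\<lambda>_. \<rho>)" and ?s = "14 * real n * M / \<delta>"
  interpret PM: prob_space ?PM by (rule prob_space_PiM) (rule prob_space_axioms)
  define good where "good r A \<longleftrightarrow> A \<in> sets ?PM \<and> 1 - \<delta> \<le> measure ?PM A \<and> (\<forall>x\<in>A. \<forall>u.
      (\<Sum>j<n. (cmod (\<Sum>i<r. u i * e (m + i) (x (Suc j))))\<^sup>2) \<le> ?s * (\<Sum>i<r. (cmod (u i))\<^sup>2))" for r A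
  have "\<exists>A. good r A" for r
  proof -
    interpret F: sampled_frame \<rho> "\<lambda>i x. cnj (e (m + i) x)" r "spectral_T D e m" "\<lambda>i. lam (m + i)"
      by (rule e_frame[OF m Tnn])
    obtain A where A: "A \<in> sets ?PM" "1 - \<delta> \<le> measure ?PM A"
      and up: "\<And>X u. X \<in> A \<Longrightarrow> F.gram X {1..n} u \<le> ?s * Re (dot r u u)"
    proof (rule F.upper_tail[of "{1..n}" n \<delta> "lam m" M])
      show "lam (m + i) \<le> lam m" for i by (rule lam_antimono[OF m]) simp
      show "0 \<le> lam m" using lam_pos[OF m] by simp
    qed (use n \<delta> M M0 in auto)
    have "(\<Sum>j<n. (cmod (\<Sum>i<r. u i * e (m + i) (x (Suc j))))\<^sup>2) \<le> ?s * (\<Sum>i<r. (cmod (u i))\<^sup>2)"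
      if "x \<in> A" for x u
      using up[OF that, of u] unfolding F.gram_def sum_nodes by (simp add: dot_self dot_def)
    with A have "good r A" unfolding good_def by auto
    then show ?thesis ..
  qed
  then have "\<forall>r. \<exists>A. good r A" ..
  from choice[OF this] obtain A where good: "\<And>r. good r (A r)" by auto
  have A: "\<And>r. A r \<in> sets ?PM" "\<And>r. 1 - \<delta> \<le> measure ?PM (A r)"
    and up: "\<And>r x u. x \<in> A r \<Longrightarrow>
      (\<Sum>j<n. (cmod (\<Sum>i<r. u i * e (m + i) (x (Suc j))))\<^sup>2) \<le> ?s * (\<Sum>i<r. (cmod (u i))\<^sup>2)"
    using good unfolding good_def by auto
  define B where "B r = (\<Union>r'\<in>{r..}. A r')" for r :: nat
  have B: "B r \<in> sets ?PM" for r unfolding B_def using A(1) by (intro sets.countable_UN') auto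
  have "1 - \<delta> \<le> measure ?PM (\<Inter>r. B r)"
  proof (rule LIMSEQ_le_const)
    have "decseq B" unfolding decseq_def B_def by (auto intro: order_trans)
    then show "(\<lambda>r. measure ?PM (B r)) \<longlonglongrightarrow> measure ?PM (\<Inter>r. B r)"
      using B by (intro PM.finite_Lim_measure_decseq) auto
    have "1 - \<delta> \<le> measure ?PM (B r)" for r
    proof (rule order_trans[OF A(2)[of r]])
      show "measure ?PM (A r) \<le> measure ?PM (B r)"
        by (rule PM.finite_measure_mono[OF _ B]) (auto simp: B_def)
    qed
    then show "\<exists>N. \<forall>r\<ge>N. 1 - \<delta> \<le> measure ?PM (B r)" by blast
  qed
  moreover have "(\<Inter>r. B r) \<in> sets ?PM" using B by (intro sets.countable_INT) auto
  moreover have "(\<Sum>j<n. (cmod (\<Sum>i<r. u i * e (m + i) (x (Suc j))))\<^sup>2) \<le> ?s * (\<Sum>i<r. (cmod (u i))\<^sup>2)"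
    if x: "x \<in> (\<Inter>r. B r)" for x r u
  proof -
    have "x \<in> B r" using x by blast
    then obtain r' where r': "r \<le> r'" "x \<in> A r'" unfolding B_def by auto
    let ?u = "\<lambda>i. if i < r then u i else 0"
    have ext: "(\<Sum>i<r'. F i) = (\<Sum>i<r. F i)" if "\<And>i. r \<le> i \<Longrightarrow> F i = 0" for F :: "nat \<Rightarrow> 'b::comm_monoid_add"
      using r'(1) that by (intro sum.mono_neutral_right) auto
    have "(\<Sum>i<r'. ?u i * e (m + i) z) = (\<Sum>i<r. u i * e (m + i) z)" for z
      by (subst ext) (auto intro: sum.cong)
    moreover have "(\<Sum>i<r'. (cmod (?u i))\<^sup>2) = (\<Sum>i<r. (cmod (u i))\<^sup>2)"
      by (subst ext) (auto intro: sum.cong)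
    ultimately show ?thesis using up[OF r'(2), of ?u] by simp
  qed
  ultimately show ?thesis using that by blast
qed

end

theorem theorem1p1:
  fixes D :: "(real ^ 'd) set"
    and K :: "real ^ 'd \<Rightarrow> real ^ 'd \<Rightarrow> complex"
    and H :: "(real ^ 'd \<Rightarrow> complex) set"
    and ip :: "(real ^ 'd \<Rightarrow> complex) \<Rightarrow> (real ^ 'd \<Rightarrow> complex) \<Rightarrow> complex"
    and \<rho> :: "(real ^ 'd) measure"
    and lam :: "nat \<Rightarrow> real"
    and e :: "nat \<Rightarrow> real ^ 'd \<Rightarrow> complex"
    and n m :: nat
    and \<delta> :: real
    and P :: "'w measure"
    and X :: "nat \<Rightarrow> 'w \<Rightarrow> real ^ 'd"
  assumes kernel: "psd_kernel D K"
    and bounded: "bdd_above ((\<lambda>x. Re (K x x)) ` D)"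
    and rkhs: "rkhs D K H ip"
    and separable: "separable_ip H ip"
    and infinite_dim: "infinite_dimensional H"
    and prob_rho: "prob_space \<rho>"
    and space_rho: "space \<rho> = D"
    and measurable: "\<And>f. f \<in> H \<Longrightarrow> f \<in> borel_measurable \<rho>"
    and eigensystem: "embedding_eigensystem H ip \<rho> lam e"
    and n: "n \<ge> 1"
    and delta: "0 < \<delta>" "\<delta> < 1 / 3"
    and m: "m \<ge> 1"
    and N_bound: "spectral_N D lam e m \<le> real n / (48 * (sqrt 2 * ln (2 * real n) - ln \<delta>))"
    and prob_P: "prob_space P"
    and indep: "prob_space.indep_vars P (\<lambda>_. \<rho>) X {1..n}"
    and distr: "\<And>j. j \<in> {1..n} \<Longrightarrow> distr P \<rho> (X j) = \<rho>"
  shows "measure P {\<omega> \<in> space P.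
            full_column_rank (lsq_matrix (L2_normalized lam e) m n (\<lambda>j. X j \<omega>)) \<and>
            lsq_worst_error_sq H ip \<rho> (L2_normalized lam e) m n (\<lambda>j. X j \<omega>)
              \<le> ennreal (29 / \<delta> * max ((singular_number lam m)\<^sup>2)
                                        (ln (8 * real n) / real n * spectral_T D e m))}
          \<ge> 1 - 3 * \<delta>"
proof -
  obtain b where b: "\<And>x. x \<in> D \<Longrightarrow> Re (K x x) \<le> b"
    using bounded unfolding bdd_above_def by auto
  interpret rho: prob_space \<rho> by (rule prob_rho)
  interpret R: rkhs D K H ip by (rule rkhs)
  interpret E: embedded_rkhs D K H ip \<rho> lam e "sqrt (max b 0)"
  proof
    show "Re (K x x) \<le> (sqrt (max b 0))\<^sup>2" if "x \<in> D" for x using b[OF that] by simp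
  qed (use space_rho measurable separable eigensystem in auto)
  interpret P: prob_space P by (rule prob_P)
  define M where "M = max (lam m) (ln (8 * real n) / real n * spectral_T D e m)"
  have M0: "0 < M" unfolding M_def using E.lam_pos[OF m] by simp
  have sing: "(singular_number lam m)\<^sup>2 = lam m" using E.lam_pos[OF m] by (simp add: singular_number_def)
  have d3: "\<delta> \<le> 1 / 3" using delta by simp
  let ?PM = "PiM {1..n} (\<lambda>_. \<rho>)"
  interpret PM: prob_space ?PM by (rule prob_space_PiM) (rule prob_rho)
  obtain A1 where A1: "A1 \<in> sets ?PM" "1 - \<delta> \<le> measure ?PM A1"
    and low: "\<And>x u. x \<in> A1 \<Longrightarrow> real n / 2 * (\<Sum>i<m-1. (cmod (u i))\<^sup>2)
      \<le> (\<Sum>j<n. (cmod (\<Sum>i<m-1. u i * L2_normalized lam e (Suc i) (x (Suc j))))\<^sup>2)"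
    by (rule E.good_lower_event[OF n delta(1) d3 N_bound]) (rule that)
  obtain A2 where A2: "A2 \<in> sets ?PM" "1 - \<delta> \<le> measure ?PM A2"
    and up: "\<And>x r u. x \<in> A2 \<Longrightarrow> (\<Sum>j<n. (cmod (\<Sum>i<r. u i * e (m + i) (x (Suc j))))\<^sup>2)
      \<le> 14 * real n * M / \<delta> * (\<Sum>i<r. (cmod (u i))\<^sup>2)"
  proof (rule E.good_upper_event[OF n m delta(1) d3])
    show "lam m \<le> M" "ln (8 * real n) / real n * spectral_T D e m \<le> M" by (simp_all add: M_def)
  qed (rule that)
  have Xm: "X j \<in> measurable P \<rho>" if "j \<in> {1..n}" for j
    using indep that unfolding P.indep_vars_def by auto
  define Y where "Y \<omega> = (\<lambda>j\<in>{1..n}. X j \<omega>)" for \<omega>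
  have Ym: "Y \<in> measurable P ?PM" unfolding Y_def using Xm by (intro measurable_restrict)
  have "distr P ?PM Y = (\<Pi>\<^sub>M j\<in>{1..n}. distr P \<rho> (X j))"
    unfolding Y_def using P.indep_vars_iff_distr_eq_PiM'[of "{1..n}" X "\<lambda>_. \<rho>"] Xm indep n by auto
  also have "\<dots> = ?PM" by (intro PiM_cong) (simp_all add: distr)
  finally have dY: "distr P ?PM Y = ?PM" .
  let ?A = "A1 \<inter> A2"
  have A: "?A \<in> sets ?PM" using A1 A2 by auto
  have "1 - 2 * \<delta> \<le> measure ?PM ?A"
  proof -
    have "measure ?PM (A1 \<union> A2) = measure ?PM A1 + measure ?PM A2 - measure ?PM ?A"
      using A1(1) A2(1) by (intro measure_Un3) (simp_all only: PM.fmeasurable_eq_sets)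
    moreover have "measure ?PM (A1 \<union> A2) \<le> 1" by (rule PM.prob_le_1)
    ultimately show ?thesis using A1(2) A2(2) by linarith
  qed
  also have "measure ?PM ?A = measure P (Y -` ?A \<inter> space P)"
    using measure_distr[OF Ym A] dY by simp
  also have "\<dots> \<le> measure P {\<omega> \<in> space P.
            full_column_rank (lsq_matrix (L2_normalized lam e) m n (\<lambda>j. X j \<omega>)) \<and>
            lsq_worst_error_sq H ip \<rho> (L2_normalized lam e) m n (\<lambda>j. X j \<omega>)
              \<le> ennreal (29 / \<delta> * M)}" (is "_ \<le> measure P ?E")
  proof (rule P.finite_measure_mono_AE)
    show "?E \<in> sets P" by (rule E.lsq_event_measurable) (rule Xm, simp)
    \<comment> \<open>Outside a null set the eigenfunction expansions are valid at all nodes.\<close>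
    have "AE \<omega> in P. \<forall>f\<in>H. (\<lambda>k. E.proj (Suc k) f (X j \<omega>)) \<longlonglongrightarrow> f (X j \<omega>)" if j: "j \<in> {1..n}" for j
      by (rule AE_distrD[OF Xm[OF j]]) (unfold distr[OF j], rule E.AE_expansion)
    then have "AE \<omega> in P. \<forall>j\<in>{1..n}. \<forall>f\<in>H. (\<lambda>k. E.proj (Suc k) f (X j \<omega>)) \<longlonglongrightarrow> f (X j \<omega>)"
      by (rule AE_finite_allI[OF finite_atLeastAtMost])
    then show "AE \<omega> in P. \<omega> \<in> Y -` ?A \<inter> space P \<longrightarrow> \<omega> \<in> ?E"
    proof eventually_elim
      case (elim \<omega>)
      show ?case
      proof
        assume \<omega>: "\<omega> \<in> Y -` ?A \<inter> space P"
        have Yj: "Y \<omega> (Suc j) = X (Suc j) \<omega>" if "j < n" for j using that by (simp add: Y_def)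
        have l: "real n / 2 * (\<Sum>i<m-1. (cmod (u i))\<^sup>2)
            \<le> (\<Sum>j<n. (cmod (\<Sum>i<m-1. u i * L2_normalized lam e (Suc i) (X (Suc j) \<omega>)))\<^sup>2)" for u
          using low[of "Y \<omega>" u] \<omega> by (simp add: Yj)
        have u: "(\<Sum>j<n. (cmod (\<Sum>i<r. u i * e (m + i) (X (Suc j) \<omega>)))\<^sup>2)
            \<le> 14 * real n * M / \<delta> * (\<Sum>i<r. (cmod (u i))\<^sup>2)" for r u
          using up[of "Y \<omega>" u r] \<omega> by (simp add: Yj)
        have s: "0 \<le> 14 * real n * M / \<delta>" using M0 delta by simp
        have nodes: "(\<lambda>k. E.proj (Suc k) f (X (Suc j) \<omega>)) \<longlonglongrightarrow> f (X (Suc j) \<omega>)" if "j < n" "f \<in> H" for j f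
          using elim that by simp
        \<comment> \<open>\<open>29 = 1 + 28\<close>, with \<open>\<lambda>\<^sub>m \<le> M \<le> M / \<delta>\<close> for the first summand.\<close>
        have "lam m + 2 / real n * (14 * real n * M / \<delta>) \<le> 29 / \<delta> * M"
        proof -
          have "\<delta> * lam m \<le> 1 * M" using delta M0 E.lam_pos[OF m] by (intro mult_mono) (simp_all add: M_def)
          then show ?thesis using delta n by (simp add: field_simps)
        qed
        then have "lsq_worst_error_sq H ip \<rho> (L2_normalized lam e) m n (\<lambda>j. X j \<omega>) \<le> ennreal (29 / \<delta> * M)"
          using E.lsq_worst_error_bound(2)[of m n "14 * real n * M / \<delta>" "\<lambda>j. X j \<omega>", OF m n s nodes l u]
          by (meson ennreal_leI order_trans)
        then show "\<omega> \<in> ?E"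
          using E.lsq_worst_error_bound(1)[of m n "14 * real n * M / \<delta>" "\<lambda>j. X j \<omega>", OF m n s nodes l u] \<omega>
          by (simp add: det_gram_iff_full_column_rank[OF lsq_matrix_carrier])
      qed
    qed
  qed
  finally show ?thesis unfolding sing M_def[symmetric] using delta by simp
qed

end
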